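(* Let $(R,F)$ be the additive formal group law and let $Q$ be any quiver without edge loops. The assignment $$Y_\hbar^+(\mathfrak g_Q)\ni x^+_{k,r}\mapsto(\lambda^{(k)})^r\in\mathcal{SH}_{e_k}\qquad(k\in I,\ r\in\mathbb N)$$ extends to a well-defined algebra homomorphism $Y_\hbar^+(\mathfrak g_Q)\to\widetilde{\mathcal{SH}}|_{t_1=t_2=\hbar/2}$.
   Context: $R$ is a commutative $\mathbb Q$-algebra. $Q=(I,H)$ is a finite quiver; $h\in H$ goes from $\mathrm{out}(h)$ to $\mathrm{in}(h)$; $a_{kl}$ is the number of arrows in $H$ from $k$ to $l$; $c_{kk}=2$ and $c_{kl}=-a_{kl}-a_{lk}$ for $k\ne l$; $\mathfrak g_Q$ is the symmetric Kac–Moody Lie algebra with Cartan matrix $(c_{kl})$. For any pair of vertices $i,j$, if $h_1,\dots,h_a$ are the arrows from $i$ to $j$, put $m_{h_p}=a+2-2p$, $m_{h_p^*}=-a+2p$. **Positive half of the Yangian.** $Y_\hbar^+(\mathfrak g_Q)$ is the $\mathbb Q[\hbar]$-algebra generated by $x^+_{k,r}$ ($k\in I,r\in\mathbb N$) subject to the relations, in terms of $x_k^+(u)=\hbar\sum_{r\ge0}x^+_{k,r}u^{-r-1}$: $$(u-v-\tfrac{\hbar c_{kl}}2)x_k^+(u)x_l^+(v)=(u-v+\tfrac{\hbar c_{kl}}2)x_l^+(v)x_k^+(u)+\hbar\big([x^+_{k,0},x_l^+(v)]-[x_k^+(u),x^+_{l,0}]\big)\quad(k,l\in I),$$ $$\sum_{\sigma\in\mathfrak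 S_{1-c_{kl}}}[x_k^+(u_{\sigma(1)}),[x_k^+(u_{\sigma(2)}),[\cdots,[x_k^+(u_{\sigma(1-c_{kl})}),x_l^+(v)]\cdots]]]=0\quad(k\ne l\in I)$$ (interpreted as relations in the $x^+_{k,r}$ themselves, i.e. after removing common powers of $\hbar$). **Twisted shuffle algebra at $t_1=t_2=\hbar/2$.** For $v\in\mathbb N^I$, $\mathfrak S_v=\prod_i\mathfrak S_{v^i}$ and $\mathcal{SH}_v=R[\hbar][\lambda^i_s]^{\mathfrak S_v}_{i\in I,1\le s\le v^i}$; for $v=e_k$ (the $k$-th unit vector) $\mathcal{SH}_{e_k}=R[\hbar][\lambda^{(k)}]$. For $f_1(\lambda')\in\mathcal{SH}_{v_1}$, $f_2(\lambda'')\in\mathcal{SH}_{v_2}$, put $\lambda'^i_s=\lambda^i_s$, $\lambda''^i_t=\lambda^i_{t+v_1^i}$ and $$f_1*f_2=(-1)^{(v_2,\overline Cv_1)+1}\sum_{\sigma\in\mathrm{Sh}(v_1,v_2)}\sigma\big(f_1f_2\,\mathrm{fac}_1\,\mathrm{fac}_2\big),\qquad \mathrm{fac}_1=\prod_{i\in I}\prod_{s=1}^{v_1^i}\prod_{t=1}^{v_2^i}\frac{\lambda'^i_s-\lambda''^i_t+\hbar}{\lambda''^i_t-\lambda'^i_s},$$ $$\mathrm{fac}_2=\prod_{h\in H}\Big(\prod_{s=1}^{v_1^{\mathrm{out}(h)}}\prod_{t=1}^{v_2^{\mathrm{in}(h)}}\big(\lambda''^{\mathrm{in}(h)}_t-\lambda'^{\mathrm{out}(h)}_s+m_h\tfrac\hbar2\big)\prod_{s=1}^{v_1^{\mathrm{in}(h)}}\prod_{t=1}^{v_2^{\mathrm{out}(h)}}\big(\lambda''^{\mathrm{out}(h)}_t-\lambda'^{\mathrm{in}(h)}_s+m_{h^*}\tfrac\hbar2\big)\Big).$$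 Here $\mathrm{Sh}(v_1,v_2)=\prod_i\mathrm{Sh}(v_1^i,v_2^i)\subset\mathfrak S_{v_1+v_2}$ is the set of shuffles, $(\cdot,\cdot)$ is the standard inner product, and $\overline C$ is the matrix with $\overline C_{kl}=\delta_{kl}-a_{kl}$. $\widetilde{\mathcal{SH}}|_{t_1=t_2=\hbar/2}=\bigoplus_v\mathcal{SH}_v$ with this product is an associative algebra whose unit is $-1\in\mathcal{SH}_0$.
   Formalization: If arrows run both ways between i and j, the weights m_h, m_{h*} are taken with a the total number of arrows between i and j, numbered jointly; with a counting only the arrows from i to j the quadratic relation fails (already for one arrow each way). R is assumed nonzero. *)

theory Defs
  imports
    "Graph_Theory.Digraph"
    "HOL-Library.Poly_Mapping"
    "HOL-Computational_Algebra.Polynomial"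
    "HOL-Combinatorics.Permutations"
    "HOL-Algebra.QuotRing"
    "HOL-Algebra.Module"
begin

hide_const (open) Modules.module

section \<open>Associative algebras\<close>

definition type_ring :: "'a::ring_1 ring" where
  "type_ring = \<lparr>carrier = UNIV, mult = (*), one = 1, zero = 0, add = (+)\<rparr>"

text \<open>The locale \<open>algebra\<close> of the library is restricted to commutative algebras.\<close>

definition assoc_algebra :: "('k, 'm) ring_scheme \<Rightarrow> ('k, 'a, 'n) module_scheme \<Rightarrow> bool" where
  "assoc_algebra K A \<longleftrightarrow> Module.module K A \<and> ring A \<and>
     (\<forall>c\<in>carrier K. \<forall>x\<in>carrier A. \<forall>y\<in>carrier A.
        (c \<odot>\<^bsub>A\<^esub> x) \<otimes>\<^bsub>A\<^esub> y = c \<odot>\<^bsub>A\<^esub> (x \<otimes>\<^bsub>A\<^esub> y) \<and>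
        x \<otimes>\<^bsub>A\<^esub> (c \<odot>\<^bsub>A\<^esub> y) = c \<odot>\<^bsub>A\<^esub> (x \<otimes>\<^bsub>A\<^esub> y))"

definition algebra_hom ::
  "('k, 'm) ring_scheme \<Rightarrow> ('k, 'a, 'n) module_scheme \<Rightarrow> ('k, 'b, 'o) module_scheme \<Rightarrow> ('a \<Rightarrow> 'b) \<Rightarrow> bool" where
  "algebra_hom K A B \<phi> \<longleftrightarrow> assoc_algebra K A \<and> assoc_algebra K B \<and> \<phi> \<in> ring_hom A B \<and>
     (\<forall>c\<in>carrier K. \<forall>x\<in>carrier A. \<phi> (c \<odot>\<^bsub>A\<^esub> x) = c \<odot>\<^bsub>B\<^esub> \<phi> x)"

definition algebra_quot :: "('k, 'a, 'n) module_scheme \<Rightarrow> 'a set \<Rightarrow> ('k, 'a set) module" where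
  "algebra_quot A J = ring.extend (A Quot J)
     \<lparr>smult = (\<lambda>c X. \<Union>x\<in>X. J +>\<^bsub>A\<^esub> (c \<odot>\<^bsub>A\<^esub> x))\<rparr>"


section \<open>Free algebras\<close>

text \<open>The free monoid on \<open>'x\<close>, written additively, so that \<open>'x free_monoid \<Rightarrow>\<^sub>0 'k\<close> is the
  monoid algebra of words, i.e. the free associative \<open>'k\<close>-algebra on \<open>'x\<close>.\<close>

datatype 'x free_monoid = Word (letters: "'x list")

instantiation free_monoid :: (type) monoid_add
begin

definition zero_free_monoid :: "'x free_monoid" where
  "zero_free_monoid = Word []"

definition plus_free_monoid :: "'x free_monoid \<Rightarrow> 'x free_monoid \<Rightarrow> 'x free_monoid" where
  "plus_free_monoid v w = Word (letters v @ letters w)"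

instance
  by standard (auto simp: zero_free_monoid_def plus_free_monoid_def)

end

definition comm :: "'a::ring \<Rightarrow> 'a \<Rightarrow> 'a" where
  "comm x y = x * y - y * x"


section \<open>The total ring of fractions of a commutative ring\<close>

definition regular :: "'a::comm_ring_1 \<Rightarrow> bool" where
  "regular b \<longleftrightarrow> (\<forall>x. b * x = 0 \<longrightarrow> x = 0)"

definition tfrac_rel :: "'a::comm_ring_1 \<times> 'a \<Rightarrow> 'a \<times> 'a \<Rightarrow> bool" where
  "tfrac_rel x y \<longleftrightarrow> regular (snd x) \<and> regular (snd y) \<and> fst x * snd y = fst y * snd x"

lemma tfrac_relI:
  "regular (snd x) \<Longrightarrow> regular (snd y) \<Longrightarrow> fst x * snd y = fst y * snd x \<Longrightarrow> tfrac_rel x y"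
  by (simp only: tfrac_rel_def)

lemma tfrac_relD:
  assumes "tfrac_rel x y"
  shows "regular (snd x)" "regular (snd y)" "fst x * snd y = fst y * snd x"
  using assms by (simp_all only: tfrac_rel_def)

lemma regular_1: "regular 1"
  by (simp add: regular_def)

lemma regular_mult: "regular a \<Longrightarrow> regular b \<Longrightarrow> regular (a * b)"
  unfolding regular_def by (metis mult.assoc)

lemma regular_cancel: "regular b \<Longrightarrow> b * x = b * y \<Longrightarrow> x = y"
  unfolding regular_def by (metis right_diff_distrib eq_iff_diff_eq_0)

lemma tfrac_rel_Pair:
  "tfrac_rel (a, b) (c, d) \<longleftrightarrow> regular b \<and> regular d \<and> a * d = c * b"
  by (simp only: tfrac_rel_def fst_conv snd_conv)

lemma tfrac_rel_refl: "tfrac_rel (a, b) (a, b) \<longleftrightarrow> regular b"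
  by (simp add: tfrac_rel_def)

lemma part_equivp_tfrac_rel: "part_equivp (tfrac_rel :: 'a::comm_ring_1 \<times> 'a \<Rightarrow> _)"
proof (rule part_equivpI)
  show "\<exists>x :: 'a \<times> 'a. tfrac_rel x x"
    by (rule exI[of _ "(0, 1)"]) (simp add: tfrac_rel_def regular_1)
  show "symp (tfrac_rel :: 'a \<times> 'a \<Rightarrow> _)"
    by (simp add: symp_def tfrac_rel_def)
  show "transp (tfrac_rel :: 'a \<times> 'a \<Rightarrow> _)"
  proof (rule transpI)
    fix x y z :: "'a \<times> 'a"
    assume xy: "tfrac_rel x y" and yz: "tfrac_rel y z"
    have "snd y * (fst x * snd z) = (fst x * snd y) * snd z"
      by (simp add: ac_simps)
    also have "\<dots> = (fst y * snd z) * snd x"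
      unfolding tfrac_relD(3)[OF xy] by (simp only: ac_simps)
    also have "\<dots> = snd y * (fst z * snd x)"
      unfolding tfrac_relD(3)[OF yz] by (simp only: ac_simps)
    finally have "fst x * snd z = fst z * snd x"
      by (rule regular_cancel[OF tfrac_relD(2)[OF xy]])
    then show "tfrac_rel x z"
      by (rule tfrac_relI[OF tfrac_relD(1)[OF xy] tfrac_relD(2)[OF yz]])
  qed
qed

quotient_type (overloaded) 'a tfrac = "'a::comm_ring_1 \<times> 'a" / partial: tfrac_rel
  by (rule part_equivp_tfrac_rel)

text \<open>As with \<open>x / 0 = 0\<close> in a field, a denominator that is a zero divisor gives the fraction 0.\<close>

lift_definition TFrac :: "'a::comm_ring_1 \<Rightarrow> 'a \<Rightarrow> 'a tfrac"
  is "\<lambda>a b. if regular b then (a, b) else (0, 1)"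
  by (simp add: tfrac_rel_def regular_1)

instantiation tfrac :: (comm_ring_1) comm_ring_1
begin

lift_definition zero_tfrac :: "'a tfrac" is "(0, 1)"
  by (simp add: tfrac_rel_def regular_1)

lift_definition one_tfrac :: "'a tfrac" is "(1, 1)"
  by (simp add: tfrac_rel_def regular_1)

lift_definition plus_tfrac :: "'a tfrac \<Rightarrow> 'a tfrac \<Rightarrow> 'a tfrac"
  is "\<lambda>x y. (fst x * snd y + fst y * snd x, snd x * snd y)"
proof -
  fix x x' y y' :: "'a \<times> 'a"
  assume x: "tfrac_rel x x'" and y: "tfrac_rel y y'"
  have "(fst x * snd y + fst y * snd x) * (snd x' * snd y')
      = (fst x * snd x') * (snd y * snd y') + (fst y * snd y') * (snd x * snd x')"
    by (simp add: algebra_simps)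
  also have "\<dots> = (fst x' * snd x) * (snd y * snd y') + (fst y' * snd y) * (snd x * snd x')"
    by (simp only: tfrac_relD(3)[OF x] tfrac_relD(3)[OF y])
  also have "\<dots> = (fst x' * snd y' + fst y' * snd x') * (snd x * snd y)"
    by (simp add: algebra_simps)
  finally have eq: "(fst x * snd y + fst y * snd x) * (snd x' * snd y')
      = (fst x' * snd y' + fst y' * snd x') * (snd x * snd y)" .
  show "tfrac_rel (fst x * snd y + fst y * snd x, snd x * snd y)
      (fst x' * snd y' + fst y' * snd x', snd x' * snd y')"
    unfolding tfrac_rel_Pair
    using eq tfrac_relD(1,2)[OF x] tfrac_relD(1,2)[OF y] by (blast intro: regular_mult)
qed

lift_definition uminus_tfrac :: "'a tfrac \<Rightarrow> 'a tfrac" is "\<lambda>x. (- fst x, snd x)"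
  by (simp only: tfrac_rel_def fst_conv snd_conv mult_minus_left)

definition minus_tfrac :: "'a tfrac \<Rightarrow> 'a tfrac \<Rightarrow> 'a tfrac" where
  "minus_tfrac x y = x + - y"

lift_definition times_tfrac :: "'a tfrac \<Rightarrow> 'a tfrac \<Rightarrow> 'a tfrac"
  is "\<lambda>x y. (fst x * fst y, snd x * snd y)"
proof -
  fix x x' y y' :: "'a \<times> 'a"
  assume x: "tfrac_rel x x'" and y: "tfrac_rel y y'"
  have "(fst x * fst y) * (snd x' * snd y') = (fst x * snd x') * (fst y * snd y')"
    by (simp add: ac_simps)
  also have "\<dots> = (fst x' * snd x) * (fst y' * snd y)"
    by (simp only: tfrac_relD(3)[OF x] tfrac_relD(3)[OF y])
  also have "\<dots> = (fst x' * fst y') * (snd x * snd y)"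
    by (simp add: ac_simps)
  finally have eq: "(fst x * fst y) * (snd x' * snd y') = (fst x' * fst y') * (snd x * snd y)" .
  show "tfrac_rel (fst x * fst y, snd x * snd y) (fst x' * fst y', snd x' * snd y')"
    unfolding tfrac_rel_Pair
    using eq tfrac_relD(1,2)[OF x] tfrac_relD(1,2)[OF y] by (blast intro: regular_mult)
qed

instance
proof
  fix a b c :: "'a tfrac"
  show "a * b * c = a * (b * c)"
    by transfer (auto intro!: tfrac_relI regular_mult regular_1 simp: tfrac_rel_refl algebra_simps)
  show "a * b = b * a"
    by transfer (auto intro!: tfrac_relI regular_mult regular_1 simp: tfrac_rel_refl algebra_simps)
  show "1 * a = a"
    by transfer (auto intro!: tfrac_relI regular_mult regular_1 simp: tfrac_rel_refl algebra_simps)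
  show "a + b + c = a + (b + c)"
    by transfer (auto intro!: tfrac_relI regular_mult regular_1 simp: tfrac_rel_refl algebra_simps)
  show "a + b = b + a"
    by transfer (auto intro!: tfrac_relI regular_mult regular_1 simp: tfrac_rel_refl algebra_simps)
  show "0 + a = a"
    by transfer (auto intro!: tfrac_relI regular_mult regular_1 simp: tfrac_rel_refl algebra_simps)
  show "- a + a = 0"
    by transfer (auto intro!: tfrac_relI regular_mult regular_1 simp: tfrac_rel_refl algebra_simps)
  show "a - b = a + - b"
    by (simp only: minus_tfrac_def)
  show "(a + b) * c = a * c + b * c"
    by transfer (auto intro!: tfrac_relI regular_mult regular_1 simp: tfrac_rel_refl algebra_simps)
  show "(0 :: 'a tfrac) \<noteq> 1"
    by transfer (auto dest: tfrac_relD(3))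
qed

end

definition to_tfrac :: "'a::comm_ring_1 \<Rightarrow> 'a tfrac" where
  "to_tfrac a = TFrac a 1"


section \<open>Quivers\<close>

text \<open>A finite quiver is a \<open>fin_digraph\<close>, with \<open>tail\<close> and \<open>head\<close> for \<open>out\<close> and \<open>in\<close>.\<close>

definition num_arrows :: "('i, 'h) pre_digraph \<Rightarrow> 'i \<Rightarrow> 'i \<Rightarrow> nat" where
  "num_arrows Q k l = card {h \<in> arcs Q. tail Q h = k \<and> head Q h = l}"

definition cartan :: "('i, 'h) pre_digraph \<Rightarrow> 'i \<Rightarrow> 'i \<Rightarrow> int" where
  "cartan Q k l = (if k = l then 2 else - int (num_arrows Q k l) - int (num_arrows Q l k))"

definition Cbar :: "('i, 'h) pre_digraph \<Rightarrow> 'i \<Rightarrow> 'i \<Rightarrow> int" where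
  "Cbar Q k l = (if k = l then 1 else 0) - int (num_arrows Q k l)"

text \<open>
  The weights \<open>m\<^sub>h, m\<^sub>h\<^sub>*\<close>.  For a pair of vertices \<open>i, j\<close> let \<open>h\<^sub>1, \<dots>, h\<^sub>a\<close> be the arrows from \<open>i\<close> to \<open>j\<close>
  in the double quiver \<open>H \<squnion> H*\<close> (the \<open>h\<close> from \<open>i\<close> to \<open>j\<close> and the \<open>h*\<close> with \<open>h\<close> from \<open>j\<close> to \<open>i\<close>); the
  weight of \<open>h\<^sub>p\<close> is \<open>a + 2 - 2p\<close> and that of \<open>(h\<^sub>p)*\<close> is \<open>- a + 2p\<close>, where \<open>h** = h\<close>.  Listing the
  arrows from \<open>j\<close> to \<open>i\<close> as \<open>(h\<^sub>a)*, \<dots>, (h\<^sub>1)*\<close> gives the same weights.  The function \<open>pos\<close> below is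
  the position \<open>p\<close> of \<open>h \<in> H\<close> in the list for \<open>(tail h, head h)\<close>, so \<open>h*\<close> has position
  \<open>a + 1 - pos h\<close> in the list for \<open>(head h, tail h)\<close>.

  If the arrows of \<open>H\<close> between \<open>i\<close> and \<open>j\<close> all go from \<open>i\<close> to \<open>j\<close>, then \<open>a\<close> is the number of arrows
  of \<open>H\<close> from \<open>i\<close> to \<open>j\<close> and \<open>pos\<close> is an arbitrary enumeration of these by \<open>1, \<dots>, a\<close>.
  If \<open>H\<close> has arrows in both directions, numbering the two directions independently of each other
  is not an option: the Yangian relation between \<open>x\<^sub>i(u)\<close> and \<open>x\<^sub>j(v)\<close> then fails in the shuffle
  algebra, already for one arrow in each direction.
\<close>

definition num_double_arrows :: "('i, 'h) pre_digraph \<Rightarrow> 'i \<Rightarrow> 'i \<Rightarrow> nat" where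
  "num_double_arrows Q i j = num_arrows Q i j + num_arrows Q j i"

definition arrow_numbering :: "('i, 'h) pre_digraph \<Rightarrow> ('h \<Rightarrow> nat) \<Rightarrow> bool" where
  "arrow_numbering Q pos \<longleftrightarrow> (\<forall>i\<in>verts Q. \<forall>j\<in>verts Q.
     bij_betw (\<lambda>h. if tail Q h = i then pos h else num_double_arrows Q i j + 1 - pos h)
       {h \<in> arcs Q. (tail Q h = i \<and> head Q h = j) \<or> (tail Q h = j \<and> head Q h = i)}
       {1..num_double_arrows Q i j})"

definition weight :: "('i, 'h) pre_digraph \<Rightarrow> ('h \<Rightarrow> nat) \<Rightarrow> 'h \<Rightarrow> int" where
  "weight Q pos h = int (num_double_arrows Q (tail Q h) (head Q h)) + 2 - 2 * int (pos h)"

definition weight_star :: "('i, 'h) pre_digraph \<Rightarrow> ('h \<Rightarrow> nat) \<Rightarrow> 'h \<Rightarrow> int" where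
  "weight_star Q pos h = - int (num_double_arrows Q (tail Q h) (head Q h)) + 2 * int (pos h)"


section \<open>The positive half of the Yangian\<close>

definition hbar :: "rat poly" where
  "hbar = [:0, 1:]"

type_synonym 'i yfree = "('i \<times> nat) free_monoid \<Rightarrow>\<^sub>0 rat poly"

definition free_yangian :: "('i, 'h) pre_digraph \<Rightarrow> (rat poly, 'i yfree) module" where
  "free_yangian Q =
     \<lparr>carrier = {f. \<forall>w\<in>Poly_Mapping.keys f. fst ` set (letters w) \<subseteq> verts Q},
      mult = (*), one = 1, zero = 0, add = (+),
      smult = (\<lambda>c f. Poly_Mapping.single 0 c * f)\<rparr>"

definition xfree :: "'i \<Rightarrow> nat \<Rightarrow> 'i yfree" where
  "xfree k r = Poly_Mapping.single (Word [(k, r)]) 1"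

text \<open>\<open>xser k n\<close> is the coefficient of \<open>u\<^sup>n\<close> in \<open>\<hbar>\<^sup>-\<^sup>1 x\<^sub>k(u) = \<Sum>r. x\<^sub>k\<^sub>,\<^sub>r u\<^sup>-\<^sup>r\<^sup>-\<^sup>1\<close>.\<close>

definition xser :: "'i \<Rightarrow> int \<Rightarrow> 'i yfree" where
  "xser k n = (if n < 0 then xfree k (nat (- n - 1)) else 0)"

text \<open>\<open>quad_rel Q k l m n\<close> is the coefficient of \<open>u\<^sup>m v\<^sup>n\<close> in the difference of the two sides of the
  quadratic relation, divided by the common factor \<open>\<hbar>\<^sup>2\<close>.\<close>

definition quad_rel :: "('i, 'h) pre_digraph \<Rightarrow> 'i \<Rightarrow> 'i \<Rightarrow> int \<Rightarrow> int \<Rightarrow> 'i yfree" where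
  "quad_rel Q k l m n =
     (let hc = Poly_Mapping.single 0 (Polynomial.smult (of_int (cartan Q k l) / 2) hbar) in
       (xser k (m - 1) * xser l n - xser k m * xser l (n - 1) - hc * xser k m * xser l n)
       - (xser l n * xser k (m - 1) - xser l (n - 1) * xser k m + hc * xser l n * xser k m)
       - ((if m = 0 then comm (xfree k 0) (xser l n) else 0)
          - (if n = 0 then comm (xser k m) (xfree l 0) else 0)))"

text \<open>Likewise the coefficient of \<open>v\<^sup>-\<^sup>s\<^sup>-\<^sup>1\<close> times the product of the \<open>(u\<^sub>p)\<close> to the powers
  \<open>- r(p) - 1\<close>, \<open>1 \<le> p \<le> N = 1 - c\<^sub>k\<^sub>l\<close>, in the Serre relation, divided by \<open>\<hbar>\<^sup>N\<^sup>+\<^sup>1\<close>.\<close>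

definition serre_rel :: "('i, 'h) pre_digraph \<Rightarrow> 'i \<Rightarrow> 'i \<Rightarrow> (nat \<Rightarrow> nat) \<Rightarrow> nat \<Rightarrow> 'i yfree" where
  "serre_rel Q k l r s =
     (let N = nat (1 - cartan Q k l) in
       \<Sum>\<sigma> | \<sigma> permutes {1..N}.
         foldr (\<lambda>p z. comm (xfree k (r (\<sigma> p))) z) [1..<Suc N] (xfree l s))"

definition yangian_rels :: "('i, 'h) pre_digraph \<Rightarrow> 'i yfree set" where
  "yangian_rels Q =
     {quad_rel Q k l m n | k l m n. k \<in> verts Q \<and> l \<in> verts Q} \<union>
     {serre_rel Q k l r s | k l r s. k \<in> verts Q \<and> l \<in> verts Q \<and> k \<noteq> l}"

definition yangian_ideal :: "('i, 'h) pre_digraph \<Rightarrow> 'i yfree set" where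
  "yangian_ideal Q = Idl\<^bsub>free_yangian Q\<^esub> (yangian_rels Q)"

definition yangian :: "('i, 'h) pre_digraph \<Rightarrow> (rat poly, 'i yfree set) module" where
  "yangian Q = algebra_quot (free_yangian Q) (yangian_ideal Q)"

definition xgen :: "('i, 'h) pre_digraph \<Rightarrow> 'i \<Rightarrow> nat \<Rightarrow> 'i yfree set" where
  "xgen Q k r = yangian_ideal Q +>\<^bsub>free_yangian Q\<^esub> xfree k r"


section \<open>The shuffle algebra\<close>

text \<open>\<open>('i, 'r) mpol\<close> is \<open>R[\<hbar>][\<lambda>\<^sup>i\<^sub>s]\<close> with a variable for every pair \<open>(i, s)\<close>.  The \<open>\<rat>\<close>-algebra
  structure of \<open>R\<close> is a ring homomorphism \<open>q\<close> from \<open>\<rat>\<close>; \<open>scal q\<close> is the induced homomorphism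
  from \<open>\<rat>[\<hbar>]\<close>.\<close>

type_synonym ('i, 'r) mpol = "(('i \<times> nat) \<Rightarrow>\<^sub>0 nat) \<Rightarrow>\<^sub>0 'r poly"

definition scal :: "(rat \<Rightarrow> 'r::comm_ring_1) \<Rightarrow> rat poly \<Rightarrow> ('i, 'r) mpol" where
  "scal q c = Poly_Mapping.single 0 (map_poly q c)"

definition lam :: "'i \<Rightarrow> nat \<Rightarrow> ('i, 'r::comm_ring_1) mpol" where
  "lam i s = Poly_Mapping.single (Poly_Mapping.single (i, s) 1) 1"

definition subst :: "('i \<Rightarrow> nat \<Rightarrow> ('i, 'r) mpol) \<Rightarrow> ('i, 'r) mpol \<Rightarrow> ('i, 'r::comm_ring_1) mpol" where
  "subst y f = (\<Sum>m\<in>Poly_Mapping.keys f. Poly_Mapping.single 0 (Poly_Mapping.lookup f m) *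
     (\<Prod>(i, s)\<in>Poly_Mapping.keys m. y i s ^ Poly_Mapping.lookup m (i, s)))"

type_synonym 'i dimvec = "'i \<Rightarrow>\<^sub>0 nat"

definition SH :: "'i dimvec \<Rightarrow> ('i, 'r::comm_ring_1) mpol set" where
  "SH v = {f. (\<forall>m\<in>Poly_Mapping.keys f. Poly_Mapping.keys m \<subseteq>
                 {(i, s). 1 \<le> s \<and> s \<le> Poly_Mapping.lookup v i}) \<and>
              (\<forall>\<sigma>. (\<forall>i. \<sigma> i permutes {1..Poly_Mapping.lookup v i}) \<longrightarrow>
                 subst (\<lambda>i s. lam i (\<sigma> i s)) f = f)}"

definition shuffles :: "'i dimvec \<Rightarrow> 'i dimvec \<Rightarrow> ('i \<Rightarrow> nat \<Rightarrow> nat) set" where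
  "shuffles v1 v2 = {\<sigma>. \<forall>i.
     let a = Poly_Mapping.lookup v1 i; b = Poly_Mapping.lookup v2 i in
       \<sigma> i permutes {1..a + b} \<and>
       strict_mono_on {1..a} (\<sigma> i) \<and> strict_mono_on {a + 1..a + b} (\<sigma> i)}"

text \<open>In \<open>fac1\<close> and \<open>fac2\<close> the arguments \<open>x\<close> and \<open>y\<close> stand for the variables \<open>\<lambda>'\<close> and \<open>\<lambda>''\<close>.\<close>

definition fac1 ::
  "(rat \<Rightarrow> 'r::comm_ring_1) \<Rightarrow> ('i, 'h) pre_digraph \<Rightarrow> 'i dimvec \<Rightarrow> 'i dimvec \<Rightarrow>
     ('i \<Rightarrow> nat \<Rightarrow> ('i, 'r) mpol) \<Rightarrow> ('i \<Rightarrow> nat \<Rightarrow> ('i, 'r) mpol) \<Rightarrow> ('i, 'r) mpol tfrac" where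
  "fac1 q Q v1 v2 x y =
     (\<Prod>i\<in>verts Q. \<Prod>s=1..Poly_Mapping.lookup v1 i. \<Prod>t=1..Poly_Mapping.lookup v2 i.
        TFrac (x i s - y i t + scal q hbar) (y i t - x i s))"

definition fac2 ::
  "(rat \<Rightarrow> 'r::comm_ring_1) \<Rightarrow> ('i, 'h) pre_digraph \<Rightarrow> ('h \<Rightarrow> nat) \<Rightarrow> 'i dimvec \<Rightarrow> 'i dimvec \<Rightarrow>
     ('i \<Rightarrow> nat \<Rightarrow> ('i, 'r) mpol) \<Rightarrow> ('i \<Rightarrow> nat \<Rightarrow> ('i, 'r) mpol) \<Rightarrow> ('i, 'r) mpol" where
  "fac2 q Q pos v1 v2 x y =
     (\<Prod>h\<in>arcs Q.
       (\<Prod>s=1..Poly_Mapping.lookup v1 (tail Q h). \<Prod>t=1..Poly_Mapping.lookup v2 (head Q h).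
          y (head Q h) t - x (tail Q h) s + scal q (Polynomial.smult (of_int (weight Q pos h) / 2) hbar)) *
       (\<Prod>s=1..Poly_Mapping.lookup v1 (head Q h). \<Prod>t=1..Poly_Mapping.lookup v2 (tail Q h).
          y (tail Q h) t - x (head Q h) s + scal q (Polynomial.smult (of_int (weight_star Q pos h) / 2) hbar)))"

definition sh_sign :: "('i, 'h) pre_digraph \<Rightarrow> 'i dimvec \<Rightarrow> 'i dimvec \<Rightarrow> 'a::ring_1" where
  "sh_sign Q v1 v2 =
     (if even ((\<Sum>k\<in>verts Q. \<Sum>l\<in>verts Q.
         int (Poly_Mapping.lookup v2 k) * Cbar Q k l * int (Poly_Mapping.lookup v1 l)) + 1)
      then 1 else - 1)"

text \<open>The sum of fractions is the image of a unique polynomial.  The action of \<open>\<sigma>\<close> replaces \<open>\<lambda>\<^sup>i\<^sub>s\<close> by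
  the variable with index \<open>\<sigma>\<^sub>i(s)\<close>.\<close>

definition sh_mult ::
  "(rat \<Rightarrow> 'r::comm_ring_1) \<Rightarrow> ('i, 'h) pre_digraph \<Rightarrow> ('h \<Rightarrow> nat) \<Rightarrow> 'i dimvec \<Rightarrow> 'i dimvec \<Rightarrow>
     ('i, 'r) mpol \<Rightarrow> ('i, 'r) mpol \<Rightarrow> ('i, 'r) mpol" where
  "sh_mult q Q pos v1 v2 f1 f2 =
     (THE f. to_tfrac f = sh_sign Q v1 v2 * (\<Sum>\<sigma>\<in>shuffles v1 v2.
        let x = (\<lambda>i s. lam i (\<sigma> i s)); y = (\<lambda>i t. lam i (\<sigma> i (t + Poly_Mapping.lookup v1 i))) in
          to_tfrac (subst x f1 * subst y f2) * fac1 q Q v1 v2 x y * to_tfrac (fac2 q Q pos v1 v2 x y)))"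

definition shuffle_algebra ::
  "(rat \<Rightarrow> 'r::comm_ring_1) \<Rightarrow> ('i, 'h) pre_digraph \<Rightarrow> ('h \<Rightarrow> nat) \<Rightarrow>
     (rat poly, 'i dimvec \<Rightarrow>\<^sub>0 ('i, 'r) mpol) module" where
  "shuffle_algebra q Q pos =
     \<lparr>carrier = {F. \<forall>v\<in>Poly_Mapping.keys F.
                      Poly_Mapping.keys v \<subseteq> verts Q \<and> Poly_Mapping.lookup F v \<in> SH v},
      mult = (\<lambda>F G. \<Sum>v\<in>Poly_Mapping.keys F. \<Sum>w\<in>Poly_Mapping.keys G.
                Poly_Mapping.single (v + w)
                  (sh_mult q Q pos v w (Poly_Mapping.lookup F v) (Poly_Mapping.lookup G w))),
      one = Poly_Mapping.single 0 (- 1), zero = 0, add = (+),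
      smult = (\<lambda>c. Poly_Mapping.map (\<lambda>f. scal q c * f))\<rparr>"

end

theory Submission
  imports Defs "HOL-Combinatorics.Multiset_Permutations"
begin

text \<open>
  The proof regards an element of the shuffle algebra as a function of finite sets \<open>U\<close> of variables
  \<open>\<lambda>\<^sup>i\<^sub>s\<close>.  A polynomial in \<open>SH v\<close> is symmetric, so it can be evaluated at every set with \<open>v\<^sup>i\<close>
  variables of each colour \<open>i\<close>, in whatever order these are inserted.  A shuffle amounts to the choice
  of the set \<open>A \<subseteq> U\<close> of the variables that go to the first factor, and the factors \<open>fac1\<close>, \<open>fac2\<close> and
  the bilinear part of the sign are products over the pairs in \<open>A \<times> (U - A)\<close>.  So, up to a global
  sign, the shuffle product is a convolution
  \<open>(F * G)(U) = \<Sum>\<^sub>A F(A) G(U - A) \<Prod>\<^sub>a\<^sub>,\<^sub>b \<omega>(a, b)\<close>, where \<open>A\<close> runs through the subsets of \<open>U\<close>, \<open>a\<close>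
  through \<open>A\<close> and \<open>b\<close> through \<open>U - A\<close>.  Such a product is associative for every \<open>\<omega>\<close>, because both
  bracketings are sums over the ordered partitions of \<open>U\<close> into three blocks (\<open>conv_assoc\<close>).  The function
  belonging to an element is \<open>realize\<close>; it takes values in fractions and is injective on the shuffle
  algebra, so all identities can be checked after applying it.

  The product of two polynomials is a polynomial because a convolution at \<open>U\<close> is symmetric and has at
  most simple poles, along the loci where two variables of the same colour coincide.  Such a fraction
  has no poles if 2 is invertible (\<open>remove_denominators\<close>).

  The generators are functions supported on singletons.  For them the quadratic relation reduces to
  an identity between \<open>\<omega>(a, b)\<close> and \<open>\<omega>(b, a)\<close> (\<open>sh_kernel_exchange\<close>).  It holds because the weights
  of the arrows between two vertices form an arithmetic progression symmetric up to its ends, so that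
  \<open>\<omega>(a, b)\<close> and \<open>\<omega>(b, a)\<close> share all but one of their linear factors.

  For the Serre relation let \<open>N = - c\<^sub>k\<^sub>l\<close>.  The symmetrised \<open>n\<close>-fold bracket of generators of colour \<open>k\<close>
  with one of colour \<open>l\<close> is computed in closed form (\<open>sym_bracket_closed_form\<close>): it is the permanent of
  the values of the first, times the value of the second, times the linear factors shared by \<open>\<omega>(a, b)\<close>
  and \<open>\<omega>(b, a)\<close>, times the constant \<open>\<Prod> (j + 1) (N - j) \<hbar>\<close> over \<open>j < n\<close>.  This constant is 0 for
  \<open>n = N + 1\<close>.  The induction step evaluates a sum over the variables of colour \<open>k\<close> by partial fractions
  (\<open>sum_partial_fraction_products\<close>).
\<close>

abbreviation keys :: "('a \<Rightarrow>\<^sub>0 'b::zero) \<Rightarrow> 'a set" where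
  "keys \<equiv> Poly_Mapping.keys"

abbreviation lookup :: "('a \<Rightarrow>\<^sub>0 'b::zero) \<Rightarrow> 'a \<Rightarrow> 'b" where
  "lookup \<equiv> Poly_Mapping.lookup"

section \<open>Fractions\<close>

lemma TFrac_mult: "regular b \<Longrightarrow> regular d \<Longrightarrow> TFrac a b * TFrac c d = TFrac (a * c) (b * d)"
  by transfer (simp add: tfrac_rel_def regular_mult)

lemma TFrac_add: "regular b \<Longrightarrow> regular d \<Longrightarrow> TFrac a b + TFrac c d = TFrac (a * d + c * b) (b * d)"
  by transfer (simp add: tfrac_rel_def regular_mult)

lemma TFrac_eq_iff: "regular b \<Longrightarrow> regular d \<Longrightarrow> TFrac a b = TFrac c d \<longleftrightarrow> a * d = c * b"
  by transfer (simp add: tfrac_rel_def)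

lemma to_tfrac_0 [simp]: "to_tfrac 0 = 0"
  unfolding to_tfrac_def by transfer (simp add: tfrac_rel_def regular_1)

lemma to_tfrac_1 [simp]: "to_tfrac 1 = 1"
  unfolding to_tfrac_def by transfer (simp add: tfrac_rel_def regular_1)

lemma to_tfrac_add: "to_tfrac (a + b) = to_tfrac a + to_tfrac b"
  by (simp add: to_tfrac_def TFrac_add regular_1)

lemma to_tfrac_mult: "to_tfrac (a * b) = to_tfrac a * to_tfrac b"
  by (simp add: to_tfrac_def TFrac_mult regular_1)

lemma to_tfrac_eq_iff [simp]: "to_tfrac a = to_tfrac b \<longleftrightarrow> a = b"
  by (simp add: to_tfrac_def TFrac_eq_iff regular_1)

lemma to_tfrac_uminus: "to_tfrac (- a) = - to_tfrac a"
proof -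
  have "to_tfrac (- a) + to_tfrac a = 0"
    by (simp flip: to_tfrac_add)
  then show ?thesis
    by (simp add: eq_neg_iff_add_eq_0)
qed

lemma to_tfrac_diff: "to_tfrac (a - b) = to_tfrac a - to_tfrac b"
  using to_tfrac_add[of a "- b"] by (simp add: to_tfrac_uminus)

lemma to_tfrac_prod: "to_tfrac (prod f A) = (\<Prod>x\<in>A. to_tfrac (f x))"
  by (induction A rule: infinite_finite_induct) (simp_all add: to_tfrac_mult)

lemma to_tfrac_power: "to_tfrac (a ^ n) = to_tfrac a ^ n"
  by (induction n) (simp_all add: to_tfrac_mult)

lemma to_tfrac_of_int: "to_tfrac (of_int n) = of_int n"
proof -
  have "to_tfrac (of_nat m) = of_nat m" for m
    by (induction m) (simp_all add: to_tfrac_add)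
  then show ?thesis
    by (cases n) (simp_all add: to_tfrac_diff to_tfrac_uminus)
qed

lemma to_tfrac_mult_TFrac: "regular b \<Longrightarrow> to_tfrac b * TFrac a b = to_tfrac a"
  by (simp add: to_tfrac_def TFrac_mult TFrac_eq_iff regular_1 mult.commute)

lemma to_tfrac_cancel:
  assumes "regular b" and "to_tfrac b * x = to_tfrac b * y"
  shows "x = y"
proof -
  have "TFrac 1 b * to_tfrac b = 1"
    using to_tfrac_mult_TFrac[OF assms(1), of 1] by (simp add: mult.commute)
  then show ?thesis
    using arg_cong[OF assms(2), of "\<lambda>z. TFrac 1 b * z"] by (simp flip: mult.assoc)
qed

lemma regular_prod: "(\<And>x. x \<in> A \<Longrightarrow> regular (f x)) \<Longrightarrow> regular (prod f A)"
  by (induction A rule: infinite_finite_induct) (auto simp: regular_1 intro: regular_mult)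

definition is_hom :: "('a::comm_ring_1 \<Rightarrow> 'b::comm_ring_1) \<Rightarrow> bool" where
  "is_hom h \<longleftrightarrow> h 1 = 1 \<and> (\<forall>x y. h (x + y) = h x + h y \<and> h (x * y) = h x * h y)"

lemma is_homD:
  assumes "is_hom h"
  shows "h 1 = 1" "h (x + y) = h x + h y" "h (x * y) = h x * h y" "h 0 = 0"
    "h (- x) = - h x" "h (x - y) = h x - h y"
proof -
  show 1: "h 1 = 1" "h (x + y) = h x + h y" "h (x * y) = h x * h y" for x y
    using assms by (simp_all add: is_hom_def)
  have "h 0 = h 0 + h 0" using 1(2)[of 0 0] by simp
  then show 0: "h 0 = 0" by simp
  show m: "h (- x) = - h x" for x
    using 1(2)[of x "- x"] 0 by (simp add: eq_neg_iff_add_eq_0 add.commute)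
  show "h (x - y) = h x - h y"
    using 1(2)[of x "- y"] m by simp
qed

lemma is_hom_sum: "is_hom h \<Longrightarrow> h (sum f A) = (\<Sum>x\<in>A. h (f x))"
  by (induction A rule: infinite_finite_induct) (simp_all add: is_homD)

lemma is_hom_prod: "is_hom h \<Longrightarrow> h (prod f A) = (\<Prod>x\<in>A. h (f x))"
  by (induction A rule: infinite_finite_induct) (simp_all add: is_homD)

lemma is_hom_power: "is_hom h \<Longrightarrow> h (x ^ n) = h x ^ n"
  by (induction n) (simp_all add: is_homD)

lemma is_hom_of_int:
  assumes "is_hom h"
  shows "h (of_int n) = of_int n"
proof -
  have "h (of_nat m) = of_nat m" for m
    by (induction m) (simp_all add: is_homD[OF assms])
  then show ?thesis
    by (cases n) (simp_all add: is_homD[OF assms])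
qed

text \<open>A ring homomorphism does not act on all fractions, since it may send a denominator to a zero
  divisor.  Where it does act, its action is a partial function, described by this relation.\<close>

definition tfrac_lift :: "('a::comm_ring_1 \<Rightarrow> 'b::comm_ring_1) \<Rightarrow> 'a tfrac \<Rightarrow> 'b tfrac \<Rightarrow> bool" where
  "tfrac_lift h x y \<longleftrightarrow>
     (\<exists>a b. regular b \<and> regular (h b) \<and> x = TFrac a b \<and> y = TFrac (h a) (h b))"

context
  fixes h :: "'a::comm_ring_1 \<Rightarrow> 'b::comm_ring_1"
  assumes h: "is_hom h"
begin

lemma tfrac_lift_TFrac: "regular b \<Longrightarrow> regular (h b) \<Longrightarrow> tfrac_lift h (TFrac a b) (TFrac (h a) (h b))"
  by (auto simp: tfrac_lift_def)

lemma tfrac_lift_to_tfrac: "tfrac_lift h (to_tfrac a) (to_tfrac (h a))"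
  using tfrac_lift_TFrac[of 1 a] by (simp add: to_tfrac_def is_homD[OF h] regular_1)

lemma tfrac_lift_unique:
  assumes "tfrac_lift h x y" and "tfrac_lift h x z"
  shows "y = z"
proof -
  obtain a b where 1: "regular b" "regular (h b)" "x = TFrac a b" "y = TFrac (h a) (h b)"
    using assms(1) by (auto simp: tfrac_lift_def)
  obtain c d where 2: "regular d" "regular (h d)" "x = TFrac c d" "z = TFrac (h c) (h d)"
    using assms(2) by (auto simp: tfrac_lift_def)
  have "a * d = c * b"
    using 1 2 by (simp add: TFrac_eq_iff)
  then have "h a * h d = h c * h b"
    by (simp flip: is_homD(3)[OF h])
  with 1 2 show ?thesis
    by (simp add: TFrac_eq_iff)
qed

lemma tfrac_lift_add:
  assumes "tfrac_lift h x y" and "tfrac_lift h x' y'"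
  shows "tfrac_lift h (x + x') (y + y')"
proof -
  obtain a b where 1: "regular b" "regular (h b)" "x = TFrac a b" "y = TFrac (h a) (h b)"
    using assms(1) by (auto simp: tfrac_lift_def)
  obtain c d where 2: "regular d" "regular (h d)" "x' = TFrac c d" "y' = TFrac (h c) (h d)"
    using assms(2) by (auto simp: tfrac_lift_def)
  show ?thesis
    using tfrac_lift_TFrac[of "b * d" "a * d + c * b"] 1 2
    by (simp add: TFrac_add is_homD[OF h] regular_mult)
qed

lemma tfrac_lift_mult:
  assumes "tfrac_lift h x y" and "tfrac_lift h x' y'"
  shows "tfrac_lift h (x * x') (y * y')"
proof -
  obtain a b where 1: "regular b" "regular (h b)" "x = TFrac a b" "y = TFrac (h a) (h b)"
    using assms(1) by (auto simp: tfrac_lift_def)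
  obtain c d where 2: "regular d" "regular (h d)" "x' = TFrac c d" "y' = TFrac (h c) (h d)"
    using assms(2) by (auto simp: tfrac_lift_def)
  show ?thesis
    using tfrac_lift_TFrac[of "b * d" "a * c"] 1 2
    by (simp add: TFrac_mult is_homD[OF h] regular_mult)
qed

lemma tfrac_lift_0: "tfrac_lift h 0 0"
  using tfrac_lift_to_tfrac[of 0] by (simp add: is_homD[OF h])

lemma tfrac_lift_1: "tfrac_lift h 1 1"
  using tfrac_lift_to_tfrac[of 1] by (simp add: is_homD[OF h])

lemma tfrac_lift_sum:
  "(\<And>x. x \<in> A \<Longrightarrow> tfrac_lift h (f x) (g x)) \<Longrightarrow> tfrac_lift h (sum f A) (sum g A)"
  by (induction A rule: infinite_finite_induct) (auto intro: tfrac_lift_add tfrac_lift_0)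

lemma tfrac_lift_prod:
  "(\<And>x. x \<in> A \<Longrightarrow> tfrac_lift h (f x) (g x)) \<Longrightarrow> tfrac_lift h (prod f A) (prod g A)"
  by (induction A rule: infinite_finite_induct) (auto intro: tfrac_lift_mult tfrac_lift_1)

end

section \<open>Polynomials and substitutions\<close>

lemma poly_mapping_sum_single: "(\<Sum>m\<in>keys f. Poly_Mapping.single m (lookup f m)) = f"
  by (rule poly_mapping_eqI) (simp add: lookup_sum lookup_single when_def in_keys_iff sum.delta)

lemma mult_eq_sum_single:
  "f * g = (\<Sum>m\<in>keys f. \<Sum>n\<in>keys g.
     Poly_Mapping.single (m + n) (lookup f m * lookup g n))"
  by (subst (1) poly_mapping_sum_single[of f, symmetric], subst (1) poly_mapping_sum_single[of g, symmetric])
    (simp add: sum_product mult_single)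

definition monom_val :: "('i \<Rightarrow> nat \<Rightarrow> ('i, 'r) mpol) \<Rightarrow> ('i \<times> nat \<Rightarrow>\<^sub>0 nat) \<Rightarrow> ('i, 'r::comm_ring_1) mpol" where
  "monom_val y m = (\<Prod>(i, s)\<in>keys m. y i s ^ lookup m (i, s))"

lemma monom_val_superset:
  assumes "finite K" and "keys m \<subseteq> K"
  shows "monom_val y m = (\<Prod>x\<in>K. y (fst x) (snd x) ^ lookup m x)"
  unfolding monom_val_def case_prod_unfold prod.collapse
  using assms by (intro prod.mono_neutral_left) (auto simp: in_keys_iff)

lemma monom_val_add: "monom_val y (m + n) = monom_val y m * monom_val y n"
proof -
  have "keys (m + n) \<subseteq> keys m \<union> keys n"
    by (rule keys_add)
  then show ?thesis
    by (simp add: monom_val_superset[of "keys m \<union> keys n"]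
        lookup_add power_add prod.distrib)
qed

lemma subst_superset:
  assumes "finite K" and "keys f \<subseteq> K"
  shows "subst y f = (\<Sum>m\<in>K. Poly_Mapping.single 0 (lookup f m) * monom_val y m)"
  unfolding subst_def monom_val_def[symmetric]
  using assms by (intro sum.mono_neutral_left) (auto simp: in_keys_iff)

lemma subst_add: "subst y (f + g) = subst y f + subst y g"
  using keys_add[of f g]
  by (simp add: subst_superset[of "keys f \<union> keys g"]
      lookup_add single_add distrib_right sum.distrib)

lemma subst_0 [simp]: "subst y 0 = 0"
  by (simp add: subst_def)

lemma subst_sum: "subst y (sum f A) = (\<Sum>x\<in>A. subst y (f x))"
  by (induction A rule: infinite_finite_induct) (simp_all add: subst_add)

lemma subst_single: "subst y (Poly_Mapping.single m c) = Poly_Mapping.single 0 c * monom_val y m"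
  by (simp add: subst_superset[of "{m}"])

lemma monom_val_0 [simp]: "monom_val y 0 = 1"
  by (simp add: monom_val_def)

lemma subst_const [simp]: "subst y (Poly_Mapping.single 0 c) = Poly_Mapping.single 0 c"
  by (simp add: subst_single)

lemma subst_1 [simp]: "subst y 1 = 1"
  using subst_const[of y 1] by simp

lemma subst_mult: "subst y (f * g) = subst y f * subst y g"
proof -
  have eq: "subst y f = (\<Sum>m\<in>keys f. Poly_Mapping.single 0 (lookup f m) * monom_val y m)" for f
    by (rule subst_superset) auto
  have "subst y (f * g) = (\<Sum>m\<in>keys f. \<Sum>n\<in>keys g.
     Poly_Mapping.single 0 (lookup f m * lookup g n) *
       (monom_val y m * monom_val y n))"
    by (simp add: mult_eq_sum_single subst_sum subst_single monom_val_add)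
  also have "\<dots> = subst y f * subst y g"
    unfolding eq sum_product
    by (intro sum.cong refl) (metis (no_types, lifting) mult_single add_0 mult.assoc mult.left_commute)
  finally show ?thesis .
qed

lemma is_hom_subst: "is_hom (subst y)"
  by (simp add: is_hom_def subst_add subst_mult)

lemmas subst_uminus = is_homD(5)[OF is_hom_subst]
lemmas subst_diff = is_homD(6)[OF is_hom_subst]
lemmas subst_prod = is_hom_prod[OF is_hom_subst]
lemmas subst_power = is_hom_power[OF is_hom_subst]

lemma subst_lam [simp]: "subst y (lam i s) = y i s"
  by (simp add: lam_def subst_single monom_val_def)

lemma subst_scal [simp]: "subst y (scal q c) = scal q c"
  by (simp add: scal_def)

lemma subst_subst: "subst z (subst y f) = subst (\<lambda>i s. subst z (y i s)) f"
  by (simp add: subst_def[of y f] subst_def[of "\<lambda>i s. subst z (y i s)"] subst_sum subst_mult subst_prod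
      subst_power case_prod_unfold)

lemma monom_val_lam: "monom_val lam m = Poly_Mapping.single m (1 :: 'r::comm_ring_1 poly)"
proof -
  have pow: "lam i s ^ n = (Poly_Mapping.single (Poly_Mapping.single (i, s) n) 1 :: ('i, 'r) mpol)" for i s n
    by (induction n) (simp_all add: lam_def mult_single flip: single_add)
  have sum: "(\<Prod>x\<in>K. Poly_Mapping.single (h x) (1 :: 'r poly)) = Poly_Mapping.single (\<Sum>x\<in>K. h x) 1"
    if "finite K" for K and h :: "_ \<Rightarrow> ('i \<times> nat \<Rightarrow>\<^sub>0 nat)"
    using that by induction (simp_all add: mult_single)
  show ?thesis
    unfolding monom_val_def case_prod_unfold pow prod.collapse
    by (simp add: sum poly_mapping_sum_single)
qed

lemma subst_lam_id [simp]: "subst lam f = f"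
  by (simp add: subst_superset[OF _ subset_refl] monom_val_lam mult_single poly_mapping_sum_single)

text \<open>A polynomial is a combination of its own monomials, which is the substitution of the variables
  for themselves.\<close>

lemma mpol_induct [case_names const lam add mult]:
  fixes f :: "('i, 'r::comm_ring_1) mpol"
  assumes const: "\<And>c. P (Poly_Mapping.single 0 c)" and lam: "\<And>i s. P (lam i s)"
    and add: "\<And>f g. P f \<Longrightarrow> P g \<Longrightarrow> P (f + g)" and mult: "\<And>f g. P f \<Longrightarrow> P g \<Longrightarrow> P (f * g)"
  shows "P f"
proof -
  have 0: "P 0" and 1: "P 1" using const[of 0] const[of 1] by simp_all
  have pow: "P (f ^ n)" if "P f" for f n
    using that by (induction n) (auto intro: 1 mult)
  have prod: "P (prod h K)" if "\<And>x. x \<in> K \<Longrightarrow> P (h x)" for h :: "_ \<Rightarrow> ('i, 'r) mpol" and K :: "('i \<times> nat) set"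
    using that by (induction K rule: infinite_finite_induct) (auto intro: 1 mult)
  have sum: "P (sum h K)" if "\<And>x. x \<in> K \<Longrightarrow> P (h x)" for h :: "_ \<Rightarrow> ('i, 'r) mpol" and K :: "('i \<times> nat \<Rightarrow>\<^sub>0 nat) set"
    using that by (induction K rule: infinite_finite_induct) (auto intro: 0 add)
  have "P (subst lam f)"
    unfolding subst_def by (intro sum mult const) (auto intro!: prod pow lam)
  then show ?thesis by simp
qed

definition in_vars :: "('i \<times> nat) set \<Rightarrow> ('i, 'r::comm_ring_1) mpol \<Rightarrow> bool" where
  "in_vars V f \<longleftrightarrow> (\<forall>m\<in>keys f. keys m \<subseteq> V)"

lemma in_vars_subst:
  assumes "\<And>i s. in_vars V (y i s)"
  shows "in_vars V (subst y f)"
proof (induction f rule: mpol_induct)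
  case (add f g)
  then show ?case
    using keys_add[of "subst y f" "subst y g"] unfolding in_vars_def subst_add by blast
next
  case (mult f g)
  show ?case
    unfolding in_vars_def subst_mult
  proof
    fix m assume "m \<in> keys (subst y f * subst y g)"
    then obtain a b where "m = a + b" "a \<in> keys (subst y f)" "b \<in> keys (subst y g)"
      using keys_mult by blast
    with mult keys_add[of a b] show "keys m \<subseteq> V"
      unfolding in_vars_def by blast
  qed
qed (use assms in \<open>simp_all add: in_vars_def\<close>)

lemma in_vars_lam: "(i, s) \<in> V \<Longrightarrow> in_vars V (lam i s)"
  by (simp add: in_vars_def lam_def)

lemma in_vars_0: "in_vars V 0"
  by (simp add: in_vars_def)

lemma subst_cong:
  assumes "in_vars V f" and "\<And>i s. (i, s) \<in> V \<Longrightarrow> y i s = z i s"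
  shows "subst y f = subst z f"
  unfolding subst_def
proof (intro sum.cong refl arg_cong2[where f = "(*)"] prod.cong)
  fix m x assume "m \<in> keys f" "x \<in> keys m"
  then have "x \<in> V" using assms(1) by (auto simp: in_vars_def)
  then show "(case x of (i, s) \<Rightarrow> y i s ^ lookup m (i, s))
      = (case x of (i, s) \<Rightarrow> z i s ^ lookup m (i, s))"
    using assms(2) by (cases x) simp
qed

text \<open>Substitution is a ring homomorphism, so that congruences modulo \<open>d\<close> pass from the variables to
  all polynomials.\<close>

lemma dvd_diff_subst:
  assumes "\<And>i s. d dvd lam i s - y i s"
  shows "d dvd f - subst y f"
proof (induction f rule: mpol_induct)
  case (add f g)
  have "f + g - subst y (f + g) = (f - subst y f) + (g - subst y g)"
    by (simp add: subst_add)
  with add show ?case by (metis dvd_add)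
next
  case (mult f g)
  have "f * g - subst y (f * g) = f * (g - subst y g) + (f - subst y f) * subst y g"
    by (simp add: subst_mult algebra_simps)
  with mult show ?case by (metis dvd_add dvd_mult dvd_mult2)
qed (use assms in auto)

definition var :: "'i \<times> nat \<Rightarrow> ('i, 'r::comm_ring_1) mpol" where
  "var x = lam (fst x) (snd x)"

text \<open>Over an arbitrary coefficient ring: a monomial of a nonzero \<open>f\<close> with the largest exponent of the
  first variable survives in the product with that variable, and nothing in the product with the
  other variable can cancel it.\<close>

lemma regular_var_diff:
  assumes "a \<noteq> b"
  shows "regular (var a - var b :: ('i, 'r::comm_ring_1) mpol)"
  unfolding regular_def
proof (intro allI impI)
  fix f :: "('i, 'r) mpol"
  assume "(var a - var b) * f = 0"
  then have eq: "var a * f = var b * f"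
    by (simp add: left_diff_distrib)
  have shift: "lookup (var x * f) n =
      (\<Sum>m\<in>keys f. if Poly_Mapping.single x 1 + m = n then lookup f m else 0)" for x n
    by (simp add: var_def lam_def mult_eq_sum_single[of "Poly_Mapping.single _ _"] lookup_sum lookup_single when_def)
  show "f = 0"
  proof (rule ccontr)
    assume "f \<noteq> 0"
    then have ne: "keys f \<noteq> {}" by simp
    define M where "M = Max ((\<lambda>m. lookup m a) ` keys f)"
    have "M \<in> (\<lambda>m. lookup m a) ` keys f"
      unfolding M_def using ne by (intro Max_in) auto
    then obtain m where m: "m \<in> keys f" "lookup m a = M" by auto
    have max: "lookup n a \<le> M" if "n \<in> keys f" for n
      unfolding M_def using that by (intro Max_ge) auto
    have "lookup (var a * f) (Poly_Mapping.single a 1 + m) = lookup f m"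
      unfolding shift using m(1) by (simp add: sum.delta)
    moreover have "lookup (var b * f) (Poly_Mapping.single a 1 + m) = 0"
      unfolding shift
    proof (rule sum.neutral, intro ballI)
      fix n assume n: "n \<in> keys f"
      have "Poly_Mapping.single b 1 + n \<noteq> Poly_Mapping.single a 1 + m"
      proof
        assume "Poly_Mapping.single b 1 + n = Poly_Mapping.single a 1 + m"
        then have "lookup (Poly_Mapping.single b 1 + n) a
            = lookup (Poly_Mapping.single a 1 + m) a" by simp
        then have "lookup n a = Suc M"
          using assms m(2) by (simp add: lookup_add lookup_single)
        with max[OF n] show False by simp
      qed
      then show "(if Poly_Mapping.single b 1 + n = Poly_Mapping.single a 1 + m
          then lookup f n else 0) = 0" by simp
    qed
    ultimately show False
      using m(1) eq by (simp add: in_keys_iff)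
  qed
qed

lemma subst_var: "subst y (var x) = y (fst x) (snd x)"
  by (simp add: var_def)

section \<open>Convolution of functions of finite sets\<close>

definition cross_prod :: "('x \<Rightarrow> 'x \<Rightarrow> 'k::comm_ring_1) \<Rightarrow> 'x set \<Rightarrow> 'x set \<Rightarrow> 'k" where
  "cross_prod \<omega> A B = (\<Prod>a\<in>A. \<Prod>b\<in>B. \<omega> a b)"

definition conv :: "('x \<Rightarrow> 'x \<Rightarrow> 'k::comm_ring_1) \<Rightarrow> ('x set \<Rightarrow> 'k) \<Rightarrow> ('x set \<Rightarrow> 'k) \<Rightarrow> 'x set \<Rightarrow> 'k" where
  "conv \<omega> F G U = (\<Sum>A\<in>Pow U. F A * G (U - A) * cross_prod \<omega> A (U - A))"

lemma cross_prod_Un_left: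
  "finite A \<Longrightarrow> finite B \<Longrightarrow> A \<inter> B = {} \<Longrightarrow> cross_prod \<omega> (A \<union> B) C = cross_prod \<omega> A C * cross_prod \<omega> B C"
  by (simp add: cross_prod_def prod.union_disjoint)

lemma cross_prod_Un_right:
  "finite A \<Longrightarrow> finite B \<Longrightarrow> A \<inter> B = {} \<Longrightarrow> cross_prod \<omega> C (A \<union> B) = cross_prod \<omega> C A * cross_prod \<omega> C B"
  by (simp add: cross_prod_def prod.union_disjoint prod.distrib)

lemma conv_cong:
  "(\<And>A. A \<subseteq> U \<Longrightarrow> F A = F' A) \<Longrightarrow> (\<And>A. A \<subseteq> U \<Longrightarrow> G A = G' A) \<Longrightarrow> conv \<omega> F G U = conv \<omega> F' G' U"
  unfolding conv_def by (intro sum.cong) auto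

text \<open>Both sides are the sum over the ordered partitions of \<open>U\<close> into three blocks.\<close>

lemma conv_assoc:
  assumes U: "finite U"
  shows "conv \<omega> (conv \<omega> F G) H U = conv \<omega> F (conv \<omega> G H) U"
proof -
  define T where "T A B C = F A * G B * H C * cross_prod \<omega> A B * cross_prod \<omega> A C * cross_prod \<omega> B C" for A B C
  have fin: "finite A" if "A \<subseteq> U" for A using that U by (rule finite_subset)
  have "conv \<omega> (conv \<omega> F G) H U = (\<Sum>A\<in>Pow U. \<Sum>B\<in>Pow A. T B (A - B) (U - A))"
    unfolding conv_def[of _ _ H] conv_def[of _ F G] sum_distrib_right
  proof (intro sum.cong refl)
    fix A B assume "A \<in> Pow U" "B \<in> Pow A"
    then have "cross_prod \<omega> A (U - A) = cross_prod \<omega> B (U - A) * cross_prod \<omega> (A - B) (U - A)"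
      using cross_prod_Un_left[of B "A - B" \<omega> "U - A"] fin by (auto simp: Un_absorb1 intro: finite_subset)
    then show "F B * G (A - B) * cross_prod \<omega> B (A - B) * H (U - A) * cross_prod \<omega> A (U - A) = T B (A - B) (U - A)"
      by (simp add: T_def mult_ac)
  qed
  also have "\<dots> = (\<Sum>(A, B)\<in>(SIGMA A:Pow U. Pow A). T B (A - B) (U - A))"
    using U by (subst sum.Sigma) (auto intro: finite_subset)
  also have "\<dots> = (\<Sum>(A, B)\<in>(SIGMA A:Pow U. Pow (U - A)). T A B (U - A - B))"
    by (intro sum.reindex_bij_witness[of _ "\<lambda>(A, B). (A \<union> B, A)" "\<lambda>(A, B). (B, A - B)"])
      (auto intro!: arg_cong[where f = "T _ _"])
  also have "\<dots> = (\<Sum>A\<in>Pow U. \<Sum>B\<in>Pow (U - A). T A B (U - A - B))"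
    using U by (subst sum.Sigma) (auto intro: finite_subset)
  also have "\<dots> = conv \<omega> F (conv \<omega> G H) U"
    unfolding conv_def[of _ F] conv_def[of _ G H] sum_distrib_left sum_distrib_right
  proof (intro sum.cong refl)
    fix A B assume "A \<in> Pow U" "B \<in> Pow (U - A)"
    then have "cross_prod \<omega> A (U - A) = cross_prod \<omega> A B * cross_prod \<omega> A (U - A - B)"
      using cross_prod_Un_right[of B "U - A - B" \<omega> A] U by (auto simp: Un_absorb1 intro: finite_subset)
    then show "T A B (U - A - B) = F A * (G B * H (U - A - B) * cross_prod \<omega> B (U - A - B)) * cross_prod \<omega> A (U - A)"
      by (simp add: T_def mult_ac)
  qed
  finally show ?thesis .
qed

definition conv_unit :: "'x set \<Rightarrow> 'k::comm_ring_1" where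
  "conv_unit U = (if U = {} then 1 else 0)"

lemma conv_unit_left:
  assumes "finite U"
  shows "conv \<omega> conv_unit F U = F U"
proof -
  have "conv \<omega> conv_unit F U = (\<Sum>A\<in>{{}}. conv_unit A * F (U - A) * cross_prod \<omega> A (U - A))"
    unfolding conv_def using assms by (intro sum.mono_neutral_right) (auto simp: conv_unit_def)
  then show ?thesis by (simp add: conv_unit_def cross_prod_def)
qed

lemma conv_unit_right:
  assumes "finite U"
  shows "conv \<omega> F conv_unit U = F U"
proof -
  have "conv \<omega> F conv_unit U = (\<Sum>A\<in>{U}. F A * conv_unit (U - A) * cross_prod \<omega> A (U - A))"
    unfolding conv_def using assms by (intro sum.mono_neutral_right) (auto simp: conv_unit_def)
  then show ?thesis by (simp add: conv_unit_def cross_prod_def)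
qed

lemma conv_add_left: "conv \<omega> (\<lambda>U. F U + G U) H U = conv \<omega> F H U + conv \<omega> G H U"
  by (simp add: conv_def distrib_right sum.distrib)

lemma conv_add_right: "conv \<omega> F (\<lambda>U. G U + H U) U = conv \<omega> F G U + conv \<omega> F H U"
  by (simp add: conv_def distrib_right distrib_left sum.distrib)

lemma conv_scale_left: "conv \<omega> (\<lambda>U. c * F U) G U = c * conv \<omega> F G U"
  by (simp add: conv_def sum_distrib_left mult_ac)

lemma conv_scale_right: "conv \<omega> F (\<lambda>U. c * G U) U = c * conv \<omega> F G U"
  by (simp add: conv_def sum_distrib_left mult_ac)

lemma conv_sum_left: "conv \<omega> (\<lambda>U. \<Sum>i\<in>I. F i U) G U = (\<Sum>i\<in>I. conv \<omega> (F i) G U)"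
  unfolding conv_def sum_distrib_right by (rule sum.swap)

lemma conv_sum_right: "conv \<omega> F (\<lambda>U. \<Sum>i\<in>I. G i U) U = (\<Sum>i\<in>I. conv \<omega> F (G i) U)"
  unfolding conv_def sum_distrib_right sum_distrib_left by (rule sum.swap)

definition on_singletons :: "('x \<Rightarrow> 'k::comm_ring_1) \<Rightarrow> 'x set \<Rightarrow> 'k" where
  "on_singletons g U = (if card U = 1 then g (the_elem U) else 0)"

lemma on_singletons_sing [simp]: "on_singletons g {a} = g a"
  by (simp add: on_singletons_def)

lemma conv_on_singletons_left:
  assumes "finite U"
  shows "conv \<omega> (on_singletons g) F U = (\<Sum>a\<in>U. g a * F (U - {a}) * (\<Prod>b\<in>U - {a}. \<omega> a b))"
proof -
  have "conv \<omega> (on_singletons g) F U =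
      (\<Sum>A\<in>(\<lambda>a. {a}) ` U. on_singletons g A * F (U - A) * cross_prod \<omega> A (U - A))"
    unfolding conv_def using assms
    by (intro sum.mono_neutral_right) (auto simp: on_singletons_def card_1_singleton_iff image_iff)
  also have "\<dots> = (\<Sum>a\<in>U. g a * F (U - {a}) * (\<Prod>b\<in>U - {a}. \<omega> a b))"
    by (subst sum.reindex) (auto simp: cross_prod_def inj_on_def)
  finally show ?thesis .
qed

lemma conv_on_singletons_right:
  assumes "finite U"
  shows "conv \<omega> F (on_singletons g) U = (\<Sum>a\<in>U. g a * F (U - {a}) * (\<Prod>b\<in>U - {a}. \<omega> b a))"
proof -
  have *: "x \<in> (\<lambda>a. U - {a}) ` U" if "x \<subseteq> U" "card (U - x) = 1" for x
    using that by (auto simp: card_1_singleton_iff image_iff)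
  have "conv \<omega> F (on_singletons g) U =
      (\<Sum>A\<in>(\<lambda>a. U - {a}) ` U. F A * on_singletons g (U - A) * cross_prod \<omega> A (U - A))"
    unfolding conv_def using assms
    by (intro sum.mono_neutral_right) (auto simp: on_singletons_def dest: *)
  also have "\<dots> = (\<Sum>a\<in>U. F (U - {a}) * on_singletons g (U - (U - {a})) * cross_prod \<omega> (U - {a}) (U - (U - {a})))"
    by (subst sum.reindex) (auto simp: inj_on_def)
  also have "\<dots> = (\<Sum>a\<in>U. g a * F (U - {a}) * (\<Prod>b\<in>U - {a}. \<omega> b a))"
    by (intro sum.cong refl) (simp add: double_diff cross_prod_def)
  finally show ?thesis .
qed

definition bracket :: "('x \<Rightarrow> 'x \<Rightarrow> 'k::comm_ring_1) \<Rightarrow> ('x set \<Rightarrow> 'k) \<Rightarrow> ('x set \<Rightarrow> 'k) \<Rightarrow> 'x set \<Rightarrow> 'k" where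
  "bracket \<omega> F G U = conv \<omega> F G U - conv \<omega> G F U"

lemma bracket_cong:
  "(\<And>A. A \<subseteq> U \<Longrightarrow> F A = F' A) \<Longrightarrow> (\<And>A. A \<subseteq> U \<Longrightarrow> G A = G' A) \<Longrightarrow> bracket \<omega> F G U = bracket \<omega> F' G' U"
  unfolding bracket_def by (intro arg_cong2[where f = "(-)"] conv_cong)

lemma bracket_on_singletons:
  "finite U \<Longrightarrow> bracket \<omega> (on_singletons g) F U =
     (\<Sum>a\<in>U. g a * F (U - {a}) * ((\<Prod>b\<in>U - {a}. \<omega> a b) - (\<Prod>b\<in>U - {a}. \<omega> b a)))"
  by (simp add: bracket_def conv_on_singletons_left conv_on_singletons_right right_diff_distrib sum_subtractf)


section \<open>A partial fraction identity\<close>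

context
  fixes z :: "'x \<Rightarrow> 'k::comm_ring_1" and \<nu> :: "'x \<Rightarrow> 'x \<Rightarrow> 'k" and e :: 'k and V :: "'x set"
  assumes inv: "\<And>a b. a \<in> V \<Longrightarrow> b \<in> V \<Longrightarrow> a \<noteq> b \<Longrightarrow> \<nu> a b * (z a - z b) = 1"
begin

lemma partial_fraction_step:
  assumes "a \<in> V" "b \<in> V" "c \<in> V" "a \<noteq> b" "a \<noteq> c" "b \<noteq> c"
  shows "\<nu> a b * \<nu> a c = (\<nu> a b - \<nu> a c) * \<nu> b c"
proof -
  have "(\<nu> a b - \<nu> a c) * \<nu> b c = \<nu> b c * (\<nu> a b * (\<nu> a c * (z a - z c)) - \<nu> a c * (\<nu> a b * (z a - z b)))"
    using assms by (simp add: inv mult.commute)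
  also have "\<dots> = \<nu> a b * \<nu> a c * (\<nu> b c * (z b - z c))"
    by (simp add: algebra_simps)
  finally show ?thesis using assms by (simp add: inv)
qed

lemma inv_antisym:
  assumes "a \<in> V" "b \<in> V" "a \<noteq> b"
  shows "\<nu> a b = - \<nu> b a"
proof -
  have "\<nu> a b + \<nu> b a = \<nu> a b * (\<nu> b a * (z b - z a)) + \<nu> b a * (\<nu> a b * (z a - z b))"
    using assms by (simp add: inv)
  also have "\<dots> = 0" by (simp add: algebra_simps)
  finally show ?thesis by (simp add: eq_neg_iff_add_eq_0)
qed

text \<open>This is the expansion of \<open>\<Prod>\<^sub>j (1 - e / (z w - z j))\<close> into partial fractions in \<open>z w\<close>.\<close>

lemma partial_fractions:
  assumes "finite S" and "S \<subseteq> V" and "w \<in> V - S"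
  shows "(\<Prod>j\<in>S. 1 - e * \<nu> w j) = 1 - e * (\<Sum>i\<in>S. \<nu> w i * (\<Prod>j\<in>S - {i}. 1 - e * \<nu> i j))"
  using assms
proof (induction S arbitrary: w)
  case empty
  then show ?case by simp
next
  case (insert t S)
  define p where "p i = (\<Prod>j\<in>S - {i}. 1 - e * \<nu> i j)" for i
  have ins: "(\<Prod>j\<in>insert t S - {i}. 1 - e * \<nu> i j) = (1 - e * \<nu> i t) * p i" if "i \<in> S" for i
  proof -
    have "insert t S - {i} = insert t (S - {i})" using that insert.hyps by auto
    then show ?thesis using insert.hyps by (simp add: p_def)
  qed
  have IHw: "(\<Prod>j\<in>S. 1 - e * \<nu> w j) = 1 - e * (\<Sum>i\<in>S. \<nu> w i * p i)"
    unfolding p_def using insert.prems by (intro insert.IH) auto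
  \<comment> \<open>The residue at the new pole \<open>z t\<close> is the old expansion evaluated at \<open>w = t\<close>.\<close>
  have IHt: "(\<Prod>j\<in>S. 1 - e * \<nu> t j) = 1 - e * (\<Sum>i\<in>S. \<nu> t i * p i)"
    unfolding p_def using insert by (intro insert.IH) auto
  have t: "insert t S - {t} = S" using insert.hyps by auto
  have *: "\<nu> w t * (\<nu> w i * p i) = (\<nu> w i - \<nu> w t) * (\<nu> i t * p i)" "\<nu> t i = - \<nu> i t" if "i \<in> S" for i
  proof -
    have "\<nu> w i * \<nu> w t = (\<nu> w i - \<nu> w t) * \<nu> i t"
      using that insert.prems insert.hyps by (intro partial_fraction_step) auto
    then have "\<nu> w i * \<nu> w t * p i = (\<nu> w i - \<nu> w t) * \<nu> i t * p i" by simp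
    then show "\<nu> w t * (\<nu> w i * p i) = (\<nu> w i - \<nu> w t) * (\<nu> i t * p i)"
      by (simp add: mult_ac)
    show "\<nu> t i = - \<nu> i t"
      using that insert.prems insert.hyps by (intro inv_antisym) auto
  qed
  define sw where "sw = (\<Sum>i\<in>S. \<nu> w i * p i)"
  define st where "st = (\<Sum>i\<in>S. \<nu> i t * p i)"
  define swt where "swt = (\<Sum>i\<in>S. \<nu> w i * (\<nu> i t * p i))"
  have 1: "\<nu> w t * sw = swt - \<nu> w t * st"
    unfolding sw_def swt_def st_def sum_distrib_left sum_subtractf[symmetric]
    by (intro sum.cong refl) (simp add: *(1) left_diff_distrib)
  have 2: "(\<Sum>i\<in>S. \<nu> t i * p i) = - st"
    unfolding st_def sum_negf[symmetric] by (intro sum.cong refl) (simp add: *(2))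
  have 3: "(\<Sum>i\<in>S. \<nu> w i * ((1 - e * \<nu> i t) * p i)) = sw - e * swt"
    unfolding sw_def swt_def sum_distrib_left sum_subtractf[symmetric]
    by (intro sum.cong refl) (simp add: algebra_simps)
  have "(\<Prod>j\<in>insert t S. 1 - e * \<nu> w j) = (1 - e * \<nu> w t) * (1 - e * sw)"
    using insert.hyps IHw by (simp add: sw_def)
  also have "\<dots> = 1 - e * \<nu> w t - e * sw + e * e * (\<nu> w t * sw)"
    by (simp add: algebra_simps)
  also have "\<dots> = 1 - e * (\<nu> w t * (1 - e * (\<Sum>i\<in>S. \<nu> t i * p i)) + (\<Sum>i\<in>S. \<nu> w i * ((1 - e * \<nu> i t) * p i)))"
    unfolding 1 2 3 by (simp add: algebra_simps)
  also have "\<dots> = 1 - e * (\<Sum>i\<in>insert t S. \<nu> w i * (\<Prod>j\<in>insert t S - {i}. 1 - e * \<nu> i j))"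
    using insert.hyps by (simp add: ins t IHt cong: sum.cong)
  finally show ?case .
qed

text \<open>These are the two leading coefficients at infinity of the expansion above.  A new index \<open>w\<close>
  changes the old terms by multiples of \<open>\<nu> w i\<close>, which cancel against the partial fraction expansion
  of the new term, in the second sum up to \<open>e\<close> times the first sum for the old indices.\<close>

lemma sum_partial_fraction_products:
  assumes "finite S" and "S \<subseteq> V"
  shows "(\<Sum>i\<in>S. \<Prod>j\<in>S - {i}. 1 - e * \<nu> i j) = of_nat (card S)" (is ?card)
    and "(\<Sum>i\<in>S. z i * (\<Prod>j\<in>S - {i}. 1 - e * \<nu> i j)) = (\<Sum>i\<in>S. z i) - of_nat (card S choose 2) * e" (is ?lin)
proof -
  have "?card \<and> ?lin" using assms
  proof (induction S)
    case empty
    then show ?case by (simp add: numeral_2_eq_2)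
  next
    case (insert w S)
    define p where "p i = (\<Prod>j\<in>S - {i}. 1 - e * \<nu> i j)" for i
    have ins: "(\<Prod>j\<in>insert w S - {i}. 1 - e * \<nu> i j) = p i + e * (\<nu> w i * p i)" if "i \<in> S" for i
    proof -
      have "insert w S - {i} = insert w (S - {i})" using that insert.hyps by auto
      moreover have "\<nu> i w = - \<nu> w i"
        using that insert.hyps insert.prems by (intro inv_antisym) auto
      ultimately have "(\<Prod>j\<in>insert w S - {i}. 1 - e * \<nu> i j) = (1 + e * \<nu> w i) * p i"
        using insert.hyps by (simp add: p_def)
      then show ?thesis by (simp add: algebra_simps)
    qed
    have w: "insert w S - {w} = S" using insert.hyps by auto
    have pf: "(\<Prod>j\<in>S. 1 - e * \<nu> w j) = 1 - e * (\<Sum>i\<in>S. \<nu> w i * p i)"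
      unfolding p_def using insert by (intro partial_fractions) auto
    have z: "z i * (e * (\<nu> w i * p i)) = z w * (e * (\<nu> w i * p i)) - e * p i" if "i \<in> S" for i
    proof -
      have "z w * (e * (\<nu> w i * p i)) - z i * (e * (\<nu> w i * p i)) = e * p i * (\<nu> w i * (z w - z i))"
        by (simp add: algebra_simps)
      also have "\<dots> = e * p i" using that insert by (subst inv) auto
      finally show ?thesis by (simp add: algebra_simps)
    qed
    have IH: "(\<Sum>i\<in>S. p i) = of_nat (card S)"
        "(\<Sum>i\<in>S. z i * p i) = (\<Sum>i\<in>S. z i) - of_nat (card S choose 2) * e"
      using insert unfolding p_def by auto
    have choose: "Suc (card S) choose 2 = card S + (card S choose 2)"
      by (simp add: numeral_2_eq_2)
    define sw where "sw = e * (\<Sum>i\<in>S. \<nu> w i * p i)"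
    have sw: "(\<Sum>i\<in>S. e * (\<nu> w i * p i)) = sw" "(\<Sum>i\<in>S. z w * (e * (\<nu> w i * p i))) = z w * sw"
      unfolding sw_def sum_distrib_left by (rule refl)+
    have "(\<Sum>i\<in>insert w S. \<Prod>j\<in>insert w S - {i}. 1 - e * \<nu> i j)
       = 1 - sw + (\<Sum>i\<in>S. p i + e * (\<nu> w i * p i))"
      using insert.hyps by (simp add: ins w pf sw_def cong: sum.cong)
    also have "\<dots> = of_nat (card (insert w S))"
      using insert.hyps by (simp add: sum.distrib sw IH)
    finally have 1: "(\<Sum>i\<in>insert w S. \<Prod>j\<in>insert w S - {i}. 1 - e * \<nu> i j) = of_nat (card (insert w S))" .
    have "(\<Sum>i\<in>insert w S. z i * (\<Prod>j\<in>insert w S - {i}. 1 - e * \<nu> i j))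
       = z w * (1 - sw) + (\<Sum>i\<in>S. z i * (p i + e * (\<nu> w i * p i)))"
      using insert.hyps by (simp add: ins w pf sw_def cong: sum.cong)
    also have "(\<Sum>i\<in>S. z i * (p i + e * (\<nu> w i * p i)))
       = (\<Sum>i\<in>S. z i * p i + (z w * (e * (\<nu> w i * p i)) - e * p i))"
      by (intro sum.cong refl) (simp only: distrib_left z)
    also have "\<dots> = (\<Sum>i\<in>S. z i) - of_nat (card S choose 2) * e + (z w * sw - e * of_nat (card S))"
      by (simp add: sum.distrib sum_subtractf IH sw_def flip: sum_distrib_left)
    also have "z w * (1 - sw) + \<dots> = (\<Sum>i\<in>insert w S. z i) - of_nat (card (insert w S) choose 2) * e"
      using insert.hyps by (simp add: choose algebra_simps)
    finally show ?case
      using 1 by simp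
  qed
  then show ?card ?lin by blast+
qed

end

section \<open>Symmetrised iterated brackets\<close>

text \<open>The permanent of the matrix with entries \<open>f m x\<close>.  The bijections are taken to be extensional in
  order to count each one only once.\<close>

definition perm_sum :: "('m \<Rightarrow> 'x \<Rightarrow> 'k::comm_ring_1) \<Rightarrow> 'm set \<Rightarrow> 'x set \<Rightarrow> 'k" where
  "perm_sum f T S = (\<Sum>\<phi> | \<phi> \<in> extensional T \<and> bij_betw \<phi> T S. \<Prod>m\<in>T. f m (\<phi> m))"

lemma finite_bij_extensional:
  assumes "finite T" and "finite S"
  shows "finite {\<phi>. \<phi> \<in> extensional T \<and> bij_betw \<phi> T S}"
  by (rule finite_subset[OF _ finite_PiE[of T "\<lambda>_. S"]]) (auto simp: PiE_def bij_betw_def assms)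

lemma perm_sum_eq_0: "finite T \<Longrightarrow> card T \<noteq> card S \<Longrightarrow> perm_sum f T S = 0"
  unfolding perm_sum_def by (rule sum.neutral) (auto dest: bij_betw_same_card)

lemma perm_sum_eq_0_vanishing:
  assumes "finite T" and "x \<in> S" and "\<And>m. m \<in> T \<Longrightarrow> f m x = 0"
  shows "perm_sum f T S = 0"
  unfolding perm_sum_def
proof (rule sum.neutral, safe)
  fix \<phi> assume "bij_betw \<phi> T S"
  with assms(2) obtain m where "m \<in> T" "\<phi> m = x" by (auto simp: bij_betw_def)
  then show "(\<Prod>m\<in>T. f m (\<phi> m)) = 0"
    using assms by (intro prod_zero) auto
qed

lemma perm_sum_empty: "perm_sum f {} S = (if S = {} then 1 else 0)"
  by (auto simp: perm_sum_def bij_betw_def)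

lemma bij_betw_fun_upd:
  assumes "bij_betw \<phi> (T - {m}) (S - {a})" "m \<in> T" "a \<in> S"
  shows "bij_betw (\<phi>(m := a)) T S"
proof -
  have "bij_betw (\<phi>(m := a)) (T - {m}) (S - {a})"
    using assms(1) by (rule bij_betw_cong[THEN iffD1, rotated]) auto
  moreover have "bij_betw (\<phi>(m := a)) {m} {a}" by (simp add: bij_betw_def)
  ultimately have "bij_betw (\<phi>(m := a)) ((T - {m}) \<union> {m}) ((S - {a}) \<union> {a})"
    by (rule bij_betw_combine) auto
  then show ?thesis using assms(2,3) by (simp add: insert_absorb)
qed

text \<open>Laplace expansion of the permanent along the column \<open>a\<close>.\<close>

lemma perm_sum_expand:
  assumes T: "finite T" and S: "finite S" and a: "a \<in> S"
  shows "(\<Sum>m\<in>T. f m a * perm_sum f (T - {m}) (S - {a})) = perm_sum f T S"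
proof -
  let ?B = "\<lambda>T S. {\<phi>. \<phi> \<in> extensional T \<and> bij_betw \<phi> T S}"
  have "(\<Sum>m\<in>T. f m a * perm_sum f (T - {m}) (S - {a})) =
     (\<Sum>(m, \<phi>)\<in>(SIGMA m:T. ?B (T - {m}) (S - {a})). f m a * (\<Prod>n\<in>T - {m}. f n (\<phi> n)))"
    unfolding perm_sum_def sum_distrib_left
    by (subst sum.Sigma) (auto intro!: finite_bij_extensional simp: T S)
  also have "\<dots> = (\<Sum>\<phi>\<in>?B T S. \<Prod>m\<in>T. f m (\<phi> m))"
  proof (rule sum.reindex_bij_witness[where j = "\<lambda>(m, \<phi>). \<phi>(m := a)"
        and i = "\<lambda>\<phi>. (inv_into T \<phi> a, \<phi>(inv_into T \<phi> a := undefined))"])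
    fix y assume "y \<in> (SIGMA m:T. ?B (T - {m}) (S - {a}))"
    then obtain m \<phi> where y: "y = (m, \<phi>)" "m \<in> T" "\<phi> \<in> extensional (T - {m})"
        "bij_betw \<phi> (T - {m}) (S - {a})" by auto
    have bij: "bij_betw (\<phi>(m := a)) T S"
      using y a by (intro bij_betw_fun_upd)
    have inv: "inv_into T (\<phi>(m := a)) a = m"
      using bij y(2) by (metis bij_betw_def fun_upd_same inv_into_f_f)
    show "(case y of (m, \<phi>) \<Rightarrow> \<phi>(m := a)) \<in> ?B T S"
      using y bij by (auto simp: extensional_def)
    show "(inv_into T (case y of (m, \<phi>) \<Rightarrow> \<phi>(m := a)) a,
        (case y of (m, \<phi>) \<Rightarrow> \<phi>(m := a))(inv_into T (case y of (m, \<phi>) \<Rightarrow> \<phi>(m := a)) a := undefined)) = y"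
      using y by (auto simp: inv extensional_def)
    have "(\<Prod>n\<in>T. f n ((\<phi>(m := a)) n)) = f m a * (\<Prod>n\<in>T - {m}. f n ((\<phi>(m := a)) n))"
      using T y(2) by (subst prod.remove) auto
    also have "(\<Prod>n\<in>T - {m}. f n ((\<phi>(m := a)) n)) = (\<Prod>n\<in>T - {m}. f n (\<phi> n))"
      by (intro prod.cong) auto
    finally show "(\<Prod>n\<in>T. f n ((case y of (m, \<phi>) \<Rightarrow> \<phi>(m := a)) n)) =
        (case y of (m, \<phi>) \<Rightarrow> f m a * (\<Prod>n\<in>T - {m}. f n (\<phi> n)))"
      by (simp add: y)
  next
    fix \<phi> assume "\<phi> \<in> ?B T S"
    then have \<phi>: "\<phi> \<in> extensional T" "bij_betw \<phi> T S" by auto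
    let ?m = "inv_into T \<phi> a"
    have m: "?m \<in> T" "\<phi> ?m = a"
      using \<phi>(2) a by (auto simp: bij_betw_def inv_into_into f_inv_into_f)
    show "(case (?m, \<phi>(?m := undefined)) of (m, \<phi>) \<Rightarrow> \<phi>(m := a)) = \<phi>"
      using m by auto
    have "bij_betw \<phi> (T - {?m}) (S - {a})"
      using \<phi>(2) m by (metis bij_betw_DiffI bij_betw_def bij_betw_imp_inj_on image_empty image_insert
          bij_betw_singletonI empty_subsetI insert_subset a)
    then have "bij_betw (\<phi>(?m := undefined)) (T - {?m}) (S - {a})"
      by (rule bij_betw_cong[THEN iffD1, rotated]) auto
    then show "(?m, \<phi>(?m := undefined)) \<in> (SIGMA m:T. ?B (T - {m}) (S - {a}))"
      using m \<phi>(1) by (auto simp: extensional_def)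
  qed
  finally show ?thesis by (simp add: perm_sum_def)
qed

definition sym_bracket ::
  "('x \<Rightarrow> 'x \<Rightarrow> 'k::comm_ring_1) \<Rightarrow> ('m \<Rightarrow> 'x \<Rightarrow> 'k) \<Rightarrow> ('x set \<Rightarrow> 'k) \<Rightarrow> 'm set \<Rightarrow> 'x set \<Rightarrow> 'k" where
  "sym_bracket \<omega> f G T U =
     (\<Sum>ms\<in>permutations_of_set T. foldr (\<lambda>m. bracket \<omega> (on_singletons (f m))) ms G U)"

lemma sym_bracket_empty: "sym_bracket \<omega> f G {} U = G U"
  by (simp add: sym_bracket_def)

lemma sym_bracket_rec:
  assumes T: "finite T" "T \<noteq> {}" and U: "finite U"
  shows "sym_bracket \<omega> f G T U = (\<Sum>m\<in>T. \<Sum>a\<in>U. f m a * sym_bracket \<omega> f G (T - {m}) (U - {a}) *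
     ((\<Prod>b\<in>U - {a}. \<omega> a b) - (\<Prod>b\<in>U - {a}. \<omega> b a)))"
proof -
  let ?B = "\<lambda>ms. foldr (\<lambda>m. bracket \<omega> (on_singletons (f m))) ms G"
  have "sym_bracket \<omega> f G T U = (\<Sum>m\<in>T. \<Sum>ms\<in>(#) m ` permutations_of_set (T - {m}). ?B ms U)"
    unfolding sym_bracket_def using T
    by (subst permutations_of_set_nonempty) (auto intro!: sum.UNION_disjoint)
  also have "\<dots> = (\<Sum>m\<in>T. \<Sum>ms\<in>permutations_of_set (T - {m}). bracket \<omega> (on_singletons (f m)) (?B ms) U)"
    by (subst sum.reindex) auto
  also have "\<dots> = (\<Sum>m\<in>T. \<Sum>a\<in>U. \<Sum>ms\<in>permutations_of_set (T - {m}). f m a * ?B ms (U - {a}) *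
     ((\<Prod>b\<in>U - {a}. \<omega> a b) - (\<Prod>b\<in>U - {a}. \<omega> b a)))"
    by (intro sum.cong refl) (simp only: bracket_on_singletons[OF U], rule sum.swap)
  finally show ?thesis
    by (simp add: sym_bracket_def sum_distrib_left sum_distrib_right)
qed

text \<open>In the bracket of one more generator of colour \<open>K\<close> with the closed form, the generator sits at one
  of the \<open>n + 1\<close> variables \<open>a\<close> of that colour.  By Laplace expansion its value combines with the
  permanent to a permanent that does not depend on \<open>a\<close>, and its kernel factors with the variable of
  colour \<open>L\<close> supply the missing factor \<open>c a b\<close>.  What is left is the sum over \<open>a\<close> of
  \<open>(z + \<alpha>) \<Prod> (1 - e \<mu>) - (z - \<alpha>) \<Prod> (1 + e \<mu>)\<close>, in which the terms linear in the variables cancel and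
  only \<open>(n + 1) (N - n) e\<close> survives.\<close>

lemma sym_bracket_closed_form:
  fixes \<omega> :: "'x \<Rightarrow> 'x \<Rightarrow> 'k::comm_ring_1" and l :: "'x \<Rightarrow> 'k" and N :: nat
  assumes inv: "\<And>i j. i \<in> K \<Longrightarrow> j \<in> K \<Longrightarrow> i \<noteq> j \<Longrightarrow> \<nu> i j * (l i - l j) = 1"
    and \<omega>_KK: "\<And>i j. i \<in> K \<Longrightarrow> j \<in> K \<Longrightarrow> i \<noteq> j \<Longrightarrow> \<omega> i j = 1 + e * \<nu> i j"
    and \<omega>_KL: "\<And>i b. i \<in> K \<Longrightarrow> b \<in> L \<Longrightarrow> \<omega> i b = c i b * (l b - l i + \<alpha>)"
    and \<omega>_LK: "\<And>i b. i \<in> K \<Longrightarrow> b \<in> L \<Longrightarrow> \<omega> b i = c i b * (l b - l i - \<alpha>)"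
    and \<alpha>: "2 * \<alpha> = of_nat N * e"
    and f: "\<And>m x. x \<notin> K \<Longrightarrow> f m x = 0" and g: "\<And>x. x \<notin> L \<Longrightarrow> g x = 0"
    and "finite T" "finite U"
  shows "sym_bracket \<omega> f (on_singletons g) T U =
    (\<Prod>j<card T. of_nat (Suc j) * (of_nat N - of_nat j) * e) *
    (\<Sum>b\<in>U. g b * perm_sum f T (U - {b}) * (\<Prod>i\<in>U - {b}. c i b))"
  using \<open>finite T\<close> \<open>finite U\<close>
proof (induction "card T" arbitrary: T U)
  case 0
  then have T: "T = {}" by simp
  show ?case
  proof (cases "card U = 1")
    case True
    then obtain b where "U = {b}" by (auto simp: card_1_singleton_iff)
    then show ?thesis by (simp add: T sym_bracket_empty perm_sum_empty)
  next
    case False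
    then have "U - {b} \<noteq> {}" if "b \<in> U" for b using that by (auto simp: card_1_singleton_iff)
    then show ?thesis
      using False by (simp add: T sym_bracket_empty perm_sum_empty on_singletons_def)
  qed
next
  case (Suc n)
  note fin = \<open>finite T\<close> \<open>finite U\<close>
  have T: "T \<noteq> {}" using Suc.hyps(2) by auto
  define k where "k = (\<Prod>j<n. of_nat (Suc j) * (of_nat N - of_nat j) * e :: 'k)"
  define W where "W a B = (\<Prod>b\<in>B. \<omega> a b) - (\<Prod>b\<in>B. \<omega> b a)" for a B
  define P where "P b S = (\<Prod>i\<in>S. c i b)" for b S
  have IH: "sym_bracket \<omega> f (on_singletons g) (T - {m}) (U - {a}) =
      k * (\<Sum>b\<in>U - {a}. g b * perm_sum f (T - {m}) (U - {b} - {a}) * P b (U - {b} - {a}))"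
    if "m \<in> T" for m a
  proof -
    have "card (T - {m}) = n" using that Suc.hyps(2) fin by simp
    then show ?thesis
      using Suc.hyps(1)[of "T - {m}" "U - {a}"] fin
      by (simp add: k_def P_def Diff_insert2[symmetric] insert_commute)
  qed
  have key: "(\<Sum>a\<in>S. P b (S - {a}) * W a (insert b (S - {a}))) =
      of_nat (Suc n) * (of_nat N - of_nat n) * e * P b S"
    if S: "S \<subseteq> K" "b \<in> L" "b \<notin> S" "card S = Suc n" for b S
  proof -
    have finS: "finite S" using S(4) by (intro card_ge_0_finite) simp
    define z where "z i = l b - l i" for i
    have z: "\<nu> j i * (z i - z j) = 1" if "i \<in> K" "j \<in> K" "i \<noteq> j" for i j
      using inv[of j i] that by (simp add: z_def)
    have \<omega>S: "\<omega> i j = 1 - e * \<nu> j i" "\<omega> j i = 1 - (- e) * \<nu> j i" if "i \<in> S" "j \<in> S" "i \<noteq> j" for i j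
    proof -
      have "\<nu> i j = - \<nu> j i"
        using inv_antisym[of K \<nu> l i j] inv that S by auto
      then show "\<omega> i j = 1 - e * \<nu> j i" "\<omega> j i = 1 - (- e) * \<nu> j i"
        using \<omega>_KK[of i j] \<omega>_KK[of j i] that S by auto
    qed
    define \<mu> where "\<mu> i j = \<nu> j i" for i j
    have \<mu>: "\<mu> i j * (z i - z j) = 1" if "i \<in> K" "j \<in> K" "i \<noteq> j" for i j
      using z that by (simp add: \<mu>_def)
    have sums: "(\<Sum>i\<in>S. \<Prod>j\<in>S - {i}. 1 - e' * \<mu> i j) = of_nat (card S)"
      "(\<Sum>i\<in>S. z i * (\<Prod>j\<in>S - {i}. 1 - e' * \<mu> i j)) = (\<Sum>i\<in>S. z i) - of_nat (card S choose 2) * e'" for e'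
      by (rule sum_partial_fraction_products[of K \<mu> z]; use \<mu> finS S(1) in blast)+
    have p: "(\<Prod>j\<in>S - {i}. \<omega> i j) = (\<Prod>j\<in>S - {i}. 1 - e * \<mu> i j)"
        "(\<Prod>j\<in>S - {i}. \<omega> j i) = (\<Prod>j\<in>S - {i}. 1 - (- e) * \<mu> i j)" if "i \<in> S" for i
      using that by (auto intro!: prod.cong \<omega>S simp: \<mu>_def simp del: mult_minus_left)
    have "P b (S - {a}) * W a (insert b (S - {a})) =
      P b S * ((z a + \<alpha>) * (\<Prod>j\<in>S - {a}. 1 - e * \<mu> a j) - (z a - \<alpha>) * (\<Prod>j\<in>S - {a}. 1 - (- e) * \<mu> a j))"
      if a: "a \<in> S" for a
    proof -
      have "P b S = c a b * P b (S - {a})"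
        unfolding P_def using finS a by (rule prod.remove)
      moreover have "W a (insert b (S - {a})) =
         c a b * (z a + \<alpha>) * (\<Prod>j\<in>S - {a}. 1 - e * \<mu> a j) -
         c a b * (z a - \<alpha>) * (\<Prod>j\<in>S - {a}. 1 - (- e) * \<mu> a j)"
        unfolding W_def p(1)[OF a, symmetric] p(2)[OF a, symmetric]
        using finS S a \<omega>_KL[of a b] \<omega>_LK[of a b] by (subst (1 2) prod.insert) (auto simp: z_def)
      ultimately show ?thesis by (simp only:) (simp add: algebra_simps)
    qed
    then have "(\<Sum>a\<in>S. P b (S - {a}) * W a (insert b (S - {a}))) = P b S *
       ((\<Sum>a\<in>S. z a * (\<Prod>j\<in>S - {a}. 1 - e * \<mu> a j)) + \<alpha> * (\<Sum>a\<in>S. \<Prod>j\<in>S - {a}. 1 - e * \<mu> a j) -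
       ((\<Sum>a\<in>S. z a * (\<Prod>j\<in>S - {a}. 1 - (- e) * \<mu> a j)) - \<alpha> * (\<Sum>a\<in>S. \<Prod>j\<in>S - {a}. 1 - (- e) * \<mu> a j)))"
      by (simp add: distrib_right left_diff_distrib sum.distrib sum_subtractf flip: sum_distrib_left)
    also have "\<dots> = P b S * (2 * \<alpha> * of_nat (Suc n) - 2 * of_nat (Suc n choose 2) * e)"
      by (simp only: sums S(4)) (simp add: algebra_simps)
    also have "2 * of_nat (Suc n choose 2) = (of_nat (Suc n) * of_nat n :: 'k)"
    proof -
      have "2 * (Suc n choose 2) = Suc n * n" by (simp add: choose_two)
      then show ?thesis by (metis of_nat_mult of_nat_numeral)
    qed
    finally show ?thesis unfolding \<alpha> by (simp add: algebra_simps)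
  qed
  \<comment> \<open>Sets \<open>S\<close> of the wrong size or colour do not contribute, since their permanents vanish.\<close>
  have inner: "g b * perm_sum f T S * (\<Sum>a\<in>S. P b (S - {a}) * W a (insert b (S - {a}))) =
      of_nat (Suc n) * (of_nat N - of_nat n) * e * (g b * perm_sum f T S * P b S)"
    if "b \<notin> S" for b S
  proof (cases "b \<in> L \<and> S \<subseteq> K \<and> card S = Suc n")
    case True
    then show ?thesis using key[of S b] that by (simp add: mult_ac)
  next
    case False
    then have "g b * perm_sum f T S = 0"
      using g[of b] f perm_sum_eq_0[OF fin(1), of S f] perm_sum_eq_0_vanishing[OF fin(1), of _ S f] Suc.hyps(2)
      by (metis mult_not_zero subsetI)
    then show ?thesis by simp
  qed
  have "sym_bracket \<omega> f (on_singletons g) T U =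
    (\<Sum>m\<in>T. \<Sum>a\<in>U. f m a * (k * (\<Sum>b\<in>U - {a}. g b * perm_sum f (T - {m}) (U - {b} - {a}) * P b (U - {b} - {a})))
       * W a (U - {a}))"
    unfolding sym_bracket_rec[OF fin(1) T fin(2)] W_def by (intro sum.cong refl) (simp only: IH)
  also have "\<dots> = (\<Sum>m\<in>T. \<Sum>a\<in>U. \<Sum>b\<in>U - {a}.
       k * g b * (f m a * perm_sum f (T - {m}) (U - {b} - {a})) * (P b (U - {b} - {a}) * W a (U - {a})))"
    by (simp add: sum_distrib_left sum_distrib_right mult_ac)
  also have "\<dots> = (\<Sum>a\<in>U. \<Sum>b\<in>U - {a}. \<Sum>m\<in>T.
       k * g b * (f m a * perm_sum f (T - {m}) (U - {b} - {a})) * (P b (U - {b} - {a}) * W a (U - {a})))"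
    by (subst sum.swap) (intro sum.cong refl sum.swap)
  also have "\<dots> = (\<Sum>a\<in>U. \<Sum>b\<in>U - {a}. k * g b * perm_sum f T (U - {b}) * (P b (U - {b} - {a}) * W a (U - {a})))"
  proof (intro sum.cong refl)
    fix a b assume ab: "a \<in> U" "b \<in> U - {a}"
    have "(\<Sum>m\<in>T. f m a * perm_sum f (T - {m}) (U - {b} - {a})) = perm_sum f T (U - {b})"
      using fin ab by (intro perm_sum_expand) auto
    then show "(\<Sum>m\<in>T. k * g b * (f m a * perm_sum f (T - {m}) (U - {b} - {a})) * (P b (U - {b} - {a}) * W a (U - {a})))
        = k * g b * perm_sum f T (U - {b}) * (P b (U - {b} - {a}) * W a (U - {a}))"
      by (simp flip: sum_distrib_left sum_distrib_right)
  qed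
  also have "\<dots> = (\<Sum>b\<in>U. \<Sum>a\<in>U - {b}. k * g b * perm_sum f T (U - {b}) * (P b (U - {b} - {a}) * W a (U - {a})))"
    using fin by (subst (1 2) sum.Sigma) (auto intro!: sum.reindex_bij_witness[of _ prod.swap prod.swap])
  also have "\<dots> = (\<Sum>b\<in>U. k * (g b * perm_sum f T (U - {b}) *
       (\<Sum>a\<in>U - {b}. P b (U - {b} - {a}) * W a (insert b (U - {b} - {a})))))"
    unfolding sum_distrib_left mult.assoc
  proof (intro sum.cong refl)
    fix b a assume "b \<in> U" "a \<in> U - {b}"
    then have "U - {a} = insert b (U - {b} - {a})" by auto
    then show "k * (g b * (perm_sum f T (U - {b}) * (P b (U - {b} - {a}) * W a (U - {a})))) =
      k * (g b * (perm_sum f T (U - {b}) * (P b (U - {b} - {a}) * W a (insert b (U - {b} - {a})))))" by simp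
  qed
  also have "\<dots> = k * (of_nat (Suc n) * (of_nat N - of_nat n) * e) * (\<Sum>b\<in>U. g b * perm_sum f T (U - {b}) * P b (U - {b}))"
    by (subst inner) (auto simp: sum_distrib_left mult_ac)
  finally show ?case
    by (simp add: k_def P_def Suc.hyps(2)[symmetric] lessThan_Suc mult_ac)
qed

corollary sym_bracket_eq_0:
  assumes "\<And>i j. i \<in> K \<Longrightarrow> j \<in> K \<Longrightarrow> i \<noteq> j \<Longrightarrow> \<nu> i j * (l i - l j) = 1"
    and "\<And>i j. i \<in> K \<Longrightarrow> j \<in> K \<Longrightarrow> i \<noteq> j \<Longrightarrow> \<omega> i j = 1 + e * \<nu> i j"
    and "\<And>i b. i \<in> K \<Longrightarrow> b \<in> L \<Longrightarrow> \<omega> i b = c i b * (l b - l i + \<alpha>)"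
    and "\<And>i b. i \<in> K \<Longrightarrow> b \<in> L \<Longrightarrow> \<omega> b i = c i b * (l b - l i - \<alpha>)"
    and "2 * \<alpha> = of_nat N * e"
    and "\<And>m x. x \<notin> K \<Longrightarrow> f m x = 0" and "\<And>x. x \<notin> L \<Longrightarrow> g x = 0"
    and "finite T" "finite U" "card T = Suc N"
  shows "sym_bracket \<omega> f (on_singletons g) T U = 0"
proof -
  have "(\<Prod>j<card T. of_nat (Suc j) * (of_nat N - of_nat j) * e) = 0"
    using assms(10) by (intro prod_zero) (auto intro!: bexI[of _ N])
  then show ?thesis
    by (subst sym_bracket_closed_form[where c = c and N = N, OF assms(1-9)]) (assumption | simp)+
qed

section \<open>Symmetric fractions with simple poles are polynomials\<close>

definition swap_vars :: "'i \<Rightarrow> nat \<Rightarrow> nat \<Rightarrow> 'i \<Rightarrow> nat \<Rightarrow> nat" where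
  "swap_vars i s t j = (if j = i then Transposition.transpose s t else id)"

definition var_diff :: "'i \<times> nat \<times> nat \<Rightarrow> ('i, 'r::comm_ring_1) mpol" where
  "var_diff = (\<lambda>(i, s, t). lam i s - lam i t)"

lemma regular_lam_diff: "(i, s) \<noteq> (j, t) \<Longrightarrow> regular (lam i s - lam j t)"
  using regular_var_diff[of "(i, s)" "(j, t)"] by (simp add: var_def)

text \<open>The poles are removed one at a time.  Let \<open>\<delta> = \<lambda>\<^sub>s - \<lambda>\<^sub>t\<close>, let \<open>D\<close> be the product of the other
  denominators, and \<open>\<delta> D P = N\<close>.  Applying the transposition \<open>\<tau>\<close> of \<open>\<lambda>\<^sub>s\<close> and \<open>\<lambda>\<^sub>t\<close>, which fixes \<open>P\<close>
  and negates \<open>\<delta>\<close>, to \<open>\<delta> D \<tau>(D) P = N \<tau>(D)\<close> gives \<open>\<tau>(N) D = - N \<tau>(D)\<close>.  On the locus \<open>\<lambda>\<^sub>s = \<lambda>\<^sub>t\<close>, where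
  \<open>\<tau>\<close> is the identity and \<open>D\<close> is regular, this says that \<open>2 N\<close> and hence \<open>N\<close> vanishes, so \<open>\<delta>\<close> divides \<open>N\<close>.\<close>

lemma remove_denominators:
  fixes P :: "('i, 'r::comm_ring_1) mpol tfrac"
  assumes two: "\<And>x :: ('i, 'r) mpol. 2 * x = 0 \<Longrightarrow> x = 0"
    and "finite E"
    and "\<And>i s t. (i, s, t) \<in> E \<Longrightarrow> s < t"
    and "\<And>i s t. (i, s, t) \<in> E \<Longrightarrow> tfrac_lift (subst (\<lambda>j u. lam j (swap_vars i s t j u))) P P"
    and "to_tfrac (prod var_diff E) * P = to_tfrac N"
  shows "\<exists>M. P = to_tfrac M"
  using assms(2-)
proof (induction E arbitrary: N)
  case empty
  then show ?case by auto
next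
  case (insert p E)
  obtain i s t where p: "p = (i, s, t)" by (cases p) auto
  with insert.prems(1) have st: "s < t" by auto
  define \<tau> :: "('i, 'r) mpol \<Rightarrow> ('i, 'r) mpol" where "\<tau> = subst (\<lambda>j u. lam j (swap_vars i s t j u))"
  define \<epsilon> :: "('i, 'r) mpol \<Rightarrow> ('i, 'r) mpol" where
    "\<epsilon> = subst (\<lambda>j u. if j = i \<and> u = t then lam i s else lam j u)"
  define \<delta> :: "('i, 'r) mpol" where "\<delta> = lam i s - lam i t"
  define D :: "('i, 'r) mpol" where "D = prod var_diff E"
  have hom: "is_hom \<tau>" "is_hom \<epsilon>" by (simp_all add: \<tau>_def \<epsilon>_def is_hom_subst)
  have \<tau>\<tau>: "\<tau> (\<tau> f) = f" for f
  proof -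
    have "\<tau> (\<tau> f) = subst lam f"
      unfolding \<tau>_def subst_subst by (rule arg_cong2[where f = subst]) (auto simp: swap_vars_def fun_eq_iff)
    then show ?thesis by simp
  qed
  have \<epsilon>\<tau>: "\<epsilon> (\<tau> f) = \<epsilon> f" for f
    unfolding \<tau>_def \<epsilon>_def subst_subst
    by (rule arg_cong2[where f = subst]) (auto simp: swap_vars_def fun_eq_iff Transposition.transpose_def)
  have \<tau>\<delta>: "\<tau> \<delta> = - \<delta>"
    by (simp add: \<tau>_def \<delta>_def subst_diff swap_vars_def)
  have \<delta>: "regular \<delta>"
    using st by (simp add: \<delta>_def regular_lam_diff)
  have "regular (\<epsilon> D)"
    unfolding D_def is_hom_prod[OF hom(2)]
  proof (rule regular_prod)
    fix x assume x: "x \<in> E"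
    obtain j u v where juv: "x = (j, u, v)" by (cases x) auto
    then have "u < v" "(j, u, v) \<noteq> (i, s, t)"
      using insert.prems(1) insert.hyps x p by auto
    then show "regular (\<epsilon> (var_diff x))"
      using st by (auto simp: juv var_diff_def \<epsilon>_def subst_diff intro!: regular_lam_diff)
  qed
  have DP: "to_tfrac (\<delta> * D) * P = to_tfrac N"
    using insert.prems(3) insert.hyps by (simp add: p var_diff_def D_def \<delta>_def)
  have lift: "tfrac_lift \<tau> P P"
    unfolding \<tau>_def using insert.prems(2)[of i s t] by (simp add: p)
  have 1: "to_tfrac (\<delta> * (D * \<tau> D)) * P = to_tfrac (N * \<tau> D)"
    using arg_cong[OF DP, of "\<lambda>x. x * to_tfrac (\<tau> D)"] by (simp add: to_tfrac_mult mult_ac)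
  have "tfrac_lift \<tau> (to_tfrac (\<delta> * (D * \<tau> D)) * P) (to_tfrac (\<tau> (\<delta> * (D * \<tau> D))) * P)"
    by (intro tfrac_lift_mult hom lift tfrac_lift_to_tfrac)
  moreover have "tfrac_lift \<tau> (to_tfrac (\<delta> * (D * \<tau> D)) * P) (to_tfrac (\<tau> (N * \<tau> D)))"
    unfolding 1 by (intro tfrac_lift_to_tfrac hom)
  ultimately have "to_tfrac (\<tau> (\<delta> * (D * \<tau> D))) * P = to_tfrac (\<tau> (N * \<tau> D))"
    by (rule tfrac_lift_unique[OF hom(1)])
  then have "- (to_tfrac (\<delta> * (D * \<tau> D)) * P) = to_tfrac (\<tau> N * D)"
    by (simp add: is_homD(3)[OF hom(1)] \<tau>\<tau> \<tau>\<delta> mult_ac to_tfrac_mult to_tfrac_uminus)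
  then have "- (N * \<tau> D) = \<tau> N * D"
    unfolding 1 by (simp flip: to_tfrac_uminus)
  then have "\<epsilon> (- (N * \<tau> D)) = \<epsilon> (\<tau> N * D)" by simp
  then have "2 * (\<epsilon> D * \<epsilon> N) = 0"
  proof -
    assume "\<epsilon> (- (N * \<tau> D)) = \<epsilon> (\<tau> N * D)"
    then have "- (\<epsilon> D * \<epsilon> N) = \<epsilon> D * \<epsilon> N"
      by (simp only: is_homD(3,5)[OF hom(2)] \<epsilon>\<tau> mult.commute[of "\<epsilon> N"])
    then show ?thesis by (simp only: mult_2) (metis add.left_inverse)
  qed
  then have "\<epsilon> D * \<epsilon> N = 0" by (rule two)
  then have "\<epsilon> N = 0"
    using \<open>regular (\<epsilon> D)\<close> unfolding regular_def by blast
  moreover have "\<delta> dvd N - \<epsilon> N"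
    unfolding \<epsilon>_def by (rule dvd_diff_subst) (use dvd_minus_iff[of \<delta> \<delta>] in \<open>simp add: \<delta>_def\<close>)
  ultimately have "\<delta> dvd N" by simp
  then obtain M where M: "N = \<delta> * M" by (rule dvdE)
  have "to_tfrac D * P = to_tfrac M"
    by (rule to_tfrac_cancel[OF \<delta>]) (use DP M in \<open>simp add: to_tfrac_mult mult.assoc\<close>)
  then show ?case
    unfolding D_def using insert.prems(1,2) by (intro insert.IH) auto
qed


section \<open>Evaluation at finite sets of variables\<close>

definition dimv :: "('i \<times> nat) set \<Rightarrow> 'i dimvec" where
  "dimv U = (\<Sum>x\<in>U. Poly_Mapping.single (fst x) 1)"

definition std :: "'i dimvec \<Rightarrow> ('i \<times> nat) set" where
  "std v = {(i, s). 1 \<le> s \<and> s \<le> lookup v i}"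

definition enumerates :: "('i \<Rightarrow> nat \<Rightarrow> nat) \<Rightarrow> 'i dimvec \<Rightarrow> ('i \<times> nat) set \<Rightarrow> bool" where
  "enumerates e v U \<longleftrightarrow> (\<forall>i. bij_betw (e i) {1..lookup v i} {s. (i, s) \<in> U})"

definition relabel :: "('i \<Rightarrow> nat \<Rightarrow> nat) \<Rightarrow> 'i \<times> nat \<Rightarrow> 'i \<times> nat" where
  "relabel e x = (fst x, e (fst x) (snd x))"

lemma lookup_dimv:
  assumes "finite U"
  shows "lookup (dimv U) i = card {s. (i, s) \<in> U}"
proof -
  have "lookup (dimv U) i = card {x \<in> U. fst x = i}"
    using assms by (simp add: dimv_def lookup_sum lookup_single when_def sum.If_cases Int_def)
  also have "{x \<in> U. fst x = i} = Pair i ` {s. (i, s) \<in> U}" by auto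
  finally show ?thesis by (simp add: card_image inj_on_def)
qed

lemma dimv_Un: "finite A \<Longrightarrow> finite B \<Longrightarrow> A \<inter> B = {} \<Longrightarrow> dimv (A \<union> B) = dimv A + dimv B"
  by (simp add: dimv_def sum.union_disjoint)

lemma dimv_Diff: "finite U \<Longrightarrow> A \<subseteq> U \<Longrightarrow> dimv U = dimv A + dimv (U - A)"
  using dimv_Un[of A "U - A"] by (simp add: Un_absorb1 finite_subset)

lemma finite_std: "finite (std v)"
proof -
  have "std v \<subseteq> (SIGMA i:keys v. {1..lookup v i})"
    by (auto simp: std_def in_keys_iff)
  then show ?thesis by (rule finite_subset) auto
qed

lemma dimv_std [simp]: "dimv (std v) = v"
proof (rule poly_mapping_eqI)
  fix i
  have "{s. (i, s) \<in> std v} = {1..lookup v i}" by (auto simp: std_def)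
  then show "lookup (dimv (std v)) i = lookup v i"
    by (simp add: lookup_dimv[OF finite_std])
qed

lemma enumerates_std: "enumerates (\<lambda>i s. s) v (std v)"
  by (auto simp: enumerates_def std_def bij_betw_def)

lemma ex_enumerates:
  assumes "finite U"
  shows "\<exists>e. enumerates e (dimv U) U"
proof -
  have "\<exists>f. bij_betw f {1..lookup (dimv U) i} {s. (i, s) \<in> U}" for i
  proof (rule finite_same_card_bij)
    have "{s. (i, s) \<in> U} \<subseteq> snd ` U" by force
    then show "finite {s. (i, s) \<in> U}" using assms by (auto intro: finite_subset)
  qed (simp_all add: lookup_dimv assms)
  then show ?thesis unfolding enumerates_def by metis
qed

lemma enumerates_imp_image:
  assumes "enumerates e v U"
  shows "U = relabel e ` std v"
proof -
  have "{s. (i, s) \<in> U} = e i ` {1..lookup v i}" for i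
    using assms by (simp add: enumerates_def bij_betw_def)
  then have iff: "(i, t) \<in> U \<longleftrightarrow> t \<in> e i ` {1..lookup v i}" for i t
    by blast
  show ?thesis
  proof (rule Set.set_eqI)
    fix x
    show "x \<in> U \<longleftrightarrow> x \<in> relabel e ` std v"
      using iff[of "fst x" "snd x"] by (cases x) (auto simp: relabel_def std_def image_iff)
  qed
qed

lemma enumerates_imp_inj:
  assumes "enumerates e v U"
  shows "inj_on (relabel e) (std v)"
proof (rule inj_onI)
  fix x y assume xy: "x \<in> std v" "y \<in> std v" "relabel e x = relabel e y"
  then have fst: "fst x = fst y" and snd: "e (fst x) (snd x) = e (fst x) (snd y)"
    by (auto simp: relabel_def)
  have "inj_on (e (fst x)) {1..lookup v (fst x)}"
    using assms by (simp add: enumerates_def bij_betw_def)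
  then have "snd x = snd y"
    using snd by (rule inj_onD) (use xy fst in \<open>auto simp: std_def\<close>)
  with fst show "x = y" by (rule prod_eqI)
qed

lemma enumerates_imp_finite: "enumerates e v U \<Longrightarrow> finite U"
  using enumerates_imp_image finite_std by (metis finite_imageI)

lemma dimv_relabel: "inj_on (relabel e) U \<Longrightarrow> dimv (relabel e ` U) = dimv U"
  unfolding dimv_def by (subst sum.reindex) (auto simp: relabel_def)

lemma enumerates_imp_dimv: "enumerates e v U \<Longrightarrow> dimv U = v"
  using dimv_relabel[OF enumerates_imp_inj, of e v U] by (simp flip: enumerates_imp_image)

lemma enumerates_relabel:
  assumes "enumerates e v U" and "inj_on (relabel e') U"
  shows "enumerates (\<lambda>i s. e' i (e i s)) v (relabel e' ` U)"
  unfolding enumerates_def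
proof
  fix i
  have "bij_betw (e i) {1..lookup v i} {s. (i, s) \<in> U}"
    using assms(1) by (simp add: enumerates_def)
  moreover have "bij_betw (e' i) {s. (i, s) \<in> U} {s. (i, s) \<in> relabel e' ` U}"
    unfolding bij_betw_def
  proof
    show "inj_on (e' i) {s. (i, s) \<in> U}"
      using assms(2) by (fastforce simp: inj_on_def relabel_def)
    show "e' i ` {s. (i, s) \<in> U} = {s. (i, s) \<in> relabel e' ` U}"
      by (auto simp: relabel_def image_iff Bex_def)
  qed
  ultimately have "bij_betw (e' i \<circ> e i) {1..lookup v i} {s. (i, s) \<in> relabel e' ` U}"
    by (rule bij_betw_trans)
  then show "bij_betw (\<lambda>s. e' i (e i s)) {1..lookup v i} {s. (i, s) \<in> relabel e' ` U}"
    by (simp add: comp_def)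
qed

lemma SH_iff:
  "f \<in> SH v \<longleftrightarrow> in_vars (std v) f \<and>
     (\<forall>\<sigma>. (\<forall>i. \<sigma> i permutes {1..lookup v i}) \<longrightarrow> subst (\<lambda>i s. lam i (\<sigma> i s)) f = f)"
  by (simp add: SH_def in_vars_def std_def)

text \<open>The choice of the enumeration is immaterial for \<open>f \<in> SH (dimv U)\<close>; the value is meaningless for
  other \<open>f\<close>.\<close>

definition eval_at :: "('i, 'r::comm_ring_1) mpol \<Rightarrow> ('i \<times> nat) set \<Rightarrow> ('i, 'r) mpol" where
  "eval_at f U = subst (\<lambda>i s. lam i ((SOME e. enumerates e (dimv U) U) i s)) f"

text \<open>Two enumerations of the same set differ by a permutation of the indices of each colour, under
  which \<open>f\<close> is invariant.\<close>

lemma subst_enumerations_eq: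
  assumes f: "f \<in> SH v" and e: "enumerates e v U" and e': "enumerates e' v U"
  shows "subst (\<lambda>i s. lam i (e i s)) f = subst (\<lambda>i s. lam i (e' i s)) f"
proof -
  let ?I = "\<lambda>i. {1..lookup v i}"
  define \<sigma> where "\<sigma> i s = (if s \<in> ?I i then inv_into (?I i) (e' i) (e i s) else s)" for i s
  have bij: "bij_betw (e i) (?I i) {s. (i, s) \<in> U}" "bij_betw (e' i) (?I i) {s. (i, s) \<in> U}" for i
    using e e' by (simp_all add: enumerates_def)
  have "\<sigma> i permutes ?I i" for i
  proof (rule bij_imp_permutes)
    have "bij_betw (inv_into (?I i) (e' i) \<circ> e i) (?I i) (?I i)"
      using bij[of i] by (blast intro: bij_betw_trans bij_betw_inv_into)
    then show "bij_betw (\<sigma> i) (?I i) (?I i)"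
      by (rule bij_betw_cong[THEN iffD1, rotated]) (simp add: \<sigma>_def)
  qed (auto simp: \<sigma>_def)
  then have "subst (\<lambda>i s. lam i (e' i s)) f = subst (\<lambda>i s. lam i (e' i s)) (subst (\<lambda>i s. lam i (\<sigma> i s)) f)"
    using f by (simp add: SH_iff)
  also have "\<dots> = subst (\<lambda>i s. lam i (e' i (\<sigma> i s))) f"
    by (simp add: subst_subst)
  also have "\<dots> = subst (\<lambda>i s. lam i (e i s)) f"
  proof (rule subst_cong[where V = "std v"])
    show "in_vars (std v) f" using f by (simp add: SH_iff)
    fix i s assume "(i, s) \<in> std v"
    then have s: "s \<in> ?I i" by (simp add: std_def)
    have "e i s \<in> e' i ` ?I i"
      using bij[of i] s by (metis bij_betw_def imageI)
    then show "lam i (e' i (\<sigma> i s)) = lam i (e i s)"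
      using s by (simp add: \<sigma>_def f_inv_into_f)
  qed
  finally show ?thesis by simp
qed

lemma eval_at_eq:
  assumes f: "f \<in> SH v" and e: "enumerates e v U"
  shows "eval_at f U = subst (\<lambda>i s. lam i (e i s)) f"
proof -
  have "enumerates (SOME e. enumerates e v U) v U"
    using e by (rule someI[where P = "\<lambda>e. enumerates e v U"])
  then show ?thesis
    unfolding eval_at_def enumerates_imp_dimv[OF e] by (rule subst_enumerations_eq[OF f _ e])
qed

lemma eval_at_std: "f \<in> SH v \<Longrightarrow> eval_at f (std v) = f"
  using eval_at_eq[OF _ enumerates_std] subst_lam_id by fastforce

lemma subst_eval_at:
  assumes f: "f \<in> SH (dimv U)" and U: "finite U" and e: "inj_on (relabel e) U"
    and h: "\<And>i s. (i, s) \<in> U \<Longrightarrow> h i s = lam i (e i s)"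
  shows "subst h (eval_at f U) = eval_at f (relabel e ` U)"
proof -
  obtain e0 where e0: "enumerates e0 (dimv U) U" using ex_enumerates[OF U] by blast
  have "subst h (eval_at f U) = subst (\<lambda>i s. h i (e0 i s)) f"
    by (simp add: eval_at_eq[OF f e0] subst_subst)
  also have "\<dots> = subst (\<lambda>i s. lam i (e i (e0 i s))) f"
  proof (rule subst_cong[where V = "std (dimv U)"])
    show "in_vars (std (dimv U)) f" using f by (simp add: SH_iff)
    fix i s assume "(i, s) \<in> std (dimv U)"
    then have "relabel e0 (i, s) \<in> U" using enumerates_imp_image[OF e0] by blast
    then show "h i (e0 i s) = lam i (e i (e0 i s))"
      using h by (simp add: relabel_def)
  qed
  also have "\<dots> = eval_at f (relabel e ` U)"
    using eval_at_eq[OF f enumerates_relabel[OF e0 e]] by simp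
  finally show ?thesis .
qed

lemma SH_0: "0 \<in> SH v"
  by (simp add: SH_iff in_vars_0)

lemma in_vars_add: "in_vars V f \<Longrightarrow> in_vars V g \<Longrightarrow> in_vars V (f + g)"
  using keys_add[of f g] unfolding in_vars_def by blast

lemma in_vars_const_mult: "in_vars V f \<Longrightarrow> in_vars V (Poly_Mapping.single 0 c * f)"
  using keys_mult[of "Poly_Mapping.single 0 c" f] unfolding in_vars_def by (fastforce split: if_splits)

lemma SH_add: "f \<in> SH v \<Longrightarrow> g \<in> SH v \<Longrightarrow> f + g \<in> SH v"
  by (simp add: SH_iff in_vars_add subst_add)

lemma SH_const_mult: "f \<in> SH v \<Longrightarrow> Poly_Mapping.single 0 c * f \<in> SH v"
  by (simp add: SH_iff in_vars_const_mult subst_mult)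

lemma eval_at_add: "eval_at (f + g) U = eval_at f U + eval_at g U"
  by (simp add: eval_at_def subst_add)

lemma eval_at_0: "eval_at 0 U = 0"
  by (simp add: eval_at_def)

lemma eval_at_const_mult: "eval_at (Poly_Mapping.single 0 c * f) U = Poly_Mapping.single 0 c * eval_at f U"
  by (simp add: eval_at_def subst_mult)

section \<open>The shuffle product as a convolution\<close>

lemma bij_betw_Pow_image:
  assumes "inj_on f U"
  shows "bij_betw ((`) f) (Pow U) (Pow (f ` U))"
  using bij_betw_Pow[OF inj_on_imp_bij_betw[OF assms]] .

lemma to_tfrac_range_add: "x \<in> range to_tfrac \<Longrightarrow> y \<in> range to_tfrac \<Longrightarrow> x + y \<in> range to_tfrac"
  by (auto simp flip: to_tfrac_add)

lemma to_tfrac_range_mult: "x \<in> range to_tfrac \<Longrightarrow> y \<in> range to_tfrac \<Longrightarrow> x * y \<in> range to_tfrac"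
  by (auto simp flip: to_tfrac_mult)

lemma to_tfrac_range_sum: "(\<And>x. x \<in> A \<Longrightarrow> f x \<in> range to_tfrac) \<Longrightarrow> sum f A \<in> range to_tfrac"
  by (induction A rule: infinite_finite_induct) (auto intro: range_eqI[of _ _ 0] to_tfrac_range_add)

lemma to_tfrac_range_prod: "(\<And>x. x \<in> A \<Longrightarrow> f x \<in> range to_tfrac) \<Longrightarrow> prod f A \<in> range to_tfrac"
  by (induction A rule: infinite_finite_induct) (auto intro: range_eqI[of _ _ 1] to_tfrac_range_mult)

lemma std_Sigma: "keys v \<subseteq> I \<Longrightarrow> std v = (SIGMA i:I. {1..lookup v i})"
  by (force simp: std_def in_keys_iff)

lemma prod_std:
  "finite I \<Longrightarrow> keys v \<subseteq> I \<Longrightarrow>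
     (\<Prod>x\<in>std v. f (fst x) (snd x)) = (\<Prod>i\<in>I. \<Prod>s=1..lookup v i. f i s)"
  by (simp add: std_Sigma prod.Sigma case_prod_unfold)

lemma prod_parity:
  "(\<Prod>x\<in>A. if even (f x :: int) then 1 else - 1) = (if even (\<Sum>x\<in>A. f x) then 1 else (- 1 :: 'a::comm_ring_1))"
  by (induction A rule: infinite_finite_induct) auto

definition shuffle_set :: "'i dimvec \<Rightarrow> ('i \<Rightarrow> nat \<Rightarrow> nat) \<Rightarrow> ('i \<times> nat) set" where
  "shuffle_set v \<sigma> = relabel \<sigma> ` std v"

context
  fixes v w :: "'i dimvec"
begin

lemma shuffle_permutes: "\<sigma> \<in> shuffles v w \<Longrightarrow> \<sigma> i permutes {1..lookup v i + lookup w i}"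
  by (simp add: shuffles_def Let_def)

lemma shuffle_mono:
  assumes "\<sigma> \<in> shuffles v w"
  shows "strict_mono_on {1..lookup v i} (\<sigma> i)"
    "strict_mono_on {lookup v i + 1..lookup v i + lookup w i} (\<sigma> i)"
  using assms by (simp_all add: shuffles_def Let_def)

lemma enumerates_shuffle_left:
  assumes "\<sigma> \<in> shuffles v w"
  shows "enumerates \<sigma> v (shuffle_set v \<sigma>)"
  unfolding enumerates_def shuffle_set_def
proof
  fix i
  have "inj_on (\<sigma> i) {1..lookup v i}"
    by (rule inj_on_subset[OF permutes_inj[OF shuffle_permutes[OF assms]]]) simp
  moreover have "\<sigma> i ` {1..lookup v i} = {s. (i, s) \<in> relabel \<sigma> ` std v}"
    by (auto simp: relabel_def std_def image_iff)
  ultimately show "bij_betw (\<sigma> i) {1..lookup v i} {s. (i, s) \<in> relabel \<sigma> ` std v}"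
    by (simp add: bij_betw_def)
qed

lemma enumerates_shuffle_right:
  assumes "\<sigma> \<in> shuffles v w"
  shows "enumerates (\<lambda>i t. \<sigma> i (t + lookup v i)) w (std (v + w) - shuffle_set v \<sigma>)"
  unfolding enumerates_def shuffle_set_def
proof
  fix i
  let ?a = "lookup v i" and ?b = "lookup w i"
  note perm = shuffle_permutes[OF assms, of i]
  have inj: "inj (\<sigma> i)" by (rule permutes_inj[OF perm])
  have "inj_on (\<lambda>t. \<sigma> i (t + ?a)) {1..?b}"
    by (rule inj_onI) (simp add: inj_eq[OF inj])
  moreover have "(\<lambda>t. \<sigma> i (t + ?a)) ` {1..?b} = {s. (i, s) \<in> std (v + w) - relabel \<sigma> ` std v}"
  proof -
    have "(\<lambda>t. \<sigma> i (t + ?a)) ` {1..?b} = \<sigma> i ` (\<lambda>t. t + ?a) ` {1..?b}"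
      by (simp only: image_image)
    also have "(\<lambda>t. t + ?a) ` {1..?b} = {1..?a + ?b} - {1..?a}"
      by (auto simp: image_iff intro!: bexI[of _ "_ - ?a"])
    also have "\<sigma> i ` \<dots> = {1..?a + ?b} - \<sigma> i ` {1..?a}"
      by (simp only: image_set_diff[OF inj] permutes_image[OF perm])
    also have "\<dots> = {s. (i, s) \<in> std (v + w) - relabel \<sigma> ` std v}"
      by (auto simp: relabel_def std_def image_iff lookup_add)
    finally show ?thesis .
  qed
  ultimately show "bij_betw (\<lambda>t. \<sigma> i (t + ?a)) {1..?b} {s. (i, s) \<in> std (v + w) - relabel \<sigma> ` std v}"
    by (simp add: bij_betw_def)
qed

lemma shuffle_set_subset:
  assumes "\<sigma> \<in> shuffles v w"
  shows "shuffle_set v \<sigma> \<subseteq> std (v + w)"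
proof
  fix x assume "x \<in> shuffle_set v \<sigma>"
  then obtain i s where x: "x = (i, \<sigma> i s)" "s \<in> {1..lookup v i}"
    by (auto simp: shuffle_set_def relabel_def std_def)
  then have "\<sigma> i s \<in> {1..lookup v i + lookup w i}"
    using permutes_in_image[OF shuffle_permutes[OF assms, of i], of s] by auto
  then show "x \<in> std (v + w)" by (simp add: x std_def lookup_add)
qed

lemma strict_mono_on_image_eq:
  fixes f g :: "nat \<Rightarrow> nat"
  assumes f: "strict_mono_on {m..<n} f" and g: "strict_mono_on {m..<n} g"
    and "f ` {m..<n} = g ` {m..<n}" and "s \<in> {m..<n}"
  shows "f s = g s"
proof -
  have sorted: "sorted (map h [m..<n])" "distinct (map h [m..<n])" if "strict_mono_on {m..<n} h" for h :: "nat \<Rightarrow> nat"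
    using that strict_mono_on_imp_mono_on[OF that] strict_mono_on_imp_inj_on[OF that]
    by (simp_all add: sorted_map_mono distinct_map)
  have "map f [m..<n] = map g [m..<n]"
    using sorted[OF f] sorted[OF g] assms(3) by (intro sorted_distinct_set_unique) auto
  then show ?thesis using assms(4) by (simp add: map_eq_conv)
qed

text \<open>This turns sums over shuffles into sums over subsets: the two increasing halves of a shuffle are
  recovered as the increasing enumerations of the set that it gives to the first factor and of its
  complement.\<close>

lemma bij_betw_shuffle_set:
  "bij_betw (shuffle_set v) (shuffles v w) {A \<in> Pow (std (v + w)). dimv A = v}"
proof (rule bij_betwI')
  fix \<sigma> \<tau> assume \<sigma>: "\<sigma> \<in> shuffles v w" and \<tau>: "\<tau> \<in> shuffles v w"
  show "shuffle_set v \<sigma> = shuffle_set v \<tau> \<longleftrightarrow> \<sigma> = \<tau>"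
  proof
    assume eq: "shuffle_set v \<sigma> = shuffle_set v \<tau>"
    show "\<sigma> = \<tau>"
    proof (intro ext)
      fix i s
      let ?a = "lookup v i" and ?b = "lookup w i"
      have im1: "\<sigma> i ` {1..?a} = \<tau> i ` {1..?a}"
        using enumerates_shuffle_left[OF \<sigma>] enumerates_shuffle_left[OF \<tau>]
        by (simp add: enumerates_def bij_betw_def eq)
      have im2: "\<sigma> i ` {?a + 1..?a + ?b} = \<tau> i ` {?a + 1..?a + ?b}"
      proof -
        have "{?a + 1..?a + ?b} = {1..?a + ?b} - {1..?a}" by auto
        then show ?thesis
          using im1 shuffle_permutes[OF \<sigma>, of i] shuffle_permutes[OF \<tau>, of i]
          by (simp only: image_set_diff permutes_inj permutes_image)
      qed
      consider "s \<in> {1..?a}" | "s \<in> {?a + 1..?a + ?b}" | "s \<notin> {1..?a + ?b}" by force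
      then show "\<sigma> i s = \<tau> i s"
      proof cases
        case 1
        then show ?thesis
          using strict_mono_on_image_eq[of 1 "Suc ?a" "\<sigma> i" "\<tau> i" s] shuffle_mono(1)[OF \<sigma>, of i]
            shuffle_mono(1)[OF \<tau>, of i] im1
          by (simp only: atLeastLessThanSuc_atLeastAtMost)
      next
        case 2
        then show ?thesis
          using strict_mono_on_image_eq[of "?a + 1" "Suc (?a + ?b)" "\<sigma> i" "\<tau> i" s]
            shuffle_mono(2)[OF \<sigma>, of i] shuffle_mono(2)[OF \<tau>, of i] im2
          by (simp only: atLeastLessThanSuc_atLeastAtMost)
      next
        case 3
        then show ?thesis
          using permutes_not_in[OF shuffle_permutes[OF \<sigma>, of i]] permutes_not_in[OF shuffle_permutes[OF \<tau>, of i]]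
          by metis
      qed
    qed
  qed simp
next
  fix \<sigma> assume \<sigma>: "\<sigma> \<in> shuffles v w"
  then show "shuffle_set v \<sigma> \<in> {A \<in> Pow (std (v + w)). dimv A = v}"
    using shuffle_set_subset enumerates_imp_dimv[OF enumerates_shuffle_left] by auto
next
  fix A assume "A \<in> {A \<in> Pow (std (v + w)). dimv A = v}"
  then have A: "A \<subseteq> std (v + w)" "dimv A = v" by auto
  have finA: "finite A" using A(1) finite_std by (rule finite_subset)
  have "dimv (std (v + w) - A) = w"
    using dimv_Diff[OF finite_std A(1)] A(2) by simp
  have enum: "\<exists>h. bij_betw h {1..lookup (dimv B) i} {s. (i, s) \<in> B} \<and>
      strict_mono_on {1..lookup (dimv B) i} h" if B: "finite B" for B :: "('i \<times> nat) set" and i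
  proof -
    have "{s. (i, s) \<in> B} \<subseteq> snd ` B" by force
    then have "finite {s. (i, s) \<in> B}" using B by (auto intro: finite_subset)
    then obtain h where h: "bij_betw h {..<lookup (dimv B) i} {s. (i, s) \<in> B}"
        "strict_mono_on {..<lookup (dimv B) i} h"
      unfolding lookup_dimv[OF B] by (rule ex_bij_betw_strict_mono_card)
    let ?n = "lookup (dimv B) i"
    have "bij_betw (\<lambda>s. s - 1) {1..?n} {..<?n}"
      by (rule bij_betwI[of _ _ _ Suc]) auto
    then have "bij_betw (h \<circ> (\<lambda>s. s - 1)) {1..?n} {s. (i, s) \<in> B}"
      using h(1) by (rule bij_betw_trans)
    moreover have "strict_mono_on {1..?n} (h \<circ> (\<lambda>s. s - 1))"
    proof (rule strict_mono_onI)
      fix r s assume "r \<in> {1..?n}" "s \<in> {1..?n}" "r < s"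
      then show "(h \<circ> (\<lambda>s. s - 1)) r < (h \<circ> (\<lambda>s. s - 1)) s"
        using strict_mono_onD[OF h(2), of "r - 1" "s - 1"] by auto
    qed
    ultimately show ?thesis by blast
  qed
  obtain e where e: "\<And>i. bij_betw (e i) {1..lookup v i} {s. (i, s) \<in> A}"
      "\<And>i. strict_mono_on {1..lookup v i} (e i)"
    using enum[OF finA] unfolding A(2) by metis
  obtain e' where e': "\<And>i. bij_betw (e' i) {1..lookup w i} {s. (i, s) \<in> std (v + w) - A}"
      "\<And>i. strict_mono_on {1..lookup w i} (e' i)"
    using enum[of "std (v + w) - A"] finite_std unfolding \<open>dimv (std (v + w) - A) = w\<close>
    by (metis finite_Diff)
  define \<sigma> where "\<sigma> i s = (let a = lookup v i; b = lookup w i in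
      if s \<in> {1..a} then e i s else if s \<in> {a + 1..a + b} then e' i (s - a) else s)" for i s
  have "\<sigma> \<in> shuffles v w"
    unfolding shuffles_def Let_def
  proof (intro CollectI allI conjI)
    fix i
    let ?a = "lookup v i" and ?b = "lookup w i"
    have 1: "bij_betw (\<sigma> i) {1..?a} {s. (i, s) \<in> A}"
      using e(1)[of i] by (rule bij_betw_cong[THEN iffD1, rotated]) (auto simp: \<sigma>_def)
    have "bij_betw (\<lambda>s. s - ?a) {?a + 1..?a + ?b} {1..?b}"
      by (rule bij_betwI[of _ _ _ "\<lambda>s. s + ?a"]) auto
    then have "bij_betw (e' i \<circ> (\<lambda>s. s - ?a)) {?a + 1..?a + ?b} {s. (i, s) \<in> std (v + w) - A}"
      using e'(1)[of i] by (rule bij_betw_trans)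
    then have 2: "bij_betw (\<sigma> i) {?a + 1..?a + ?b} {s. (i, s) \<in> std (v + w) - A}"
      by (rule bij_betw_cong[THEN iffD1, rotated]) (auto simp: \<sigma>_def)
    have "bij_betw (\<sigma> i) ({1..?a} \<union> {?a + 1..?a + ?b}) ({s. (i, s) \<in> A} \<union> {s. (i, s) \<in> std (v + w) - A})"
      using 1 2 by (rule bij_betw_combine) auto
    also have "{1..?a} \<union> {?a + 1..?a + ?b} = {1..?a + ?b}" by auto
    also have "{s. (i, s) \<in> A} \<union> {s. (i, s) \<in> std (v + w) - A} = {1..?a + ?b}"
      using A(1) by (auto simp: std_def lookup_add)
    finally show "\<sigma> i permutes {1..?a + ?b}"
      by (rule bij_imp_permutes) (auto simp: \<sigma>_def)
    show "strict_mono_on {1..?a} (\<sigma> i)"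
      using e(2)[of i] by (auto simp: strict_mono_on_def \<sigma>_def)
    show "strict_mono_on {?a + 1..?a + ?b} (\<sigma> i)"
    proof (rule strict_mono_onI)
      fix r s assume "r \<in> {?a + 1..?a + ?b}" "s \<in> {?a + 1..?a + ?b}" "r < s"
      then show "\<sigma> i r < \<sigma> i s"
        using strict_mono_onD[OF e'(2)[of i], of "r - ?a" "s - ?a"] by (auto simp: \<sigma>_def)
    qed
  qed
  moreover have "A = shuffle_set v \<sigma>"
  proof -
    have "enumerates \<sigma> v A"
      unfolding enumerates_def
      by (intro allI bij_betw_cong[THEN iffD1, OF _ e(1)]) (auto simp: \<sigma>_def)
    then show ?thesis unfolding shuffle_set_def by (rule enumerates_imp_image)
  qed
  ultimately show "\<exists>\<sigma>\<in>shuffles v w. A = shuffle_set v \<sigma>" by blast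
qed

end

locale quiver_shuffle =
  fixes q :: "rat \<Rightarrow> 'r::comm_ring_1" and Q :: "('i, 'h) pre_digraph" and pos :: "'h \<Rightarrow> nat"
  assumes q: "q \<in> ring_hom type_ring type_ring"
    and fin_digraph: "fin_digraph Q" and loopfree: "loopfree_digraph Q"
    and numbering: "arrow_numbering Q pos"
begin

sublocale fin_digraph Q by (rule fin_digraph)

lemma is_hom_q: "is_hom q"
  using q by (simp add: ring_hom_def type_ring_def is_hom_def)

lemma is_hom_scal: "is_hom (scal q :: rat poly \<Rightarrow> ('i, 'r) mpol)"
proof -
  note [simp] = is_homD[OF is_hom_q] coeff_map_poly
  have "map_poly q (c + d) = map_poly q c + map_poly q d" for c d
    by (rule poly_eqI) simp
  moreover have "map_poly q (c * d) = map_poly q c * map_poly q d" for c d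
    by (rule poly_eqI) (simp add: coeff_mult is_hom_sum[OF is_hom_q])
  moreover have "map_poly q 1 = 1"
    by (rule poly_eqI) simp
  ultimately show ?thesis
    by (simp add: is_hom_def scal_def single_add mult_single)
qed

definition eta :: "('i, 'r) mpol" where
  "eta = scal q [:0, 1 / 2:]"

lemma scal_hbar: "scal q hbar = (2 * eta :: ('i, 'r) mpol)"
proof -
  have "hbar = [:0, 1 / 2:] + [:0, 1 / 2:]" by (simp add: hbar_def)
  then have "scal q hbar = (scal q ([:0, 1 / 2:] + [:0, 1 / 2:]) :: ('i, 'r) mpol)" by (rule arg_cong)
  also have "\<dots> = 2 * eta" by (simp only: is_homD(2)[OF is_hom_scal] eta_def mult_2)
  finally show ?thesis .
qed

lemma scal_smult_hbar: "scal q (Polynomial.smult (of_int n / 2) hbar) = (of_int n * eta :: ('i, 'r) mpol)"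
proof -
  have "Polynomial.smult (of_int n / 2) hbar = of_int n * [:0, 1 / 2:]"
    by (simp add: hbar_def of_int_poly)
  then have "scal q (Polynomial.smult (of_int n / 2) hbar) = (scal q (of_int n * [:0, 1 / 2:]) :: ('i, 'r) mpol)"
    by (rule arg_cong)
  also have "\<dots> = of_int n * eta"
    by (simp only: is_homD(3)[OF is_hom_scal] is_hom_of_int[OF is_hom_scal] eta_def)
  finally show ?thesis .
qed

lemma subst_eta [simp]: "subst y eta = eta"
  by (simp add: eta_def)

text \<open>That \<open>R\<close> is a \<open>\<rat>\<close>-algebra enters here, and through the element \<open>\<hbar> / 2\<close>.\<close>

lemma two_regular:
  assumes "2 * x = (0 :: ('i, 'r) mpol)"
  shows "x = 0"
proof -
  have "scal q [:1 / 2:] * 2 = (scal q ([:1 / 2:] + [:1 / 2:]) :: ('i, 'r) mpol)"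
    by (simp only: is_homD[OF is_hom_scal] mult_2_right)
  also have "[:1 / 2:] + [:1 / 2:] = (1 :: rat poly)" by simp
  finally have "scal q [:1 / 2:] * 2 = (1 :: ('i, 'r) mpol)" by (simp only: is_homD[OF is_hom_scal])
  then have "x = scal q [:1 / 2:] * (2 * x)" by (simp flip: mult.assoc)
  with assms show ?thesis by simp
qed

text \<open>The interaction of a variable of colour \<open>k\<close> in the first factor with one of colour \<open>l\<close> in the
  second: the contribution to \<open>fac2\<close>.\<close>

definition arrow_fac :: "'i \<Rightarrow> 'i \<Rightarrow> ('i, 'r) mpol \<Rightarrow> ('i, 'r) mpol \<Rightarrow> ('i, 'r) mpol" where
  "arrow_fac k l x y = (\<Prod>h\<in>arcs Q.
     (if tail Q h = k \<and> head Q h = l then y - x + of_int (weight Q pos h) * eta else 1) *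
     (if head Q h = k \<and> tail Q h = l then y - x + of_int (weight_star Q pos h) * eta else 1))"

definition parity_sign :: "'i \<Rightarrow> 'i \<Rightarrow> ('i, 'r) mpol tfrac" where
  "parity_sign k l = (if even (Cbar Q l k) then 1 else - 1)"

definition pole_fac :: "'i \<times> nat \<Rightarrow> 'i \<times> nat \<Rightarrow> ('i, 'r) mpol tfrac" where
  "pole_fac a b = (if fst a = fst b then TFrac (var a - var b + 2 * eta) (var b - var a) else 1)"

definition sh_kernel :: "'i \<times> nat \<Rightarrow> 'i \<times> nat \<Rightarrow> ('i, 'r) mpol tfrac" where
  "sh_kernel a b = parity_sign (fst a) (fst b) * pole_fac a b *
     to_tfrac (arrow_fac (fst a) (fst b) (var a) (var b))"

text \<open>The minus sign turns the unit \<open>-1\<close> into the unit of the convolution, and absorbs the constant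
  sign of the shuffle product.\<close>

definition comp_fun :: "'i dimvec \<Rightarrow> ('i, 'r) mpol \<Rightarrow> ('i \<times> nat) set \<Rightarrow> ('i, 'r) mpol tfrac" where
  "comp_fun v f U = (if finite U \<and> dimv U = v then - to_tfrac (eval_at f U) else 0)"

lemma comp_fun_add: "comp_fun v (f + g) U = comp_fun v f U + comp_fun v g U"
  by (simp add: comp_fun_def eval_at_add to_tfrac_add)

lemma comp_fun_0: "comp_fun v 0 U = 0"
  by (simp add: comp_fun_def eval_at_0)

lemma comp_fun_scal: "comp_fun v (scal q c * f) U = to_tfrac (scal q c) * comp_fun v f U"
  by (simp add: comp_fun_def scal_def eval_at_const_mult to_tfrac_mult)

lemma subst_arrow_fac: "subst h (arrow_fac k l x y) = arrow_fac k l (subst h x) (subst h y)"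
proof -
  have int: "subst h (of_int n) = of_int n" for n
    by (rule is_hom_of_int[OF is_hom_subst])
  show ?thesis
    unfolding arrow_fac_def subst_prod
    by (intro prod.cong refl)
      (simp only: subst_mult subst_add subst_diff int subst_eta subst_1 if_distrib[of "subst h"])
qed

lemma relabel_var: "var (relabel e x) = lam (fst x) (e (fst x) (snd x))"
  by (simp add: var_def relabel_def)

lemma tfrac_lift_sign: "tfrac_lift (subst h) (parity_sign k l) (parity_sign k l)"
proof -
  define c :: "('i, 'r) mpol" where "c = (if even (Cbar Q l k) then 1 else - 1)"
  have "parity_sign k l = to_tfrac c" "subst h c = c"
    by (simp_all add: c_def parity_sign_def to_tfrac_uminus subst_uminus)
  then show ?thesis
    using tfrac_lift_to_tfrac[OF is_hom_subst, of h c] by (simp only:)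
qed

context
  fixes U :: "('i \<times> nat) set" and e :: "'i \<Rightarrow> nat \<Rightarrow> nat" and h :: "'i \<Rightarrow> nat \<Rightarrow> ('i, 'r) mpol"
  assumes U: "finite U" and inj: "inj_on (relabel e) U"
    and h: "\<And>i s. (i, s) \<in> U \<Longrightarrow> h i s = lam i (e i s)"
begin

lemma subst_var_relabel: "x \<in> U \<Longrightarrow> subst h (var x) = var (relabel e x)"
  using h[of "fst x" "snd x"] by (simp add: subst_var relabel_var)

lemma tfrac_lift_kernel:
  assumes "a \<in> U" "b \<in> U" "a \<noteq> b"
  shows "tfrac_lift (subst h) (sh_kernel a b) (sh_kernel (relabel e a) (relabel e b))"
proof -
  have ne: "relabel e b \<noteq> relabel e a"
    using inj assms by (auto dest: inj_onD)
  have fst: "fst (relabel e x) = fst x" for x by (simp add: relabel_def)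
  have "subst h 2 = 2"
    using is_hom_of_int[OF is_hom_subst, of h 2] by simp
  then have s: "subst h (var a - var b + 2 * eta) = var (relabel e a) - var (relabel e b) + 2 * eta"
      "subst h (var b - var a) = var (relabel e b) - var (relabel e a)"
    using assms by (simp_all only: subst_diff subst_add subst_mult subst_var_relabel subst_eta)
  have "tfrac_lift (subst h) (TFrac (var a - var b + 2 * eta) (var b - var a))
     (TFrac (var (relabel e a) - var (relabel e b) + 2 * eta) (var (relabel e b) - var (relabel e a)))"
    unfolding s[symmetric] using assms ne
    by (intro tfrac_lift_TFrac is_hom_subst) (simp_all add: s regular_var_diff)
  then have "tfrac_lift (subst h) (pole_fac a b) (pole_fac (relabel e a) (relabel e b))"
    by (simp add: pole_fac_def fst tfrac_lift_1[OF is_hom_subst])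
  moreover have "tfrac_lift (subst h) (to_tfrac (arrow_fac (fst a) (fst b) (var a) (var b)))
     (to_tfrac (arrow_fac (fst (relabel e a)) (fst (relabel e b)) (var (relabel e a)) (var (relabel e b))))"
    using tfrac_lift_to_tfrac[OF is_hom_subst, of h "arrow_fac (fst a) (fst b) (var a) (var b)"] assms
    by (simp only: subst_arrow_fac subst_var_relabel fst)
  ultimately show ?thesis
    unfolding sh_kernel_def fst by (intro tfrac_lift_mult is_hom_subst tfrac_lift_sign)
qed

lemma tfrac_lift_comp_fun:
  assumes f: "f \<in> SH v" and A: "A \<subseteq> U"
  shows "tfrac_lift (subst h) (comp_fun v f A) (comp_fun v f (relabel e ` A))"
proof -
  have finA: "finite A" and injA: "inj_on (relabel e) A"
    using A U inj by (auto intro: finite_subset inj_on_subset)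
  show ?thesis
  proof (cases "dimv A = v")
    case True
    have "subst h (eval_at f A) = eval_at f (relabel e ` A)"
      using f True finA injA A h by (intro subst_eval_at) auto
    then show ?thesis
      using True finA tfrac_lift_to_tfrac[OF is_hom_subst, of h "- eval_at f A"]
      by (simp add: comp_fun_def dimv_relabel injA subst_uminus to_tfrac_uminus)
  next
    case False
    then show ?thesis
      by (simp add: comp_fun_def dimv_relabel injA tfrac_lift_0[OF is_hom_subst])
  qed
qed

text \<open>With a permutation of \<open>U\<close> this says that the convolution is symmetric, and with an injection into
  another set that it is compatible with evaluation.  As \<open>h\<close> is arbitrary outside \<open>U\<close>, it also shows that
  no other variables occur.\<close>

lemma tfrac_lift_conv:
  assumes f: "f \<in> SH v" and g: "g \<in> SH w"
  shows "tfrac_lift (subst h) (conv sh_kernel (comp_fun v f) (comp_fun w g) U)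
     (conv sh_kernel (comp_fun v f) (comp_fun w g) (relabel e ` U))"
proof -
  let ?T = "\<lambda>V A. comp_fun v f A * comp_fun w g (V - A) * cross_prod sh_kernel A (V - A)"
  have eq: "conv sh_kernel (comp_fun v f) (comp_fun w g) (relabel e ` U) = (\<Sum>A\<in>Pow U. ?T (relabel e ` U) (relabel e ` A))"
    unfolding conv_def by (rule sum.reindex_bij_betw[OF bij_betw_Pow_image[OF inj], symmetric])
  have "tfrac_lift (subst h) (?T U A) (?T (relabel e ` U) (relabel e ` A))" if "A \<in> Pow U" for A
  proof -
    have A: "A \<subseteq> U" using that by simp
    have diff: "relabel e ` U - relabel e ` A = relabel e ` (U - A)"
      using inj A by (simp add: inj_on_image_set_diff)
    have injA: "inj_on (relabel e) A" "inj_on (relabel e) (U - A)"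
      using inj A by (auto intro: inj_on_subset)
    have "tfrac_lift (subst h) (cross_prod sh_kernel A (U - A)) (cross_prod sh_kernel (relabel e ` A) (relabel e ` (U - A)))"
      unfolding cross_prod_def prod.reindex[OF injA(1)] prod.reindex[OF injA(2)] comp_def
      using A by (intro tfrac_lift_prod is_hom_subst tfrac_lift_kernel) auto
    then show ?thesis
      unfolding diff using A by (intro tfrac_lift_mult is_hom_subst tfrac_lift_comp_fun f g) auto
  qed
  then show ?thesis
    unfolding eq unfolding conv_def by (rule tfrac_lift_sum[OF is_hom_subst])
qed

end

text \<open>Every pole of the product over \<open>A \<times> B\<close> belongs to an unordered pair of variables of the same colour,
  and since \<open>A\<close> and \<open>B\<close> are disjoint, each of these pairs occurs at most once.\<close>

lemma cross_prod_kernel_denominators: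
  assumes "finite A" "finite B" "A \<inter> B = {}"
    and E: "E = {(i, s, t). s < t \<and> (i, s) \<in> A \<union> B \<and> (i, t) \<in> A \<union> B}"
  shows "to_tfrac (prod var_diff E) * cross_prod sh_kernel A B \<in> range to_tfrac"
proof -
  define den :: "('i \<times> nat) \<times> ('i \<times> nat) \<Rightarrow> ('i, 'r) mpol" where
    "den = (\<lambda>(a, b). if fst a = fst b then var b - var a else 1)"
  define D where "D = {p. \<exists>i s t. p = ((i, s), (i, t)) \<and> (i, s) \<in> A \<and> (i, t) \<in> B}"
  define srt where "srt = (\<lambda>(a :: 'i \<times> nat, b :: 'i \<times> nat). (fst a, min (snd a) (snd b), max (snd a) (snd b)))"
  have "finite E"
  proof (rule finite_subset)
    show "E \<subseteq> (\<lambda>(a, b). (fst a, snd a, snd b)) ` ((A \<union> B) \<times> (A \<union> B))"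
      by (force simp: E image_iff)
  qed (use assms in auto)
  have srt_D: "srt p \<in> E" if pD: "p \<in> D" for p
  proof -
    obtain i s t where p: "p = ((i, s), (i, t))" "(i, s) \<in> A" "(i, t) \<in> B"
      using pD unfolding D_def by blast
    then have "s \<noteq> t" using assms(3) by auto
    with p show ?thesis by (auto simp: E srt_def min_def max_def)
  qed
  have inj: "inj_on srt D"
  proof (rule inj_onI)
    fix x y assume "x \<in> D" "y \<in> D" and eq: "srt x = srt y"
    then obtain i s t j u v where x: "x = ((i, s), (i, t))" "(i, s) \<in> A" "(i, t) \<in> B"
        and y: "y = ((j, u), (j, v))" "(j, u) \<in> A" "(j, v) \<in> B"
      unfolding D_def by blast
    have "i = j" "min s t = min u v" "max s t = max u v"
      using eq by (auto simp: x y srt_def)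
    then have "(s = u \<and> t = v) \<or> (s = v \<and> t = u)" by (auto simp: min_def max_def split: if_splits)
    with x y assms(3) \<open>i = j\<close> show "x = y" by auto
  qed
  have "den p dvd var_diff (srt p)" if pD: "p \<in> D" for p
  proof -
    obtain i s t where p: "p = ((i, s), (i, t))" using pD unfolding D_def by blast
    show ?thesis
    proof (cases "s \<le> t")
      case True
      then have "var_diff (srt p) = - den p"
        by (simp add: p srt_def den_def var_diff_def var_def)
      then show ?thesis by simp
    next
      case False
      then have "var_diff (srt p) = den p"
        by (simp add: p srt_def den_def var_diff_def var_def)
      then show ?thesis by simp
    qed
  qed
  then have "prod den D dvd (\<Prod>p\<in>D. var_diff (srt p))"
    by (rule prod_dvd_prod)
  also have "\<dots> = prod var_diff (srt ` D)"
    using inj by (simp add: prod.reindex)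
  also have "\<dots> dvd prod var_diff E"
    using srt_D \<open>finite E\<close> by (intro prod_dvd_prod_subset) auto
  also have "prod den D = prod den (A \<times> B)"
  proof (rule prod.mono_neutral_left)
    show "D \<subseteq> A \<times> B" by (auto simp: D_def)
    show "\<forall>p\<in>A \<times> B - D. den p = 1" by (force simp: D_def den_def)
  qed (use assms in auto)
  finally obtain c where c: "prod var_diff E = prod den (A \<times> B) * c" by (rule dvdE)
  have "to_tfrac (den p) * sh_kernel (fst p) (snd p) \<in> range to_tfrac" if p: "p \<in> A \<times> B" for p
  proof -
    obtain a b where ab: "p = (a, b)" "a \<noteq> b" using p assms(3) by (cases p) auto
    have "regular (var b - var a :: ('i, 'r) mpol)" using ab by (intro regular_var_diff) auto
    then have "to_tfrac (den p) * pole_fac a b \<in> range to_tfrac"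
      by (auto simp: ab den_def pole_fac_def to_tfrac_mult_TFrac intro: range_eqI[of _ _ 1])
    moreover have "parity_sign (fst a) (fst b) * to_tfrac (arrow_fac (fst a) (fst b) (var a) (var b)) \<in> range to_tfrac"
      by (simp add: parity_sign_def flip: to_tfrac_uminus)
    ultimately have "to_tfrac (den p) * pole_fac a b * (parity_sign (fst a) (fst b) *
        to_tfrac (arrow_fac (fst a) (fst b) (var a) (var b))) \<in> range to_tfrac"
      by (rule to_tfrac_range_mult)
    then show ?thesis by (simp add: ab sh_kernel_def mult_ac)
  qed
  then have "(\<Prod>p\<in>A \<times> B. to_tfrac (den p) * sh_kernel (fst p) (snd p)) \<in> range to_tfrac"
    by (rule to_tfrac_range_prod)
  then have "to_tfrac (prod den (A \<times> B)) * cross_prod sh_kernel A B \<in> range to_tfrac"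
    by (simp add: prod.distrib to_tfrac_prod cross_prod_def prod.cartesian_product case_prod_unfold)
  then have "to_tfrac c * (to_tfrac (prod den (A \<times> B)) * cross_prod sh_kernel A B) \<in> range to_tfrac"
    by (rule to_tfrac_range_mult[OF rangeI])
  then show ?thesis by (simp add: c to_tfrac_mult mult_ac)
qed

text \<open>The convolution at \<open>U\<close> is symmetric with at most simple poles, so \<open>remove_denominators\<close> applies.\<close>

lemma conv_polynomial:
  assumes f: "f \<in> SH v" and g: "g \<in> SH w" and U: "finite U"
  shows "\<exists>M. conv sh_kernel (comp_fun v f) (comp_fun w g) U = to_tfrac M \<and> in_vars U M"
proof -
  let ?P = "conv sh_kernel (comp_fun v f) (comp_fun w g) U"
  define E where "E = {(i, s, t). s < t \<and> (i, s) \<in> U \<and> (i, t) \<in> U}"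
  have "finite E"
  proof (rule finite_subset)
    show "E \<subseteq> (\<lambda>(a, b). (fst a, snd a, snd b)) ` (U \<times> U)"
      by (force simp: E_def image_iff)
  qed (use U in auto)
  have lift: "tfrac_lift (subst (\<lambda>j u. lam j (swap_vars i s t j u))) ?P ?P" if "(i, s, t) \<in> E" for i s t
  proof -
    have invol: "relabel (swap_vars i s t) (relabel (swap_vars i s t) x) = x" for x
      by (simp add: relabel_def swap_vars_def prod_eq_iff)
    then have inj: "inj_on (relabel (swap_vars i s t)) U" by (rule inj_on_inverseI)
    have sub: "relabel (swap_vars i s t) ` U \<subseteq> U"
      using that by (auto simp: relabel_def swap_vars_def E_def Transposition.transpose_def)
    then have "relabel (swap_vars i s t) ` U = U"
      using invol by (metis image_subset_iff subsetI subset_antisym image_eqI)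
    then show ?thesis
      using tfrac_lift_conv[OF U inj _ f g] by simp
  qed
  have "to_tfrac (prod var_diff E) * ?P \<in> range to_tfrac"
    unfolding conv_def sum_distrib_left
  proof (rule to_tfrac_range_sum)
    fix A assume A: "A \<in> Pow U"
    have "to_tfrac (prod var_diff E) * cross_prod sh_kernel A (U - A) \<in> range to_tfrac"
      using A U by (intro cross_prod_kernel_denominators) (auto simp: E_def intro: finite_subset)
    moreover have range: "comp_fun v f A \<in> range to_tfrac" for v f A
      by (auto simp: comp_fun_def intro: range_eqI[of _ _ 0] simp flip: to_tfrac_uminus)
    ultimately have "comp_fun v f A * comp_fun w g (U - A) *
        (to_tfrac (prod var_diff E) * cross_prod sh_kernel A (U - A)) \<in> range to_tfrac"
      by (intro to_tfrac_range_mult[OF to_tfrac_range_mult] range)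
    then show "to_tfrac (prod var_diff E) *
        (comp_fun v f A * comp_fun w g (U - A) * cross_prod sh_kernel A (U - A)) \<in> range to_tfrac"
      by (simp add: mult_ac)
  qed
  then obtain N where N: "to_tfrac (prod var_diff E) * ?P = to_tfrac N" by auto
  have "\<exists>M. ?P = to_tfrac M"
    by (rule remove_denominators[of E ?P N, OF two_regular \<open>finite E\<close> _ lift N]) (auto simp: E_def)
  then obtain M where M: "?P = to_tfrac M" by blast
  \<comment> \<open>Setting all variables outside \<open>U\<close> to 0 does not change the convolution at \<open>U\<close>.\<close>
  define y :: "'i \<Rightarrow> nat \<Rightarrow> ('i, 'r) mpol" where "y i s = (if (i, s) \<in> U then lam i s else 0)" for i s
  have "relabel (\<lambda>_ s. s) = (id :: 'i \<times> nat \<Rightarrow> _)" by (simp add: relabel_def fun_eq_iff)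
  then have "tfrac_lift (subst y) ?P ?P"
    using tfrac_lift_conv[of U "\<lambda>_ s. s" y, OF U _ _ f g] by (simp add: y_def)
  then have "tfrac_lift (subst y) (to_tfrac M) (to_tfrac M)" by (simp add: M)
  then have "subst y M = M"
    using tfrac_lift_unique[OF is_hom_subst tfrac_lift_to_tfrac[OF is_hom_subst]] by fastforce
  moreover have "in_vars U (subst y M)"
    by (rule in_vars_subst) (simp add: y_def in_vars_lam in_vars_0)
  ultimately have "in_vars U M" by (simp only:)
  with M show ?thesis by blast
qed

end

lemma prod_std_select:
  "(\<Prod>x\<in>std v. if fst x = k then g (snd x) else 1) = (\<Prod>s=1..lookup v k. g s)"
proof -
  have "(\<Prod>x\<in>std v. if fst x = k then g (snd x) else 1) = (\<Prod>x\<in>Pair k ` {1..lookup v k}. g (snd x))"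
    by (rule prod.mono_neutral_cong_right) (auto simp: finite_std, auto simp: std_def)
  also have "\<dots> = (\<Prod>s=1..lookup v k. g s)"
    by (subst prod.reindex) (auto simp: inj_on_def)
  finally show ?thesis .
qed

lemma prod_std_select2:
  "(\<Prod>a\<in>std v. \<Prod>b\<in>std w. if fst a = k \<and> fst b = l then g (snd a) (snd b) else 1) =
   (\<Prod>s=1..lookup v k. \<Prod>t=1..lookup w l. g s t)"
proof -
  have "(\<Prod>a\<in>std v. \<Prod>b\<in>std w. if fst a = k \<and> fst b = l then g (snd a) (snd b) else 1) =
     (\<Prod>a\<in>std v. if fst a = k then \<Prod>b\<in>std w. if fst b = l then g (snd a) (snd b) else 1 else 1)"
    by (intro prod.cong refl) simp
  also have "\<dots> = (\<Prod>a\<in>std v. if fst a = k then \<Prod>t=1..lookup w l. g (snd a) t else 1)"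
    by (simp only: prod_std_select[of l "g (snd _)"])
  also have "\<dots> = (\<Prod>s=1..lookup v k. \<Prod>t=1..lookup w l. g s t)"
    by (rule prod_std_select[of k "\<lambda>s. \<Prod>t=1..lookup w l. g s t"])
  finally show ?thesis .
qed

lemma sum_std:
  assumes "finite I" "keys v \<subseteq> I"
  shows "(\<Sum>x\<in>std v. f (fst x)) = (\<Sum>i\<in>I. of_nat (lookup v i) * (f i :: 'a::comm_ring_1))"
proof -
  have "(\<Sum>x\<in>std v. f (fst x)) = (\<Sum>i\<in>I. \<Sum>s\<in>{1..lookup v i}. f i)"
    using assms(1) by (subst sum.Sigma) (simp_all add: std_Sigma[OF assms(2)] case_prod_unfold)
  then show ?thesis by simp
qed

context quiver_shuffle
begin

context
  fixes v w :: "'i dimvec"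
  assumes v: "keys v \<subseteq> verts Q" and w: "keys w \<subseteq> verts Q"
begin

lemma sh_sign_eq: "(sh_sign Q v w :: ('i, 'r) mpol tfrac) = - (\<Prod>a\<in>std v. \<Prod>b\<in>std w. parity_sign (fst a) (fst b))"
proof -
  have "(\<Sum>a\<in>std v. \<Sum>b\<in>std w. Cbar Q (fst b) (fst a)) =
     (\<Sum>l\<in>verts Q. int (lookup v l) * (\<Sum>k\<in>verts Q. int (lookup w k) * Cbar Q k l))"
  proof -
    have "(\<Sum>b\<in>std w. Cbar Q (fst b) l) = (\<Sum>k\<in>verts Q. int (lookup w k) * Cbar Q k l)" for l
      using sum_std[OF finite_verts w, of "\<lambda>k. Cbar Q k l"] by simp
    then show ?thesis
      using sum_std[OF finite_verts v, of "\<lambda>l. \<Sum>k\<in>verts Q. int (lookup w k) * Cbar Q k l"] by simp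
  qed
  also have "\<dots> = (\<Sum>k\<in>verts Q. \<Sum>l\<in>verts Q. int (lookup w k) * Cbar Q k l * int (lookup v l))"
    unfolding sum_distrib_left by (subst sum.swap) (simp add: mult_ac)
  finally show ?thesis
    by (simp add: sh_sign_def parity_sign_def prod_parity)
qed

lemma fac1_eq:
  "fac1 q Q v w (\<lambda>i s. lam i (\<alpha> i s)) (\<lambda>i t. lam i (\<beta> i t)) =
     (\<Prod>a\<in>std v. \<Prod>b\<in>std w. pole_fac (relabel \<alpha> a) (relabel \<beta> b))"
proof -
  let ?T = "\<lambda>i s t. TFrac (lam i (\<alpha> i s) - lam i (\<beta> i t) + 2 * eta) (lam i (\<beta> i t) - lam i (\<alpha> i s))"
  have "(\<Prod>a\<in>std v. \<Prod>b\<in>std w. pole_fac (relabel \<alpha> a) (relabel \<beta> b)) =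
     (\<Prod>a\<in>std v. \<Prod>t=1..lookup w (fst a). ?T (fst a) (snd a) t)"
  proof (rule prod.cong[OF refl])
    fix a
    have "pole_fac (relabel \<alpha> a) (relabel \<beta> b) = (if fst b = fst a then ?T (fst a) (snd a) (snd b) else 1)" for b
      by (auto simp: pole_fac_def relabel_var) (auto simp: relabel_def)
    then show "(\<Prod>b\<in>std w. pole_fac (relabel \<alpha> a) (relabel \<beta> b)) =
        (\<Prod>t=1..lookup w (fst a). ?T (fst a) (snd a) t)"
      using prod_std_select[of "fst a" "?T (fst a) (snd a)" w] by simp
  qed
  also have "\<dots> = (\<Prod>i\<in>verts Q. \<Prod>s=1..lookup v i. \<Prod>t=1..lookup w i. ?T i s t)"
    using prod_std[OF finite_verts v, of "\<lambda>i s. \<Prod>t=1..lookup w i. ?T i s t"] by simp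
  finally show ?thesis unfolding fac1_def scal_hbar by (rule sym)
qed

lemma fac2_eq:
  "fac2 q Q pos v w (\<lambda>i s. lam i (\<alpha> i s)) (\<lambda>i t. lam i (\<beta> i t)) =
     (\<Prod>a\<in>std v. \<Prod>b\<in>std w. arrow_fac (fst a) (fst b) (var (relabel \<alpha> a)) (var (relabel \<beta> b)))"
proof -
  let ?F = "\<lambda>k l m a b. if fst a = k \<and> fst b = l
     then lam l (\<beta> l (snd b)) - lam k (\<alpha> k (snd a)) + of_int m * eta else (1 :: ('i, 'r) mpol)"
  have "arrow_fac (fst a) (fst b) (var (relabel \<alpha> a)) (var (relabel \<beta> b)) = (\<Prod>h\<in>arcs Q.
     ?F (tail Q h) (head Q h) (weight Q pos h) a b * ?F (head Q h) (tail Q h) (weight_star Q pos h) a b)" for a b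
    unfolding arrow_fac_def relabel_var
    by (intro prod.cong[OF refl] arg_cong2[where f = "(*)"] if_cong refl) (auto simp only:)
  then have "(\<Prod>a\<in>std v. \<Prod>b\<in>std w. arrow_fac (fst a) (fst b) (var (relabel \<alpha> a)) (var (relabel \<beta> b))) =
     (\<Prod>a\<in>std v. \<Prod>b\<in>std w. \<Prod>h\<in>arcs Q. ?F (tail Q h) (head Q h) (weight Q pos h) a b *
        ?F (head Q h) (tail Q h) (weight_star Q pos h) a b)" by simp
  also have "\<dots> = (\<Prod>a\<in>std v. \<Prod>h\<in>arcs Q. \<Prod>b\<in>std w. ?F (tail Q h) (head Q h) (weight Q pos h) a b *
        ?F (head Q h) (tail Q h) (weight_star Q pos h) a b)"
    by (intro prod.cong refl prod.swap)
  also have "\<dots> = (\<Prod>h\<in>arcs Q. \<Prod>a\<in>std v. \<Prod>b\<in>std w. ?F (tail Q h) (head Q h) (weight Q pos h) a b *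
        ?F (head Q h) (tail Q h) (weight_star Q pos h) a b)"
    by (rule prod.swap)
  also have "\<dots> = fac2 q Q pos v w (\<lambda>i s. lam i (\<alpha> i s)) (\<lambda>i t. lam i (\<beta> i t))"
    unfolding prod.distrib fac2_def scal_smult_hbar
    by (intro arg_cong2[where f = "(*)"] prod.cong refl prod_std_select2)
  finally show ?thesis by simp
qed

lemma sh_factors_eq:
  assumes "inj_on (relabel \<alpha>) (std v)" "inj_on (relabel \<beta>) (std w)"
  shows "sh_sign Q v w * (fac1 q Q v w (\<lambda>i s. lam i (\<alpha> i s)) (\<lambda>i t. lam i (\<beta> i t)) *
      to_tfrac (fac2 q Q pos v w (\<lambda>i s. lam i (\<alpha> i s)) (\<lambda>i t. lam i (\<beta> i t)))) =
    - cross_prod sh_kernel (relabel \<alpha> ` std v) (relabel \<beta> ` std w)"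
proof -
  have "cross_prod sh_kernel (relabel \<alpha> ` std v) (relabel \<beta> ` std w) =
      (\<Prod>a\<in>std v. \<Prod>b\<in>std w. sh_kernel (relabel \<alpha> a) (relabel \<beta> b))"
    unfolding cross_prod_def prod.reindex[OF assms(1)] prod.reindex[OF assms(2)] comp_def ..
  also have "\<dots> = (\<Prod>a\<in>std v. \<Prod>b\<in>std w. parity_sign (fst a) (fst b)) *
      fac1 q Q v w (\<lambda>i s. lam i (\<alpha> i s)) (\<lambda>i t. lam i (\<beta> i t)) *
      to_tfrac (fac2 q Q pos v w (\<lambda>i s. lam i (\<alpha> i s)) (\<lambda>i t. lam i (\<beta> i t)))"
    unfolding fac1_eq fac2_eq to_tfrac_prod prod.distrib[symmetric] sh_kernel_def
    by (simp add: relabel_def)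
  finally show ?thesis by (simp add: sh_sign_eq mult_ac)
qed

text \<open>The shuffles correspond to the subsets of dimension vector \<open>v\<close>, and the other subsets contribute 0
  to the convolution.  Each of the two components and the product of the signs of the pairs, which
  differs from \<open>sh_sign\<close> by a factor \<open>-1\<close>, contributes a minus sign.\<close>

lemma to_tfrac_sh_mult:
  assumes f: "f \<in> SH v" and g: "g \<in> SH w"
  shows "to_tfrac (sh_mult q Q pos v w f g) = - conv sh_kernel (comp_fun v f) (comp_fun w g) (std (v + w))"
    (is "_ = - ?C")
proof -
  let ?U = "std (v + w)"
  let ?T = "\<lambda>A. comp_fun v f A * comp_fun w g (?U - A) * cross_prod sh_kernel A (?U - A)"
  let ?x = "\<lambda>\<sigma> i s. lam i (\<sigma> i s)" and ?y = "\<lambda>\<sigma> i t. lam i (\<sigma> i (t + lookup v i))"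
  have summand: "sh_sign Q v w * (to_tfrac (subst (?x \<sigma>) f * subst (?y \<sigma>) g) *
        fac1 q Q v w (?x \<sigma>) (?y \<sigma>) * to_tfrac (fac2 q Q pos v w (?x \<sigma>) (?y \<sigma>))) = - ?T (shuffle_set v \<sigma>)"
    if \<sigma>: "\<sigma> \<in> shuffles v w" for \<sigma>
  proof -
    let ?A = "shuffle_set v \<sigma>"
    note l = enumerates_shuffle_left[OF \<sigma>] and r = enumerates_shuffle_right[OF \<sigma>]
    have "comp_fun v f ?A = - to_tfrac (subst (?x \<sigma>) f)"
      using enumerates_imp_finite[OF l] enumerates_imp_dimv[OF l] eval_at_eq[OF f l]
      by (simp add: comp_fun_def)
    moreover have "comp_fun w g (?U - ?A) = - to_tfrac (subst (?y \<sigma>) g)"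
      using enumerates_imp_finite[OF r] enumerates_imp_dimv[OF r] eval_at_eq[OF g r]
      by (simp add: comp_fun_def)
    moreover have "sh_sign Q v w * (fac1 q Q v w (?x \<sigma>) (?y \<sigma>) * to_tfrac (fac2 q Q pos v w (?x \<sigma>) (?y \<sigma>))) =
        - cross_prod sh_kernel ?A (?U - ?A)"
      using sh_factors_eq[OF enumerates_imp_inj[OF l] enumerates_imp_inj[OF r]]
      by (simp only: enumerates_imp_image[OF l, symmetric] enumerates_imp_image[OF r, symmetric])
    moreover have "c * (to_tfrac (a * b) * d * e) = to_tfrac a * to_tfrac b * (c * (d * e))"
      for a b :: "('i, 'r) mpol" and c d e
      by (simp add: to_tfrac_mult mult_ac)
    ultimately show ?thesis by simp
  qed
  obtain M where M: "?C = to_tfrac M"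
    using conv_polynomial[OF f g finite_std, of "v + w"] by auto
  have "sh_sign Q v w * (\<Sum>\<sigma>\<in>shuffles v w. to_tfrac (subst (?x \<sigma>) f * subst (?y \<sigma>) g) *
        fac1 q Q v w (?x \<sigma>) (?y \<sigma>) * to_tfrac (fac2 q Q pos v w (?x \<sigma>) (?y \<sigma>))) =
     - (\<Sum>\<sigma>\<in>shuffles v w. ?T (shuffle_set v \<sigma>))"
    unfolding sum_distrib_left sum_negf[symmetric] by (intro sum.cong refl summand)
  also have "(\<Sum>\<sigma>\<in>shuffles v w. ?T (shuffle_set v \<sigma>)) = (\<Sum>A | A \<in> Pow ?U \<and> dimv A = v. ?T A)"
    by (rule sum.reindex_bij_betw[OF bij_betw_shuffle_set])
  also have "\<dots> = ?C"
    unfolding conv_def using finite_std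
    by (intro sum.mono_neutral_left) (auto simp: comp_fun_def)
  finally have sum: "sh_sign Q v w * (\<Sum>\<sigma>\<in>shuffles v w. to_tfrac (subst (?x \<sigma>) f * subst (?y \<sigma>) g) *
        fac1 q Q v w (?x \<sigma>) (?y \<sigma>) * to_tfrac (fac2 q Q pos v w (?x \<sigma>) (?y \<sigma>))) = to_tfrac (- M)"
    by (simp add: M to_tfrac_uminus)
  have "sh_mult q Q pos v w f g = - M"
    unfolding sh_mult_def Let_def sum by simp
  then show ?thesis by (simp add: M to_tfrac_uminus)
qed

text \<open>The analogue for an arbitrary set of variables, obtained by renaming the standard ones.\<close>

lemma sh_mult_relabel:
  assumes f: "f \<in> SH v" and g: "g \<in> SH w" and e: "inj_on (relabel e) (std (v + w))"
  shows "to_tfrac (subst (\<lambda>i s. lam i (e i s)) (sh_mult q Q pos v w f g)) =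
    - conv sh_kernel (comp_fun v f) (comp_fun w g) (relabel e ` std (v + w))"
proof -
  let ?h = "\<lambda>i s. lam i (e i s)"
  have "tfrac_lift (subst ?h) (- to_tfrac (sh_mult q Q pos v w f g))
     (conv sh_kernel (comp_fun v f) (comp_fun w g) (relabel e ` std (v + w)))"
    using tfrac_lift_conv[OF finite_std e _ f g, of ?h] unfolding to_tfrac_sh_mult[OF f g] minus_minus by blast
  moreover have "tfrac_lift (subst ?h) (- to_tfrac (sh_mult q Q pos v w f g))
     (- to_tfrac (subst ?h (sh_mult q Q pos v w f g)))"
    using tfrac_lift_to_tfrac[OF is_hom_subst, of ?h "- sh_mult q Q pos v w f g"]
    by (simp add: subst_uminus to_tfrac_uminus)
  ultimately have "- to_tfrac (subst ?h (sh_mult q Q pos v w f g)) =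
      conv sh_kernel (comp_fun v f) (comp_fun w g) (relabel e ` std (v + w))"
    by (rule tfrac_lift_unique[OF is_hom_subst, rotated])
  from arg_cong[OF this, of uminus] show ?thesis by (simp only: minus_minus)
qed

lemma sh_mult_SH:
  assumes f: "f \<in> SH v" and g: "g \<in> SH w"
  shows "sh_mult q Q pos v w f g \<in> SH (v + w)"
proof -
  obtain M where M: "conv sh_kernel (comp_fun v f) (comp_fun w g) (std (v + w)) = to_tfrac M" "in_vars (std (v + w)) M"
    using conv_polynomial[OF f g finite_std, of "v + w"] by auto
  have "sh_mult q Q pos v w f g = - M"
    using to_tfrac_sh_mult[OF f g] unfolding M(1) by (simp flip: to_tfrac_uminus)
  moreover have "subst (\<lambda>i s. lam i (\<sigma> i s)) (sh_mult q Q pos v w f g) = sh_mult q Q pos v w f g"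
    if \<sigma>: "\<And>i. \<sigma> i permutes {1..lookup (v + w) i}" for \<sigma>
  proof -
    have "enumerates \<sigma> (v + w) (std (v + w))"
      unfolding enumerates_def
    proof
      fix i
      have "{s. (i, s) \<in> std (v + w)} = {1..lookup (v + w) i}" by (auto simp: std_def)
      then show "bij_betw (\<sigma> i) {1..lookup (v + w) i} {s. (i, s) \<in> std (v + w)}"
        using permutes_imp_bij[OF \<sigma>[of i]] by simp
    qed
    then have "inj_on (relabel \<sigma>) (std (v + w))" "relabel \<sigma> ` std (v + w) = std (v + w)"
      using enumerates_imp_inj enumerates_imp_image by metis+
    then have "to_tfrac (subst (\<lambda>i s. lam i (\<sigma> i s)) (sh_mult q Q pos v w f g)) = to_tfrac (sh_mult q Q pos v w f g)"
      using sh_mult_relabel[OF f g] to_tfrac_sh_mult[OF f g] by simp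
    then show ?thesis by simp
  qed
  moreover have "in_vars (std (v + w)) (- M)"
    using M(2) by (simp add: in_vars_def keys_def)
  ultimately show ?thesis by (simp add: SH_iff)
qed

lemma comp_fun_sh_mult:
  assumes f: "f \<in> SH v" and g: "g \<in> SH w" and U: "finite U"
  shows "comp_fun (v + w) (sh_mult q Q pos v w f g) U = conv sh_kernel (comp_fun v f) (comp_fun w g) U"
proof (cases "dimv U = v + w")
  case True
  obtain e where e: "enumerates e (v + w) U" using ex_enumerates[OF U] True by metis
  have "comp_fun (v + w) (sh_mult q Q pos v w f g) U = - to_tfrac (subst (\<lambda>i s. lam i (e i s)) (sh_mult q Q pos v w f g))"
    using True U eval_at_eq[OF sh_mult_SH[OF f g] e] by (simp add: comp_fun_def)
  also have "\<dots> = conv sh_kernel (comp_fun v f) (comp_fun w g) U"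
    using sh_mult_relabel[OF f g enumerates_imp_inj[OF e]] by (simp flip: enumerates_imp_image[OF e])
  finally show ?thesis .
next
  case False
  have "comp_fun v f A * comp_fun w g (U - A) * cross_prod sh_kernel A (U - A) = 0" if "A \<in> Pow U" for A
    using dimv_Diff[OF U, of A] that False by (auto simp: comp_fun_def)
  then have "conv sh_kernel (comp_fun v f) (comp_fun w g) U = 0"
    unfolding conv_def by (intro sum.neutral) blast
  with False show ?thesis by (simp add: comp_fun_def)
qed

end

section \<open>The shuffle algebra is an associative algebra\<close>

abbreviation SA :: "(rat poly, 'i dimvec \<Rightarrow>\<^sub>0 ('i, 'r) mpol) module" where
  "SA \<equiv> shuffle_algebra q Q pos"

text \<open>The function of finite sets of variables that belongs to an element of the shuffle algebra: at
  \<open>U\<close> only the component of dimension vector \<open>dimv U\<close> contributes.\<close>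

definition realize :: "('i dimvec \<Rightarrow>\<^sub>0 ('i, 'r) mpol) \<Rightarrow> ('i \<times> nat) set \<Rightarrow> ('i, 'r) mpol tfrac" where
  "realize F U = comp_fun (dimv U) (lookup F (dimv U)) U"

lemma realize_0: "realize 0 U = 0"
  by (simp add: realize_def comp_fun_0)

lemma realize_add: "realize (F + G) U = realize F U + realize G U"
  by (simp add: realize_def lookup_add comp_fun_add)

lemma realize_uminus: "realize (- F) U = - realize F U"
  using realize_add[of F "- F" U] by (simp add: realize_0 eq_neg_iff_add_eq_0 add.commute)

lemma realize_sum: "realize (sum F I) U = (\<Sum>i\<in>I. realize (F i) U)"
  by (induction I rule: infinite_finite_induct) (simp_all add: realize_0 realize_add)

lemma realize_single: "realize (Poly_Mapping.single v f) U = comp_fun v f U"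
  by (auto simp: realize_def lookup_single when_def comp_fun_0) (simp add: comp_fun_def)

lemma realize_eq_sum: "realize F U = (\<Sum>v\<in>keys F. comp_fun v (lookup F v) U)"
  by (subst (1) poly_mapping_sum_single[of F, symmetric]) (simp only: realize_sum realize_single)

lemma in_SA: "F \<in> carrier SA \<longleftrightarrow> (\<forall>v. lookup F v \<in> SH v) \<and> (\<forall>v\<in>keys F. keys v \<subseteq> verts Q)"
  by (simp add: shuffle_algebra_def) (metis SH_0 not_in_keys_iff_lookup_eq_zero)

text \<open>The component of dimension vector \<open>v\<close> is recovered from the value at the standard set of variables
  of that dimension vector.\<close>

lemma realize_inj:
  assumes "F \<in> carrier SA" "G \<in> carrier SA" and eq: "\<And>U. finite U \<Longrightarrow> realize F U = realize G U"
  shows "F = G"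
proof (rule poly_mapping_eqI)
  fix v
  have "F \<in> carrier SA \<Longrightarrow> realize F (std v) = - to_tfrac (lookup F v)" for F
    by (simp add: realize_def comp_fun_def finite_std in_SA eval_at_std)
  then show "lookup F v = lookup G v"
    using assms eq[OF finite_std, of v] by simp
qed

lemma SA_simps:
  "zero SA = 0" "add SA = (+)" "one SA = Poly_Mapping.single 0 (- 1)"
  by (simp_all add: shuffle_algebra_def)

lemma SA_0: "0 \<in> carrier SA"
  by (simp add: in_SA SH_0)

lemma SA_add: "F \<in> carrier SA \<Longrightarrow> G \<in> carrier SA \<Longrightarrow> F + G \<in> carrier SA"
  using keys_add[of F G] unfolding in_SA lookup_add by (blast intro: SH_add)

lemma SA_sum: "(\<And>i. i \<in> I \<Longrightarrow> F i \<in> carrier SA) \<Longrightarrow> sum F I \<in> carrier SA"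
  by (induction I rule: infinite_finite_induct) (auto intro: SA_0 SA_add)

lemma SA_single: "f \<in> SH v \<Longrightarrow> keys v \<subseteq> verts Q \<Longrightarrow> Poly_Mapping.single v f \<in> carrier SA"
  by (auto simp: in_SA lookup_single when_def SH_0 split: if_splits)

lemma SA_one: "one SA \<in> carrier SA"
  unfolding SA_simps
  by (rule SA_single) (simp_all add: SH_iff in_vars_def subst_uminus keys_def lookup_one)

lemma SA_mult_eq: "F \<otimes>\<^bsub>SA\<^esub> G = (\<Sum>v\<in>keys F. \<Sum>w\<in>keys G. Poly_Mapping.single (v + w)
    (sh_mult q Q pos v w (lookup F v) (lookup G w)))"
  by (simp add: shuffle_algebra_def)

lemma SA_mult:
  assumes "F \<in> carrier SA" "G \<in> carrier SA"
  shows "F \<otimes>\<^bsub>SA\<^esub> G \<in> carrier SA"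
  unfolding SA_mult_eq
proof (intro SA_sum SA_single)
  fix v w assume "v \<in> keys F" "w \<in> keys G"
  then have *: "keys v \<subseteq> verts Q" "keys w \<subseteq> verts Q"
    using assms unfolding in_SA by blast+
  show "sh_mult q Q pos v w (lookup F v) (lookup G w) \<in> SH (v + w)"
    using assms by (intro sh_mult_SH *) (simp_all add: in_SA)
  show "keys (v + w) \<subseteq> verts Q"
    using keys_add[of v w] * by blast
qed

lemma realize_mult:
  assumes "F \<in> carrier SA" "G \<in> carrier SA" "finite U"
  shows "realize (F \<otimes>\<^bsub>SA\<^esub> G) U = conv sh_kernel (realize F) (realize G) U"
proof -
  have "realize (F \<otimes>\<^bsub>SA\<^esub> G) U = (\<Sum>v\<in>keys F. \<Sum>w\<in>keys G.
     conv sh_kernel (comp_fun v (lookup F v)) (comp_fun w (lookup G w)) U)"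
    unfolding SA_mult_eq realize_sum realize_single
    using assms by (intro sum.cong refl comp_fun_sh_mult) (auto simp: in_SA)
  also have "\<dots> = conv sh_kernel (realize F) (realize G) U"
    unfolding realize_eq_sum[abs_def] conv_sum_left conv_sum_right ..
  finally show ?thesis .
qed

lemma realize_one: "finite U \<Longrightarrow> realize (one SA) U = conv_unit U"
proof -
  assume U: "finite U"
  have *: "dimv U = 0 \<longleftrightarrow> U = {}"
  proof
    assume "dimv U = 0"
    then have "card {s. (i, s) \<in> U} = 0" for i using lookup_dimv[OF U, of i] by simp
    moreover have "finite {s. (i, s) \<in> U}" for i
      by (rule finite_subset[of _ "snd ` U"]) (use U in force)+
    ultimately show "U = {}" by auto
  qed (simp add: dimv_def)
  have "eval_at (- 1) V = (- 1 :: ('i, 'r) mpol)" for V by (simp add: eval_at_def subst_uminus)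
  then show ?thesis
    using U * by (simp add: SA_simps realize_single comp_fun_def conv_unit_def to_tfrac_uminus)
qed

lemma lookup_smult: "lookup (c \<odot>\<^bsub>SA\<^esub> F) v = scal q c * lookup F v"
  by (simp add: shuffle_algebra_def Poly_Mapping.map.rep_eq when_def)

lemma SA_smult: "F \<in> carrier SA \<Longrightarrow> c \<odot>\<^bsub>SA\<^esub> F \<in> carrier SA"
proof -
  assume F: "F \<in> carrier SA"
  then have "lookup (c \<odot>\<^bsub>SA\<^esub> F) v \<in> SH v" for v
    by (simp add: lookup_smult scal_def in_SA SH_const_mult)
  moreover have "keys (c \<odot>\<^bsub>SA\<^esub> F) \<subseteq> keys F"
    by (auto simp: in_keys_iff lookup_smult)
  ultimately show ?thesis using F by (auto simp: in_SA)
qed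

lemma realize_smult: "realize (c \<odot>\<^bsub>SA\<^esub> F) U = to_tfrac (scal q c) * realize F U"
  by (simp add: realize_def lookup_smult comp_fun_scal)

lemma abelian_group_SA: "abelian_group SA"
proof (rule abelian_groupI)
  fix F assume "F \<in> carrier SA"
  have "- F \<in> carrier SA"
    using SA_smult[OF \<open>F \<in> carrier SA\<close>, of "- 1"]
    by (rule back_subst[where P = "\<lambda>x. x \<in> carrier SA"])
      (rule poly_mapping_eqI, simp add: lookup_smult is_homD[OF is_hom_scal])
  then show "\<exists>G\<in>carrier SA. G \<oplus>\<^bsub>SA\<^esub> F = \<zero>\<^bsub>SA\<^esub>"
    by (intro bexI[of _ "- F"]) (simp_all add: SA_simps)
qed (auto simp: SA_simps SA_0 SA_add add_ac)

lemma monoid_SA: "Group.monoid SA"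
proof (rule Group.monoidI)
  fix F G H assume *: "F \<in> carrier SA" "G \<in> carrier SA" "H \<in> carrier SA"
  show "F \<otimes>\<^bsub>SA\<^esub> G \<otimes>\<^bsub>SA\<^esub> H = F \<otimes>\<^bsub>SA\<^esub> (G \<otimes>\<^bsub>SA\<^esub> H)"
  proof (rule realize_inj)
    fix U :: "('i \<times> nat) set" assume U: "finite U"
    then have sub: "finite A" if "A \<subseteq> U" for A using that by (rule rev_finite_subset)
    have "realize (F \<otimes>\<^bsub>SA\<^esub> G \<otimes>\<^bsub>SA\<^esub> H) U = conv sh_kernel (conv sh_kernel (realize F) (realize G)) (realize H) U"
      using * U by (auto simp: realize_mult SA_mult sub intro!: conv_cong)
    also have "\<dots> = conv sh_kernel (realize F) (conv sh_kernel (realize G) (realize H)) U"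
      by (rule conv_assoc[OF U])
    also have "\<dots> = realize (F \<otimes>\<^bsub>SA\<^esub> (G \<otimes>\<^bsub>SA\<^esub> H)) U"
      using * U by (auto simp: realize_mult SA_mult sub intro!: conv_cong)
    finally show "realize (F \<otimes>\<^bsub>SA\<^esub> G \<otimes>\<^bsub>SA\<^esub> H) U = realize (F \<otimes>\<^bsub>SA\<^esub> (G \<otimes>\<^bsub>SA\<^esub> H)) U" .
  qed (simp_all add: * SA_mult)
next
  fix F assume *: "F \<in> carrier SA"
  have unit: "conv sh_kernel (realize \<one>\<^bsub>SA\<^esub>) (realize F) U = conv sh_kernel conv_unit (realize F) U"
    "conv sh_kernel (realize F) (realize \<one>\<^bsub>SA\<^esub>) U = conv sh_kernel (realize F) conv_unit U"
    if "finite U" for U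
    using that by (auto intro!: conv_cong simp: realize_one finite_subset)
  show "\<one>\<^bsub>SA\<^esub> \<otimes>\<^bsub>SA\<^esub> F = F"
    by (rule realize_inj) (simp_all add: * SA_mult SA_one realize_mult unit conv_unit_left)
  show "F \<otimes>\<^bsub>SA\<^esub> \<one>\<^bsub>SA\<^esub> = F"
    by (rule realize_inj) (simp_all add: * SA_mult SA_one realize_mult unit conv_unit_right)
qed (simp_all add: SA_mult SA_one)

lemma ring_SA: "ring SA"
proof (rule ringI[OF abelian_group_SA monoid_SA])
  fix F G H assume *: "F \<in> carrier SA" "G \<in> carrier SA" "H \<in> carrier SA"
  have add: "realize (A + B) = (\<lambda>U. realize A U + realize B U)" for A B
    by (simp add: fun_eq_iff realize_add)
  show "(F \<oplus>\<^bsub>SA\<^esub> G) \<otimes>\<^bsub>SA\<^esub> H = F \<otimes>\<^bsub>SA\<^esub> H \<oplus>\<^bsub>SA\<^esub> G \<otimes>\<^bsub>SA\<^esub> H"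
    by (rule realize_inj) (simp_all add: * SA_simps(2) SA_mult SA_add realize_mult add conv_add_left)
  show "H \<otimes>\<^bsub>SA\<^esub> (F \<oplus>\<^bsub>SA\<^esub> G) = H \<otimes>\<^bsub>SA\<^esub> F \<oplus>\<^bsub>SA\<^esub> H \<otimes>\<^bsub>SA\<^esub> G"
    by (rule realize_inj) (simp_all add: * SA_simps(2) SA_mult SA_add realize_mult add conv_add_right)
qed

lemma cring_type_ring: "cring (type_ring :: rat poly ring)"
proof (rule cringI)
  show "abelian_group (type_ring :: rat poly ring)"
    by (rule abelian_groupI) (auto simp: type_ring_def algebra_simps intro: exI[of _ "- _"])
  show "Group.comm_monoid (type_ring :: rat poly ring)"
    by (rule Group.comm_monoidI) (auto simp: type_ring_def algebra_simps)
qed (auto simp: type_ring_def algebra_simps)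

lemma assoc_algebra_SA: "assoc_algebra type_ring SA"
  unfolding assoc_algebra_def
proof (intro conjI ballI)
  have eqI: "F = G" if "\<And>v. lookup F v = lookup G v" for F G :: "'i dimvec \<Rightarrow>\<^sub>0 ('i, 'r) mpol"
    using that by (rule poly_mapping_eqI)
  show "Module.module type_ring SA"
    by (rule moduleI[OF cring_type_ring abelian_group_SA])
      (auto simp: SA_smult type_ring_def SA_simps lookup_smult lookup_add is_homD[OF is_hom_scal] algebra_simps intro!: eqI)
  show "ring SA" by (rule ring_SA)
  have smult: "realize (c \<odot>\<^bsub>SA\<^esub> F) = (\<lambda>U. to_tfrac (scal q c) * realize F U)" for c F
    by (simp add: fun_eq_iff realize_smult)
  fix c F G assume *: "F \<in> carrier SA" "G \<in> carrier SA"
  show "(c \<odot>\<^bsub>SA\<^esub> F) \<otimes>\<^bsub>SA\<^esub> G = c \<odot>\<^bsub>SA\<^esub> (F \<otimes>\<^bsub>SA\<^esub> G)"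
    by (rule realize_inj) (simp_all add: * SA_mult SA_smult realize_mult smult conv_scale_left)
  show "F \<otimes>\<^bsub>SA\<^esub> (c \<odot>\<^bsub>SA\<^esub> G) = c \<odot>\<^bsub>SA\<^esub> (F \<otimes>\<^bsub>SA\<^esub> G)"
    by (rule realize_inj) (simp_all add: * SA_mult SA_smult realize_mult smult conv_scale_right)
qed

end

context quiver_shuffle
begin

section \<open>The Yangian relations for the convolution\<close>

definition val :: "'i \<times> nat \<Rightarrow> ('i, 'r) mpol tfrac" where
  "val x = to_tfrac (var x)"

definition etaf :: "('i, 'r) mpol tfrac" where
  "etaf = to_tfrac eta"

lemma num_arrows_loop: "num_arrows Q k k = 0"
proof -
  have "{h \<in> arcs Q. tail Q h = k \<and> head Q h = k} = {}"
    using loopfree_digraph.no_loops[OF loopfree] by (metis (mono_tags, lifting) empty_Collect_eq)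
  then show ?thesis by (simp add: num_arrows_def)
qed

text \<open>The sign \<open>(-1)\<close> to the power \<open>Cbar Q k k = 1\<close> turns the factor from \<open>fac1\<close> into
  \<open>1 + \<hbar> / (\<lambda>\<^sub>a - \<lambda>\<^sub>b)\<close>.\<close>

lemma sh_kernel_same_colour:
  assumes "fst a = fst b" "a \<noteq> b"
  shows "sh_kernel a b = 1 + 2 * etaf * TFrac 1 (var a - var b)"
proof -
  have reg: "regular (var a - var b :: ('i, 'r) mpol)" "regular (var b - var a :: ('i, 'r) mpol)"
    using assms(2) by (auto intro: regular_var_diff)
  have "arrow_fac (fst a) (fst b) (var a) (var b) = 1"
    unfolding arrow_fac_def
  proof (rule prod.neutral, rule ballI)
    fix h assume "h \<in> arcs Q"
    then have "tail Q h \<noteq> head Q h" by (rule loopfree_digraph.no_loops[OF loopfree])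
    then have "\<not> (tail Q h = fst a \<and> head Q h = fst b)" "\<not> (head Q h = fst a \<and> tail Q h = fst b)"
      using assms(1) by auto
    then show "(if tail Q h = fst a \<and> head Q h = fst b then var b - var a + of_int (weight Q pos h) * eta else 1) *
        (if head Q h = fst a \<and> tail Q h = fst b then var b - var a + of_int (weight_star Q pos h) * eta else 1) =
        (1 :: ('i, 'r) mpol)"
      by (simp only: if_False mult_1)
  qed
  moreover have "parity_sign (fst a) (fst b) = - 1"
    using assms(1) by (simp add: parity_sign_def Cbar_def num_arrows_loop)
  ultimately have k: "sh_kernel a b = - TFrac (var a - var b + 2 * eta) (var b - var a)"
    using assms(1) by (simp add: sh_kernel_def pole_fac_def)
  have "to_tfrac (var a - var b) * sh_kernel a b = to_tfrac (var b - var a) * TFrac (var a - var b + 2 * eta) (var b - var a)"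
    by (simp add: k to_tfrac_diff algebra_simps)
  also have "\<dots> = to_tfrac (var a - var b + 2 * eta)"
    by (rule to_tfrac_mult_TFrac[OF reg(2)])
  also have "\<dots> = to_tfrac (var a - var b) + 2 * etaf"
    by (simp only: to_tfrac_add to_tfrac_mult etaf_def to_tfrac_of_int[of 2, simplified])
  also have "\<dots> = to_tfrac (var a - var b) + 2 * etaf * (to_tfrac (var a - var b) * TFrac 1 (var a - var b))"
    by (simp add: to_tfrac_mult_TFrac[OF reg(1)])
  also have "\<dots> = to_tfrac (var a - var b) * (1 + 2 * etaf * TFrac 1 (var a - var b))"
    by (simp add: distrib_left mult_ac)
  finally show ?thesis by (rule to_tfrac_cancel[OF reg(1)])
qed

lemma TFrac_inverse_var_diff: "a \<noteq> b \<Longrightarrow> TFrac 1 (var a - var b) * (val a - val b) = 1"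
  using to_tfrac_mult_TFrac[OF regular_var_diff, of a b 1]
  by (simp add: val_def to_tfrac_diff mult.commute)

lemma num_double_arrows_commute: "num_double_arrows Q k l = num_double_arrows Q l k"
  by (simp add: num_double_arrows_def)

text \<open>The numbering of the arrows makes the weights between two vertices run through an arithmetic
  progression, whatever the orientations are.\<close>

lemma arrow_fac_eq:
  assumes kl: "k \<in> verts Q" "l \<in> verts Q" "k \<noteq> l" and N: "N = num_double_arrows Q k l"
  shows "arrow_fac k l x y = (\<Prod>p=1..N. y - x + of_int (int N + 2 - 2 * int p) * eta)"
proof -
  let ?S = "{h \<in> arcs Q. (tail Q h = k \<and> head Q h = l) \<or> (tail Q h = l \<and> head Q h = k)}"
  let ?\<pi> = "\<lambda>h. if tail Q h = k then pos h else N + 1 - pos h"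
  have bij: "bij_betw ?\<pi> ?S {1..N}"
    using bspec[OF bspec[OF numbering[unfolded arrow_numbering_def] kl(1)] kl(2)] unfolding N .
  have "arrow_fac k l x y = (\<Prod>h\<in>?S.
     (if tail Q h = k \<and> head Q h = l then y - x + of_int (weight Q pos h) * eta else 1) *
     (if head Q h = k \<and> tail Q h = l then y - x + of_int (weight_star Q pos h) * eta else 1))"
    unfolding arrow_fac_def
  proof (rule prod.mono_neutral_right)
    show "\<forall>h\<in>arcs Q - ?S.
       (if tail Q h = k \<and> head Q h = l then y - x + of_int (weight Q pos h) * eta else 1) *
       (if head Q h = k \<and> tail Q h = l then y - x + of_int (weight_star Q pos h) * eta else 1) = 1"
    proof
      fix h assume "h \<in> arcs Q - ?S"
      then have "\<not> (tail Q h = k \<and> head Q h = l)" "\<not> (head Q h = k \<and> tail Q h = l)" by blast+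
      then show "(if tail Q h = k \<and> head Q h = l then y - x + of_int (weight Q pos h) * eta else 1) *
         (if head Q h = k \<and> tail Q h = l then y - x + of_int (weight_star Q pos h) * eta else 1) = 1"
        by (simp only: if_False mult_1)
    qed
  qed auto
  also have "\<dots> = (\<Prod>h\<in>?S. y - x + of_int (int N + 2 - 2 * int (?\<pi> h)) * eta)"
  proof (rule prod.cong[OF refl])
    fix h assume h: "h \<in> ?S"
    have "?\<pi> h \<in> {1..N}" using bij h by (rule bij_betw_apply)
    then have pos: "pos h \<le> N" if "tail Q h \<noteq> k" using that by auto
    show "(if tail Q h = k \<and> head Q h = l then y - x + of_int (weight Q pos h) * eta else 1) *
        (if head Q h = k \<and> tail Q h = l then y - x + of_int (weight_star Q pos h) * eta else 1) =
        y - x + of_int (int N + 2 - 2 * int (?\<pi> h)) * eta"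
    proof (cases "tail Q h = k")
      case True
      with h kl(3) have "head Q h = l" by auto
      with True kl(3) show ?thesis by (simp add: weight_def N)
    next
      case False
      with h have "tail Q h = l" "head Q h = k" by auto
      moreover have "weight_star Q pos h = int N + 2 - 2 * int (?\<pi> h)"
        using calculation pos[OF False] False
        by (simp add: weight_star_def N num_double_arrows_commute[of l k] of_nat_diff)
      ultimately show ?thesis using kl(3) by simp
    qed
  qed
  also have "\<dots> = (\<Prod>p=1..N. y - x + of_int (int N + 2 - 2 * int p) * eta)"
    by (rule prod.reindex_bij_betw[OF bij])
  finally show ?thesis .
qed

lemma cartan_eq: "k \<noteq> l \<Longrightarrow> cartan Q k l = - int (num_double_arrows Q k l)"
  by (simp add: cartan_def num_double_arrows_def)

lemma parity_sign_commute:
  assumes "k \<noteq> l"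
  shows "parity_sign l k = (- 1) ^ num_double_arrows Q k l * parity_sign k l"
  using assms by (auto simp: parity_sign_def Cbar_def num_double_arrows_def minus_one_power_iff)

lemma sh_kernel_no_arrows:
  assumes "k \<in> verts Q" "l \<in> verts Q" "k \<noteq> l" and "num_double_arrows Q k l = 0"
    and "fst a = k" "fst b = l"
  shows "sh_kernel a b = sh_kernel b a"
  using assms arrow_fac_eq[of k l 0] arrow_fac_eq[of l k 0] parity_sign_commute[of k l]
  by (simp add: sh_kernel_def pole_fac_def num_double_arrows_commute[of l k])

text \<open>The product of the linear factors that \<open>sh_kernel a b\<close> and \<open>sh_kernel b a\<close> share, together with the
  sign of the former.  The factor with \<open>p = 1\<close> is the one that they do not share.\<close>

definition common_fac :: "'i \<times> nat \<Rightarrow> 'i \<times> nat \<Rightarrow> ('i, 'r) mpol tfrac" where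
  "common_fac a b = (let N = num_double_arrows Q (fst a) (fst b) in parity_sign (fst a) (fst b) *
     to_tfrac (\<Prod>p=2..N. var b - var a + of_int (int N + 2 - 2 * int p) * eta))"

text \<open>The weights in \<open>sh_kernel a b\<close> are \<open>N, N - 2, \<dots>, 2 - N\<close>.  Exchanging the variables negates the
  linear factors up to replacing the weights by \<open>- N, 2 - N, \<dots>, N - 2\<close>, so that only the factors
  with weights \<open>N\<close> and \<open>- N\<close> differ.  The sign \<open>(-1) ^ N\<close> from the negations is the quotient of the two
  parity signs.\<close>

lemma sh_kernel_arrows:
  assumes kl: "k \<in> verts Q" "l \<in> verts Q" "k \<noteq> l" and N: "N = num_double_arrows Q k l" "N > 0"
    and ab: "fst a = k" "fst b = l"
  shows "sh_kernel a b = common_fac a b * (val b - val a + of_nat N * etaf)"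
    and "sh_kernel b a = common_fac a b * (val b - val a - of_nat N * etaf)"
proof -
  define z :: "('i, 'r) mpol" where "z = var b - var a"
  define F :: "('i, 'r) mpol" where "F = (\<Prod>p=2..N. z + of_int (int N + 2 - 2 * int p) * eta)"
  have c: "common_fac a b = parity_sign k l * to_tfrac F"
    by (simp add: common_fac_def Let_def ab F_def z_def flip: N(1))
  have one: "{1..N} = insert 1 {2..N}" using N(2) by auto
  have "arrow_fac k l (var a) (var b) = (\<Prod>p=1..N. z + of_int (int N + 2 - 2 * int p) * eta)"
    using arrow_fac_eq[OF kl N(1)] by (simp add: z_def)
  also have "\<dots> = (z + of_int (int N) * eta) * F"
    unfolding one F_def by (subst prod.insert) auto
  finally have 1: "arrow_fac k l (var a) (var b) = (z + of_int (int N) * eta) * F" .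
  have "arrow_fac l k (var b) (var a) = (\<Prod>p=1..N. - z + of_int (int N + 2 - 2 * int p) * eta)"
    using arrow_fac_eq[of l k N] kl N by (simp add: z_def num_double_arrows_commute[of l k])
  also have "\<dots> = (- z + of_int (int N) * eta) * (\<Prod>p=2..N. - z + of_int (int N + 2 - 2 * int p) * eta)"
    unfolding one by (subst prod.insert) auto
  also have "(\<Prod>p=2..N. - z + of_int (int N + 2 - 2 * int p) * eta) =
      (\<Prod>p=2..N. - z + of_int (int N + 2 - 2 * int (N + 2 - p)) * eta)"
    by (rule prod.reindex_bij_witness[of _ "\<lambda>p. N + 2 - p" "\<lambda>p. N + 2 - p"]) auto
  also have "\<dots> = (\<Prod>p=2..N. (- 1) * (z + of_int (int N + 2 - 2 * int p) * eta))"
  proof (intro prod.cong refl)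
    fix p assume "p \<in> {2..N}"
    then have eq: "int N + 2 - 2 * int (N + 2 - p) = - (int N + 2 - 2 * int p)" by auto
    have "- z + - c * eta = (- 1) * (z + c * eta)" for c by simp
    then show "- z + of_int (int N + 2 - 2 * int (N + 2 - p)) * eta =
        (- 1) * (z + of_int (int N + 2 - 2 * int p) * eta)"
      unfolding eq of_int_minus .
  qed
  also have "\<dots> = (- 1) ^ (N - 1) * F"
    unfolding prod.distrib F_def by simp
  also have "(- z + of_int (int N) * eta) * ((- 1) ^ (N - 1) * F) = (- 1) ^ N * ((z - of_int (int N) * eta) * F)"
    using N(2) by (cases N) (simp_all add: algebra_simps)
  finally have 2: "arrow_fac l k (var b) (var a) = (- 1) ^ N * ((z - of_int (int N) * eta) * F)" .
  have v: "to_tfrac (z + of_int (int N) * eta) = val b - val a + of_nat N * etaf"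
      "to_tfrac (z - of_int (int N) * eta) = val b - val a - of_nat N * etaf"
    by (simp_all only: z_def to_tfrac_add to_tfrac_diff to_tfrac_mult val_def etaf_def of_int_of_nat_eq
        to_tfrac_of_int[of "int N", unfolded of_int_of_nat_eq])
  show "sh_kernel a b = common_fac a b * (val b - val a + of_nat N * etaf)"
    unfolding sh_kernel_def c ab 1 to_tfrac_mult v
    using kl(3) by (simp add: pole_fac_def ab mult_ac)
  have sq: "(- 1) ^ N * ((- 1) ^ N * x) = x" for x :: "('i, 'r) mpol tfrac"
    by (simp add: minus_one_power_iff)
  show "sh_kernel b a = common_fac a b * (val b - val a - of_nat N * etaf)"
    unfolding sh_kernel_def c ab 2 to_tfrac_mult v parity_sign_commute[OF kl(3)] N(1)[symmetric] to_tfrac_power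
    using kl(3) sq by (simp add: pole_fac_def ab mult_ac to_tfrac_uminus)
qed

text \<open>The quadratic relation for two fixed variables: multiplication by \<open>u - v\<close> becomes multiplication by
  the difference of the variables.\<close>

lemma sh_kernel_exchange:
  assumes kl: "k \<in> verts Q" "l \<in> verts Q" and ab: "fst a = k" "fst b = l" "a \<noteq> b"
  shows "sh_kernel a b * (val a - val b - of_int (cartan Q k l) * etaf) =
    sh_kernel b a * (val a - val b + of_int (cartan Q k l) * etaf)"
proof (cases "k = l")
  case True
  define d where "d = val a - val b"
  define i where "i = TFrac 1 (var a - var b :: ('i, 'r) mpol)"
  define j where "j = TFrac 1 (var b - var a :: ('i, 'r) mpol)"
  have ij: "i * d = 1" "j * d = - 1"
  proof -
    show "i * d = 1" using TFrac_inverse_var_diff[of a b] ab by (simp add: i_def d_def)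
    have "j * (- d) = 1" using TFrac_inverse_var_diff[of b a] ab by (simp add: j_def d_def)
    then show "j * d = - 1" by (simp add: minus_equation_iff)
  qed
  have j: "j = - i"
  proof -
    have "j = j * (i * d)" by (simp add: ij)
    also have "\<dots> = i * (j * d)" by (simp add: mult_ac)
    finally show ?thesis by (simp add: ij)
  qed
  have s: "sh_kernel a b = 1 + 2 * etaf * i" "sh_kernel b a = 1 - 2 * etaf * i"
    using sh_kernel_same_colour[of a b] sh_kernel_same_colour[of b a] ab True
    by (simp_all add: i_def[symmetric] j_def[symmetric] j)
  have "sh_kernel a b * (d - 2 * etaf) = d + 2 * etaf * (i * d) - 2 * etaf - 4 * etaf * etaf * i"
    "sh_kernel b a * (d + 2 * etaf) = d - 2 * etaf * (i * d) + 2 * etaf - 4 * etaf * etaf * i"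
    unfolding s by (simp_all add: algebra_simps)
  then show ?thesis using True unfolding ij(1) by (simp add: cartan_def d_def)
next
  case False
  let ?N = "num_double_arrows Q k l"
  show ?thesis
  proof (cases "?N = 0")
    case True
    then show ?thesis
      using sh_kernel_no_arrows[OF kl False True ab(1,2)] False by (simp add: cartan_eq)
  next
    case N: False
    show ?thesis
      unfolding sh_kernel_arrows[OF kl False refl _ ab(1,2), OF N[unfolded neq0_conv]] cartan_eq[OF False]
      by (simp add: algebra_simps)
  qed
qed

text \<open>The sign is the one in \<open>comp_fun\<close>.\<close>

definition gen :: "'i \<Rightarrow> nat \<Rightarrow> 'i \<times> nat \<Rightarrow> ('i, 'r) mpol tfrac" where
  "gen k r x = (if fst x = k then - (val x ^ r) else 0)"

lemma gen_Suc: "gen k (Suc r) x = val x * gen k r x"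
  by (simp add: gen_def)

text \<open>Each of the convolutions is a sum over the variable that carries the generator of colour \<open>k\<close>, and
  the terms with the same variable are matched by \<open>sh_kernel_exchange\<close>.\<close>

lemma conv_quadratic:
  assumes kl: "k \<in> verts Q" "l \<in> verts Q" and U: "finite U"
  defines "X \<equiv> \<lambda>k r. on_singletons (gen k r)" and "c \<equiv> of_int (cartan Q k l) * etaf"
  shows "conv sh_kernel (X k (Suc r)) (X l s) U - conv sh_kernel (X k r) (X l (Suc s)) U
      - c * conv sh_kernel (X k r) (X l s) U
    = conv sh_kernel (X l s) (X k (Suc r)) U - conv sh_kernel (X l (Suc s)) (X k r) U
      + c * conv sh_kernel (X l s) (X k r) U"
  unfolding X_def conv_on_singletons_left[OF U, of sh_kernel "gen k _"]
    conv_on_singletons_right[OF U, of sh_kernel _ "gen k _"]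
    sum_distrib_left sum_subtractf[symmetric] sum.distrib[symmetric]
proof (intro sum.cong refl)
  fix a assume a: "a \<in> U"
  show "gen k (Suc r) a * on_singletons (gen l s) (U - {a}) * (\<Prod>b\<in>U - {a}. sh_kernel a b) -
      gen k r a * on_singletons (gen l (Suc s)) (U - {a}) * (\<Prod>b\<in>U - {a}. sh_kernel a b) -
      c * (gen k r a * on_singletons (gen l s) (U - {a}) * (\<Prod>b\<in>U - {a}. sh_kernel a b)) =
      gen k (Suc r) a * on_singletons (gen l s) (U - {a}) * (\<Prod>b\<in>U - {a}. sh_kernel b a) -
      gen k r a * on_singletons (gen l (Suc s)) (U - {a}) * (\<Prod>b\<in>U - {a}. sh_kernel b a) +
      c * (gen k r a * on_singletons (gen l s) (U - {a}) * (\<Prod>b\<in>U - {a}. sh_kernel b a))"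
  proof (cases "card (U - {a}) = 1 \<and> fst a = k \<and> fst (the_elem (U - {a})) = l")
    case True
    then obtain b where b: "U - {a} = {b}" by (auto simp: card_1_singleton_iff)
    with True have ab: "fst a = k" "fst b = l" "a \<noteq> b" by auto
    have "gen k (Suc r) a * gen l s b * sh_kernel a b - gen k r a * gen l (Suc s) b * sh_kernel a b -
        c * (gen k r a * gen l s b * sh_kernel a b) = gen k r a * gen l s b * (sh_kernel a b * (val a - val b - c))"
      by (simp add: gen_Suc algebra_simps)
    also have "\<dots> = gen k r a * gen l s b * (sh_kernel b a * (val a - val b + c))"
      unfolding c_def sh_kernel_exchange[OF kl ab] ..
    also have "\<dots> = gen k (Suc r) a * gen l s b * sh_kernel b a - gen k r a * gen l (Suc s) b * sh_kernel b a +
        c * (gen k r a * gen l s b * sh_kernel b a)"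
      by (simp add: gen_Suc algebra_simps)
    finally show ?thesis by (simp add: b)
  next
    case False
    then have "gen k r a = 0 \<and> gen k (Suc r) a = 0 \<or>
        on_singletons (gen l s) (U - {a}) = 0 \<and> on_singletons (gen l (Suc s)) (U - {a}) = 0"
      by (auto simp: gen_def on_singletons_def)
    then show ?thesis by auto
  qed
qed

text \<open>Without arrows between the two vertices there is no linear factor to split off from the kernel, but
  then the kernel is symmetric and the generators commute.\<close>

lemma conv_serre:
  assumes kl: "k \<in> verts Q" "l \<in> verts Q" "k \<noteq> l" and U: "finite U"
    and T: "finite T" "card T = Suc (num_double_arrows Q k l)"
  shows "sym_bracket sh_kernel (\<lambda>m. gen k (r m)) (on_singletons (gen l s)) T U = 0"
proof (cases "num_double_arrows Q k l = 0")
  case True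
  then have "card T = 1" using T(2) by simp
  then obtain m where m: "T = {m}" by (rule card_1_singletonE)
  have "gen k (r m) a * on_singletons (gen l s) (U - {a}) *
      ((\<Prod>b\<in>U - {a}. sh_kernel a b) - (\<Prod>b\<in>U - {a}. sh_kernel b a)) = 0" if "a \<in> U" for a
  proof (cases "card (U - {a}) = 1 \<and> fst a = k \<and> fst (the_elem (U - {a})) = l")
    case c: True
    from c obtain b where b: "U - {a} = {b}" by (elim conjE card_1_singletonE)
    with c have "fst a = k" "fst b = l" by simp_all
    then have "sh_kernel a b = sh_kernel b a"
      by (rule sh_kernel_no_arrows[OF kl True])
    then show ?thesis by (simp add: b)
  next
    case False
    then show ?thesis by (auto simp: gen_def on_singletons_def)
  qed
  then show ?thesis
    using sym_bracket_rec[of T U sh_kernel "\<lambda>m. gen k (r m)" "on_singletons (gen l s)"] T U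
    by (simp add: m sym_bracket_empty)
next
  case False
  let ?K = "{x :: 'i \<times> nat. fst x = k}" and ?L = "{x :: 'i \<times> nat. fst x = l}"
  show ?thesis
  proof (rule sym_bracket_eq_0[where K = ?K and L = ?L and l = val and e = "2 * etaf"
        and \<nu> = "\<lambda>a b. TFrac 1 (var a - var b)" and c = common_fac and N = "num_double_arrows Q k l"
        and \<alpha> = "of_nat (num_double_arrows Q k l) * etaf"])
    fix i b assume ib: "i \<in> ?K" "b \<in> ?L"
    show "sh_kernel i b = common_fac i b * (val b - val i + of_nat (num_double_arrows Q k l) * etaf)"
      "sh_kernel b i = common_fac i b * (val b - val i - of_nat (num_double_arrows Q k l) * etaf)"
      using sh_kernel_arrows[OF kl refl, of i b] False ib by auto
  qed (use T U in \<open>auto simp: TFrac_inverse_var_diff sh_kernel_same_colour gen_def\<close>)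
qed

lemma std_unit: "std (Poly_Mapping.single k 1) = {(k, 1)}"
  by (auto simp: std_def lookup_single when_def split: if_splits)

lemma SH_lam_power: "(lam k 1 ^ r :: ('i, 'r) mpol) \<in> SH (Poly_Mapping.single k 1)"
proof -
  have "in_vars (std (Poly_Mapping.single k 1)) (subst (\<lambda>_ _. lam k 1) (lam k 1 ^ r) :: ('i, 'r) mpol)"
    by (rule in_vars_subst) (rule in_vars_lam, unfold std_unit, rule singletonI)
  then have "in_vars (std (Poly_Mapping.single k 1)) (lam k 1 ^ r :: ('i, 'r) mpol)"
    by (simp only: subst_power subst_lam)
  moreover have "subst (\<lambda>i s. lam i (\<sigma> i s)) (lam k 1 ^ r) = (lam k 1 ^ r :: ('i, 'r) mpol)"
    if \<sigma>: "\<forall>i. \<sigma> i permutes {1..lookup (Poly_Mapping.single k 1) i}" for \<sigma>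
  proof -
    have "\<sigma> k permutes {1..1}" using \<sigma>[rule_format, of k] by (simp only: lookup_single_eq)
    then have "\<sigma> k 1 = 1" using permutes_in_image[of "\<sigma> k" "{1..1}" 1] by simp
    then show ?thesis by (simp only: subst_power subst_lam)
  qed
  ultimately show ?thesis unfolding SH_iff by blast
qed

lemma realize_generator:
  assumes U: "finite U"
  shows "realize (Poly_Mapping.single (Poly_Mapping.single k 1) (lam k 1 ^ r)) U = on_singletons (gen k r) U"
proof (cases "dimv U = Poly_Mapping.single k 1")
  case True
  obtain e where e: "enumerates e (Poly_Mapping.single k 1) U"
    using ex_enumerates[OF U] True by metis
  have "U = {(k, e k 1)}"
    using enumerates_imp_image[OF e] unfolding std_unit relabel_def by simp
  moreover have "eval_at (lam k 1 ^ r) U = (lam k (e k 1) ^ r :: ('i, 'r) mpol)"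
    using eval_at_eq[OF SH_lam_power e] by (simp add: subst_power)
  ultimately show ?thesis
    using True U by (simp add: realize_single comp_fun_def gen_def val_def var_def to_tfrac_power)
next
  case False
  have "on_singletons (gen k r) U = 0"
  proof (cases "card U = 1")
    case True
    then obtain a where "U = {a}" by (auto simp: card_1_singleton_iff)
    with False have "fst a \<noteq> k" by (auto simp: dimv_def)
    with \<open>U = {a}\<close> show ?thesis by (simp add: gen_def)
  qed (simp add: on_singletons_def)
  with False show ?thesis by (simp add: realize_single comp_fun_def)
qed

end

section \<open>Quotients of associative algebras\<close>

context
  fixes K :: "('k, 'm) ring_scheme" and A :: "('k, 'a, 'n) module_scheme" and J :: "'a set"
  assumes A: "assoc_algebra K A" and J: "ideal J A"
begin

interpretation A: ring A using A by (simp add: assoc_algebra_def)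
interpretation M: Module.module K A using A by (simp add: assoc_algebra_def)
interpretation J: ideal J A by (rule J)

lemma smult_ideal:
  assumes "c \<in> carrier K" "x \<in> J"
  shows "c \<odot>\<^bsub>A\<^esub> x \<in> J"
proof -
  have x: "x \<in> carrier A" using assms(2) by (rule J.Icarr)
  \<comment> \<open>Scalars act through the algebra.\<close>
  have "c \<odot>\<^bsub>A\<^esub> x = (c \<odot>\<^bsub>A\<^esub> \<one>\<^bsub>A\<^esub>) \<otimes>\<^bsub>A\<^esub> x"
    using A assms(1) x by (simp add: assoc_algebra_def)
  then show ?thesis
    using assms x by (simp add: J.I_l_closed)
qed

lemma algebra_quot_simps:
  "carrier (algebra_quot A J) = a_rcosets\<^bsub>A\<^esub> J"
  "mult (algebra_quot A J) = rcoset_mult A J"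
  "one (algebra_quot A J) = J +>\<^bsub>A\<^esub> \<one>\<^bsub>A\<^esub>"
  "zero (algebra_quot A J) = J"
  "add (algebra_quot A J) = set_add A"
  by (simp_all add: algebra_quot_def FactRing_def ring.defs)

lemma algebra_quot_carrierE:
  assumes "X \<in> carrier (algebra_quot A J)"
  obtains x where "x \<in> carrier A" "X = J +>\<^bsub>A\<^esub> x"
  using assms by (auto simp: algebra_quot_simps A_RCOSETS_def')

lemma coset_in_carrier: "x \<in> carrier A \<Longrightarrow> J +>\<^bsub>A\<^esub> x \<in> carrier (algebra_quot A J)"
  by (auto simp: algebra_quot_simps A_RCOSETS_def')

lemma coset_memE:
  assumes "y \<in> J +>\<^bsub>A\<^esub> x"
  obtains j where "j \<in> J" "y = j \<oplus>\<^bsub>A\<^esub> x"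
  using assms by (auto simp: a_r_coset_def')

lemma coset_add_left:
  assumes "j \<in> J" "x \<in> carrier A"
  shows "J +>\<^bsub>A\<^esub> (j \<oplus>\<^bsub>A\<^esub> x) = J +>\<^bsub>A\<^esub> x"
proof -
  have "j \<oplus>\<^bsub>A\<^esub> x \<in> J +>\<^bsub>A\<^esub> x" using assms(1) by (auto simp: a_r_coset_def')
  then show ?thesis using J.a_repr_independence' assms(2) by blast
qed

lemma smult_coset:
  assumes "c \<in> carrier K" "x \<in> carrier A"
  shows "c \<odot>\<^bsub>algebra_quot A J\<^esub> (J +>\<^bsub>A\<^esub> x) = J +>\<^bsub>A\<^esub> (c \<odot>\<^bsub>A\<^esub> x)"
proof -
  have "J +>\<^bsub>A\<^esub> (c \<odot>\<^bsub>A\<^esub> y) = J +>\<^bsub>A\<^esub> (c \<odot>\<^bsub>A\<^esub> x)" if "y \<in> J +>\<^bsub>A\<^esub> x" for y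
  proof -
    obtain j where j: "j \<in> J" "y = j \<oplus>\<^bsub>A\<^esub> x" using \<open>y \<in> J +>\<^bsub>A\<^esub> x\<close> by (rule coset_memE)
    then have "c \<odot>\<^bsub>A\<^esub> y = c \<odot>\<^bsub>A\<^esub> j \<oplus>\<^bsub>A\<^esub> c \<odot>\<^bsub>A\<^esub> x"
      using assms J.Icarr[OF j(1)] by (simp add: M.smult_r_distr)
    then show ?thesis
      using coset_add_left[OF smult_ideal[OF assms(1) j(1)]] assms by simp
  qed
  moreover have "J +>\<^bsub>A\<^esub> x \<noteq> {}" using J.a_rcos_self[OF assms(2)] by auto
  ultimately show ?thesis
    by (simp add: algebra_quot_def ring.defs)
qed

lemmas coset_simps =
  J.rcoset_mult_add[folded algebra_quot_simps(2)] J.a_rcos_sum[folded algebra_quot_simps(5)] smult_coset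

lemma ring_algebra_quot: "ring (algebra_quot A J)"
proof -
  interpret Q: ring "A Quot J" by (rule J.quotient_is_ring)
  have fields:
    "carrier (algebra_quot A J) = carrier (A Quot J)" "mult (algebra_quot A J) = mult (A Quot J)"
    "one (algebra_quot A J) = one (A Quot J)" "zero (algebra_quot A J) = zero (A Quot J)"
    "add (algebra_quot A J) = add (A Quot J)"
    by (simp_all only: algebra_quot_def ring.defs ring.simps monoid.simps partial_object.simps)
  have "abelian_group (algebra_quot A J)"
    by (rule abelian_groupI; unfold fields)
      (use Q.a_inv_closed Q.l_neg in \<open>auto simp: Q.a_ac\<close>)
  moreover have "Group.monoid (algebra_quot A J)"
    by (rule Group.monoidI; unfold fields) (auto simp: Q.m_assoc)
  ultimately show ?thesis
    by (rule ringI) (unfold fields, simp_all add: Q.l_distr Q.r_distr)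
qed

lemma assoc_algebra_quot: "assoc_algebra K (algebra_quot A J)"
  unfolding assoc_algebra_def
proof (intro conjI ballI)
  show "ring (algebra_quot A J)" by (rule ring_algebra_quot)
  show "Module.module K (algebra_quot A J)"
    by (rule moduleI[OF M.R.is_cring ring.is_abelian_group[OF ring_algebra_quot]])
      (auto elim!: algebra_quot_carrierE
        simp: coset_simps coset_in_carrier M.smult_l_distr M.smult_r_distr M.smult_assoc1)
next
  fix c X Y assume c: "c \<in> carrier K" and "X \<in> carrier (algebra_quot A J)" "Y \<in> carrier (algebra_quot A J)"
  then obtain x y where xy: "x \<in> carrier A" "y \<in> carrier A" "X = J +>\<^bsub>A\<^esub> x" "Y = J +>\<^bsub>A\<^esub> y"
    by (elim algebra_quot_carrierE)
  then show "c \<odot>\<^bsub>algebra_quot A J\<^esub> X \<otimes>\<^bsub>algebra_quot A J\<^esub> Y = c \<odot>\<^bsub>algebra_quot A J\<^esub> (X \<otimes>\<^bsub>algebra_quot A J\<^esub> Y)"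
    "X \<otimes>\<^bsub>algebra_quot A J\<^esub> (c \<odot>\<^bsub>algebra_quot A J\<^esub> Y) = c \<odot>\<^bsub>algebra_quot A J\<^esub> (X \<otimes>\<^bsub>algebra_quot A J\<^esub> Y)"
    using A c by (simp_all add: coset_simps assoc_algebra_def)
qed

lemma algebra_quot_induced_hom:
  assumes hom: "algebra_hom K A B \<psi>" and ker: "\<And>x. x \<in> J \<Longrightarrow> \<psi> x = \<zero>\<^bsub>B\<^esub>"
  shows "\<exists>\<phi>. algebra_hom K (algebra_quot A J) B \<phi> \<and> (\<forall>x\<in>carrier A. \<phi> (J +>\<^bsub>A\<^esub> x) = \<psi> x)"
proof -
  interpret B: ring B using hom by (simp add: algebra_hom_def assoc_algebra_def)
  have \<psi>: "\<psi> \<in> ring_hom A B" using hom by (simp add: algebra_hom_def)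
  define \<phi> where "\<phi> X = the_elem (\<psi> ` X)" for X
  have \<phi>: "\<phi> (J +>\<^bsub>A\<^esub> x) = \<psi> x" if x: "x \<in> carrier A" for x
  proof -
    have "\<psi> y = \<psi> x" if y: "y \<in> J +>\<^bsub>A\<^esub> x" for y
    proof -
      obtain j where j: "j \<in> J" "y = j \<oplus>\<^bsub>A\<^esub> x" using y by (rule coset_memE)
      then show ?thesis
        using ring_hom_add[OF \<psi> J.Icarr[OF j(1)] x] ker[OF j(1)] ring_hom_closed[OF \<psi> x] by simp
    qed
    then have "\<psi> ` (J +>\<^bsub>A\<^esub> x) \<subseteq> {\<psi> x}" by blast
    moreover have "\<psi> x \<in> \<psi> ` (J +>\<^bsub>A\<^esub> x)" using J.a_rcos_self[OF x] by (rule imageI)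
    ultimately have "\<psi> ` (J +>\<^bsub>A\<^esub> x) = {\<psi> x}" by blast
    then show ?thesis by (simp add: \<phi>_def)
  qed
  have "\<phi> \<in> ring_hom (algebra_quot A J) B"
  proof (rule ring_hom_memI)
    fix X assume "X \<in> carrier (algebra_quot A J)"
    then obtain x where x: "x \<in> carrier A" "X = J +>\<^bsub>A\<^esub> x" by (rule algebra_quot_carrierE)
    then show "\<phi> X \<in> carrier B" using ring_hom_closed[OF \<psi>] by (simp add: \<phi>)
    fix Y assume "Y \<in> carrier (algebra_quot A J)"
    then obtain y where y: "y \<in> carrier A" "Y = J +>\<^bsub>A\<^esub> y" by (rule algebra_quot_carrierE)
    show "\<phi> (X \<otimes>\<^bsub>algebra_quot A J\<^esub> Y) = \<phi> X \<otimes>\<^bsub>B\<^esub> \<phi> Y"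
      using x y ring_hom_mult[OF \<psi>] by (simp add: coset_simps \<phi>)
    show "\<phi> (X \<oplus>\<^bsub>algebra_quot A J\<^esub> Y) = \<phi> X \<oplus>\<^bsub>B\<^esub> \<phi> Y"
      using x y ring_hom_add[OF \<psi>] by (simp add: coset_simps \<phi>)
  next
    show "\<phi> \<one>\<^bsub>algebra_quot A J\<^esub> = \<one>\<^bsub>B\<^esub>"
      using ring_hom_one[OF \<psi>] by (simp add: algebra_quot_simps \<phi>)
  qed
  moreover have "\<phi> (c \<odot>\<^bsub>algebra_quot A J\<^esub> X) = c \<odot>\<^bsub>B\<^esub> \<phi> X"
    if c: "c \<in> carrier K" and X: "X \<in> carrier (algebra_quot A J)" for c X
  proof -
    obtain x where x: "x \<in> carrier A" "X = J +>\<^bsub>A\<^esub> x" using X by (rule algebra_quot_carrierE)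
    then show ?thesis using c hom by (simp add: coset_simps \<phi> algebra_hom_def)
  qed
  ultimately have "algebra_hom K (algebra_quot A J) B \<phi>"
    using hom assoc_algebra_quot by (simp add: algebra_hom_def)
  with \<phi> show ?thesis by blast
qed

end

section \<open>The free algebra and its map to the shuffle algebra\<close>

lemma single_const_commute:
  "Poly_Mapping.single 0 c * f = f * (Poly_Mapping.single 0 c :: 'i yfree)"
  by (simp add: mult_eq_sum_single[of "Poly_Mapping.single 0 c"] mult_eq_sum_single[of _ "Poly_Mapping.single 0 c"]
      mult.commute)

context quiver_shuffle
begin

abbreviation FY :: "(rat poly, 'i yfree) module" where
  "FY \<equiv> free_yangian Q"

lemma FY_simps:
  "mult FY = (*)" "one FY = 1" "zero FY = 0" "add FY = (+)" "smult FY = (\<lambda>c f. Poly_Mapping.single 0 c * f)"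
  by (simp_all add: free_yangian_def)

lemma in_FY: "f \<in> carrier FY \<longleftrightarrow> (\<forall>w\<in>keys f. fst ` set (letters w) \<subseteq> verts Q)"
  by (simp add: free_yangian_def)

lemma FY_const: "Poly_Mapping.single 0 c \<in> carrier FY"
  by (simp add: in_FY zero_free_monoid_def)

lemma FY_0: "0 \<in> carrier FY"
  by (simp add: in_FY)

lemma FY_1: "1 \<in> carrier FY"
  using FY_const[of 1] by simp

lemma FY_add: "f \<in> carrier FY \<Longrightarrow> g \<in> carrier FY \<Longrightarrow> f + g \<in> carrier FY"
  using keys_add[of f g] unfolding in_FY by blast

lemma FY_uminus: "f \<in> carrier FY \<Longrightarrow> - f \<in> carrier FY"
  by (simp add: in_FY in_keys_iff)

lemma FY_diff: "f \<in> carrier FY \<Longrightarrow> g \<in> carrier FY \<Longrightarrow> f - g \<in> carrier FY"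
  using FY_add[of f "- g"] FY_uminus[of g] by simp

lemma FY_mult:
  assumes "f \<in> carrier FY" "g \<in> carrier FY"
  shows "f * g \<in> carrier FY"
  unfolding in_FY
proof
  fix w assume "w \<in> keys (f * g)"
  then obtain a b where "w = a + b" "a \<in> keys f" "b \<in> keys g"
    using keys_mult by blast
  then show "fst ` set (letters w) \<subseteq> verts Q"
    using assms by (auto simp: in_FY plus_free_monoid_def)
qed

lemma FY_sum: "(\<And>i. i \<in> I \<Longrightarrow> f i \<in> carrier FY) \<Longrightarrow> sum f I \<in> carrier FY"
  by (induction I rule: infinite_finite_induct) (auto intro: FY_0 FY_add)

lemma FY_xfree: "k \<in> verts Q \<Longrightarrow> xfree k r \<in> carrier FY"
  by (simp add: in_FY xfree_def)

lemma FY_comm: "f \<in> carrier FY \<Longrightarrow> g \<in> carrier FY \<Longrightarrow> comm f g \<in> carrier FY"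
  by (simp add: comm_def FY_diff FY_mult)

lemma ring_FY: "ring FY"
proof (rule ringI)
  show "abelian_group FY"
  proof (rule abelian_groupI)
    fix f assume "f \<in> carrier FY"
    then show "\<exists>g\<in>carrier FY. g \<oplus>\<^bsub>FY\<^esub> f = \<zero>\<^bsub>FY\<^esub>"
      by (intro bexI[of _ "- f"]) (simp_all add: FY_simps FY_uminus)
  qed (simp_all add: FY_simps FY_0 FY_add add_ac)
  show "Group.monoid FY"
    by (rule Group.monoidI) (simp_all add: FY_simps FY_1 FY_mult mult.assoc)
qed (simp_all add: FY_simps distrib_left distrib_right)

lemma assoc_algebra_FY: "assoc_algebra type_ring FY"
  unfolding assoc_algebra_def
proof (intro conjI ballI)
  have single: "Poly_Mapping.single 0 (c * d) = (Poly_Mapping.single 0 c * Poly_Mapping.single 0 d :: 'i yfree)" for c d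
    by (simp add: mult_single)
  show "Module.module type_ring FY"
    by (rule moduleI[OF cring_type_ring ring.is_abelian_group[OF ring_FY]])
      (simp_all add: FY_simps FY_mult FY_const type_ring_def single_add distrib_left distrib_right single mult.assoc)
  show "ring FY" by (rule ring_FY)
  fix c f g
  show "c \<odot>\<^bsub>FY\<^esub> f \<otimes>\<^bsub>FY\<^esub> g = c \<odot>\<^bsub>FY\<^esub> (f \<otimes>\<^bsub>FY\<^esub> g)"
    by (simp add: FY_simps mult.assoc)
  show "f \<otimes>\<^bsub>FY\<^esub> (c \<odot>\<^bsub>FY\<^esub> g) = c \<odot>\<^bsub>FY\<^esub> (f \<otimes>\<^bsub>FY\<^esub> g)"
    unfolding FY_simps by (metis mult.assoc single_const_commute)
qed

interpretation SA: ring SA by (rule ring_SA)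

definition generator :: "'i \<Rightarrow> nat \<Rightarrow> 'i dimvec \<Rightarrow>\<^sub>0 ('i, 'r) mpol" where
  "generator k r = Poly_Mapping.single (Poly_Mapping.single k 1) (lam k 1 ^ r)"

definition word_val :: "('i \<times> nat) list \<Rightarrow> 'i dimvec \<Rightarrow>\<^sub>0 ('i, 'r) mpol" where
  "word_val xs = foldr (\<lambda>(k, r) z. generator k r \<otimes>\<^bsub>SA\<^esub> z) xs \<one>\<^bsub>SA\<^esub>"

definition free_hom :: "'i yfree \<Rightarrow> 'i dimvec \<Rightarrow>\<^sub>0 ('i, 'r) mpol" where
  "free_hom f = (\<Sum>w\<in>keys f. lookup f w \<odot>\<^bsub>SA\<^esub> word_val (letters w))"

lemma generator_SA: "k \<in> verts Q \<Longrightarrow> generator k r \<in> carrier SA"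
  unfolding generator_def by (rule SA_single[OF SH_lam_power]) simp

lemma word_val_SA: "fst ` set xs \<subseteq> verts Q \<Longrightarrow> word_val xs \<in> carrier SA"
  by (induction xs) (auto simp: word_val_def SA_one generator_SA SA_mult)

lemma word_val_append:
  "fst ` set xs \<subseteq> verts Q \<Longrightarrow> fst ` set ys \<subseteq> verts Q \<Longrightarrow>
     word_val (xs @ ys) = word_val xs \<otimes>\<^bsub>SA\<^esub> word_val ys"
proof (induction xs)
  case Nil
  then show ?case using word_val_SA[of ys] by (simp add: word_val_def[of "[]"])
next
  case (Cons x xs)
  have "word_val (x # zs) = generator (fst x) (snd x) \<otimes>\<^bsub>SA\<^esub> word_val zs" for zs
    by (simp add: word_val_def case_prod_unfold)
  with Cons show ?case
    by (simp add: SA.m_assoc generator_SA word_val_SA)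
qed

lemma smult_SA:
  "(c + d) \<odot>\<^bsub>SA\<^esub> F = c \<odot>\<^bsub>SA\<^esub> F + d \<odot>\<^bsub>SA\<^esub> F" "0 \<odot>\<^bsub>SA\<^esub> F = 0" "1 \<odot>\<^bsub>SA\<^esub> F = F"
  "c \<odot>\<^bsub>SA\<^esub> (d \<odot>\<^bsub>SA\<^esub> F) = (c * d) \<odot>\<^bsub>SA\<^esub> F"
  by (rule poly_mapping_eqI, simp add: lookup_smult lookup_add is_homD[OF is_hom_scal] distrib_right mult.assoc)+

lemma mult_SA_sum_left:
  assumes "\<And>i. i \<in> I \<Longrightarrow> F i \<in> carrier SA" "G \<in> carrier SA"
  shows "(\<Sum>i\<in>I. F i) \<otimes>\<^bsub>SA\<^esub> G = (\<Sum>i\<in>I. F i \<otimes>\<^bsub>SA\<^esub> G)"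
  using assms
proof (induction I rule: infinite_finite_induct)
  case (insert i I)
  then show ?case using SA.l_distr[of "F i" "\<Sum>i\<in>I. F i" G] by (simp add: SA_simps(2) SA_sum)
qed (use SA.l_null in \<open>auto simp: SA_simps(1)\<close>)

lemma mult_SA_sum_right:
  assumes "\<And>i. i \<in> I \<Longrightarrow> F i \<in> carrier SA" "G \<in> carrier SA"
  shows "G \<otimes>\<^bsub>SA\<^esub> (\<Sum>i\<in>I. F i) = (\<Sum>i\<in>I. G \<otimes>\<^bsub>SA\<^esub> F i)"
  using assms
proof (induction I rule: infinite_finite_induct)
  case (insert i I)
  then show ?case using SA.r_distr[of "F i" "\<Sum>i\<in>I. F i" G] by (simp add: SA_simps(2) SA_sum)
qed (use SA.r_null in \<open>auto simp: SA_simps(1)\<close>)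

lemma free_hom_superset:
  assumes "finite K" "keys f \<subseteq> K"
  shows "free_hom f = (\<Sum>w\<in>K. lookup f w \<odot>\<^bsub>SA\<^esub> word_val (letters w))"
  unfolding free_hom_def using assms
  by (intro sum.mono_neutral_left) (auto simp: in_keys_iff smult_SA)

lemma free_hom_0: "free_hom 0 = 0"
  by (simp add: free_hom_def)

lemma free_hom_add: "free_hom (f + g) = free_hom f + free_hom g"
  using keys_add[of f g]
  by (simp add: free_hom_superset[of "keys f \<union> keys g"] lookup_add smult_SA sum.distrib)

lemma free_hom_uminus: "free_hom (- f) = - free_hom f"
  using free_hom_add[of f "- f"] by (simp add: free_hom_0 eq_neg_iff_add_eq_0 add.commute)

lemma free_hom_diff: "free_hom (f - g) = free_hom f - free_hom g"
  using free_hom_add[of f "- g"] by (simp add: free_hom_uminus)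

lemma free_hom_sum: "free_hom (sum f I) = (\<Sum>i\<in>I. free_hom (f i))"
  by (induction I rule: infinite_finite_induct) (simp_all add: free_hom_0 free_hom_add)

lemma free_hom_single: "free_hom (Poly_Mapping.single w c) = c \<odot>\<^bsub>SA\<^esub> word_val (letters w)"
  by (simp add: free_hom_superset[of "{w}"])

lemma free_hom_SA: "f \<in> carrier FY \<Longrightarrow> free_hom f \<in> carrier SA"
  unfolding free_hom_def by (intro SA_sum SA_smult word_val_SA) (auto simp: in_FY)

lemma smult_mult_SA:
  assumes "F \<in> carrier SA" "G \<in> carrier SA"
  shows "(c \<odot>\<^bsub>SA\<^esub> F) \<otimes>\<^bsub>SA\<^esub> (d \<odot>\<^bsub>SA\<^esub> G) = (c * d) \<odot>\<^bsub>SA\<^esub> (F \<otimes>\<^bsub>SA\<^esub> G)"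
  using assoc_algebra_SA assms SA_smult by (simp add: assoc_algebra_def type_ring_def smult_SA(4) mult.commute)

lemma free_hom_mult:
  assumes f: "f \<in> carrier FY" and g: "g \<in> carrier FY"
  shows "free_hom (f * g) = free_hom f \<otimes>\<^bsub>SA\<^esub> free_hom g"
proof -
  let ?W = "\<lambda>w. word_val (letters w)"
  have w: "fst ` set (letters w) \<subseteq> verts Q" if "w \<in> keys f \<or> w \<in> keys g" for w
    using that f g by (auto simp: in_FY)
  have W: "?W w \<in> carrier SA" if "w \<in> keys f \<or> w \<in> keys g" for w
    using w[OF that] by (rule word_val_SA)
  have "free_hom (f * g) = (\<Sum>v\<in>keys f. \<Sum>w\<in>keys g.
      (lookup f v * lookup g w) \<odot>\<^bsub>SA\<^esub> ?W (v + w))"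
    by (simp add: mult_eq_sum_single free_hom_sum free_hom_single)
  also have "\<dots> = (\<Sum>v\<in>keys f. \<Sum>w\<in>keys g.
      (lookup f v \<odot>\<^bsub>SA\<^esub> ?W v) \<otimes>\<^bsub>SA\<^esub> (lookup g w \<odot>\<^bsub>SA\<^esub> ?W w))"
    by (intro sum.cong refl) (simp add: smult_mult_SA W w plus_free_monoid_def word_val_append)
  also have "\<dots> = (\<Sum>v\<in>keys f. (lookup f v \<odot>\<^bsub>SA\<^esub> ?W v) \<otimes>\<^bsub>SA\<^esub> free_hom g)"
    unfolding free_hom_def by (intro sum.cong refl mult_SA_sum_right[symmetric]) (auto intro: SA_smult W)
  also have "\<dots> = free_hom f \<otimes>\<^bsub>SA\<^esub> free_hom g"
    unfolding free_hom_def[of f] using free_hom_SA[OF g]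
    by (intro mult_SA_sum_left[symmetric]) (auto intro: SA_smult W)
  finally show ?thesis .
qed

lemma free_hom_const_mult:
  assumes "f \<in> carrier FY"
  shows "free_hom (Poly_Mapping.single 0 c * f) = c \<odot>\<^bsub>SA\<^esub> free_hom f"
proof -
  have "free_hom (Poly_Mapping.single 0 c) = c \<odot>\<^bsub>SA\<^esub> \<one>\<^bsub>SA\<^esub>"
    by (simp add: free_hom_single zero_free_monoid_def word_val_def)
  then have "free_hom (Poly_Mapping.single 0 c * f) = (c \<odot>\<^bsub>SA\<^esub> \<one>\<^bsub>SA\<^esub>) \<otimes>\<^bsub>SA\<^esub> (1 \<odot>\<^bsub>SA\<^esub> free_hom f)"
    by (simp add: free_hom_mult FY_const assms smult_SA)
  then show ?thesis
    using free_hom_SA[OF assms] by (simp add: smult_mult_SA SA_one)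
qed

lemma free_hom_xfree: "k \<in> verts Q \<Longrightarrow> free_hom (xfree k r) = generator k r"
  using generator_SA[of k r] by (simp add: xfree_def free_hom_single word_val_def smult_SA)

lemma algebra_hom_free_hom: "algebra_hom type_ring FY SA free_hom"
  unfolding algebra_hom_def
proof (intro conjI ballI assoc_algebra_FY assoc_algebra_SA)
  show "free_hom \<in> ring_hom FY SA"
  proof (rule ring_hom_memI)
    show "free_hom \<one>\<^bsub>FY\<^esub> = \<one>\<^bsub>SA\<^esub>"
      using free_hom_single[of 0 1] unfolding single_one FY_simps
      by (simp add: zero_free_monoid_def word_val_def smult_SA)
  qed (simp_all add: free_hom_SA FY_simps free_hom_mult free_hom_add SA_simps)
  show "free_hom (c \<odot>\<^bsub>FY\<^esub> f) = c \<odot>\<^bsub>SA\<^esub> free_hom f" if "f \<in> carrier FY" for c f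
    using that by (simp add: FY_simps free_hom_const_mult)
qed

section \<open>The Yangian relations in the shuffle algebra\<close>

lemma realize_diff: "realize (F - G) U = realize F U - realize G U"
  using realize_add[of F "- G"] by (simp add: realize_uminus)

lemma realize_xfree:
  "k \<in> verts Q \<Longrightarrow> finite U \<Longrightarrow> realize (free_hom (xfree k r)) U = on_singletons (gen k r) U"
  by (simp only: free_hom_xfree generator_def realize_generator)

lemma realize_xfree_mult:
  assumes "k \<in> verts Q" "l \<in> verts Q" "finite U"
  shows "realize (free_hom (xfree k r * xfree l s)) U = conv sh_kernel (on_singletons (gen k r)) (on_singletons (gen l s)) U"
proof -
  have "realize (free_hom (xfree k r * xfree l s)) U =
      conv sh_kernel (realize (free_hom (xfree k r))) (realize (free_hom (xfree l s))) U"
    using assms by (simp add: free_hom_mult FY_xfree realize_mult free_hom_SA)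
  also have "\<dots> = conv sh_kernel (on_singletons (gen k r)) (on_singletons (gen l s)) U"
    using assms by (intro conv_cong realize_xfree) (auto intro: finite_subset)
  finally show ?thesis .
qed

lemma free_hom_quad_rel:
  assumes kl: "k \<in> verts Q" "l \<in> verts Q"
  shows "free_hom (quad_rel Q k l m n) = 0"
proof -
  \<comment> \<open>For \<open>m = 0\<close> or \<open>n = 0\<close> the commutators in the relation cancel the remaining products, and for
    positive \<open>m\<close> or \<open>n\<close> all terms are 0.\<close>
  consider "m < 0 \<and> n < 0" | "m = 0" | "n = 0" | "m > 0" | "n > 0" by linarith
  then show ?thesis
  proof cases
    case 1
    define r s where "r = nat (- m - 1)" and "s = nat (- n - 1)"
    then have m: "m = - int r - 1" and n: "n = - int s - 1"
      using 1 by simp_all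
    have x: "xser i (- int t - 1) = xfree i t" "xser i (- int t - 1 - 1) = xfree i (Suc t)" for i t
      by (simp_all add: xser_def nat_add_distrib)
    define c where "c = Polynomial.smult (of_int (cartan Q k l) / 2) hbar"
    let ?hc = "Poly_Mapping.single 0 c"
    have q: "quad_rel Q k l m n = (xfree k (Suc r) * xfree l s - xfree k r * xfree l (Suc s) - ?hc * (xfree k r * xfree l s)) -
       (xfree l s * xfree k (Suc r) - xfree l (Suc s) * xfree k r + ?hc * (xfree l s * xfree k r))"
      unfolding quad_rel_def Let_def m n x c_def[symmetric] mult.assoc by simp
    have c: "to_tfrac (scal q c) = of_int (cartan Q k l) * etaf"
      by (simp add: c_def scal_smult_hbar to_tfrac_mult to_tfrac_of_int etaf_def)
    show ?thesis
    proof (rule realize_inj)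
      show "free_hom (quad_rel Q k l m n) \<in> carrier SA"
        unfolding q using kl by (intro free_hom_SA FY_diff FY_add FY_mult FY_const FY_xfree)
      show "0 \<in> carrier SA" by (rule SA_0)
      fix U :: "('i \<times> nat) set" assume U: "finite U"
      have FY: "xfree k r * xfree l s \<in> carrier FY" "xfree l s * xfree k r \<in> carrier FY"
        using kl by (simp_all add: FY_mult FY_xfree)
      show "realize (free_hom (quad_rel Q k l m n)) U = realize 0 U"
        unfolding q free_hom_diff free_hom_add free_hom_const_mult[OF FY(1)] free_hom_const_mult[OF FY(2)]
          realize_diff realize_add realize_smult realize_xfree_mult[OF kl U] realize_xfree_mult[OF kl(2,1) U]
          c realize_0
        using conv_quadratic[OF kl U, of r s] by simp
    qed
  next
    case 2
    then show ?thesis by (simp add: quad_rel_def Let_def xser_def comm_def free_hom_0)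
  next
    case 3
    then show ?thesis by (simp add: quad_rel_def Let_def xser_def comm_def free_hom_0)
  next
    case 4
    then show ?thesis by (simp add: quad_rel_def Let_def xser_def comm_def free_hom_0)
  next
    case 5
    then show ?thesis by (simp add: quad_rel_def Let_def xser_def comm_def free_hom_0)
  qed
qed

lemma quad_rel_FY:
  assumes kl: "k \<in> verts Q" "l \<in> verts Q"
  shows "quad_rel Q k l m n \<in> carrier FY"
proof -
  have x: "xser i t \<in> carrier FY" if "i \<in> verts Q" for i t
    using that by (simp add: xser_def FY_xfree FY_0)
  show ?thesis
    unfolding quad_rel_def Let_def
    using kl by (auto intro!: FY_diff FY_add FY_mult FY_const FY_comm x FY_xfree FY_0)
qed

lemma nested_comm:
  fixes r :: "nat \<Rightarrow> nat" and s :: nat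
  assumes kl: "k \<in> verts Q" "l \<in> verts Q"
  defines "C \<equiv> \<lambda>ms. foldr (\<lambda>m z. comm (xfree k (r m)) z) ms (xfree l s)"
  shows "C ms \<in> carrier FY"
    and "finite U \<Longrightarrow> realize (free_hom (C ms)) U =
      foldr (\<lambda>m. bracket sh_kernel (on_singletons (gen k (r m)))) ms (on_singletons (gen l s)) U"
proof -
  show C: "C ms \<in> carrier FY" for ms
    by (induction ms) (simp_all add: C_def FY_xfree FY_comm kl)
  show "realize (free_hom (C ms)) U =
      foldr (\<lambda>m. bracket sh_kernel (on_singletons (gen k (r m)))) ms (on_singletons (gen l s)) U"
    if "finite U"
    using that
  proof (induction ms arbitrary: U)
    case Nil
    then show ?case by (simp add: C_def realize_xfree kl)
  next
    case (Cons m ms)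
    let ?B = "foldr (\<lambda>m. bracket sh_kernel (on_singletons (gen k (r m)))) ms (on_singletons (gen l s))"
    let ?x = "xfree k (r m)"
    have sub: "finite A" if "A \<subseteq> U" for A using that Cons.prems by (rule finite_subset)
    have eq: "C (m # ms) = ?x * C ms - C ms * ?x" by (simp add: C_def comm_def)
    have x: "?x \<in> carrier FY" using kl by (simp add: FY_xfree)
    have "realize (free_hom (C (m # ms))) U =
        bracket sh_kernel (realize (free_hom ?x)) (realize (free_hom (C ms))) U"
      unfolding eq free_hom_diff realize_diff bracket_def
      using Cons.prems x C[of ms] by (simp add: free_hom_mult realize_mult free_hom_SA)
    also have "\<dots> = bracket sh_kernel (on_singletons (gen k (r m))) ?B U"
      by (intro bracket_cong realize_xfree[OF kl(1)] Cons.IH sub)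
    finally show ?case by simp
  qed
qed

text \<open>The Serre relation sums over permutations as functions, the symmetrised bracket over permutations
  as lists, for which the recursion on the first entry is available.\<close>

lemma bij_betw_map_permutations:
  "bij_betw (\<lambda>\<sigma>. map \<sigma> [1..<Suc n]) {\<sigma>. \<sigma> permutes {1..n}} (permutations_of_set {1..n})"
proof (rule bij_betwI')
  fix \<sigma> \<tau> assume "\<sigma> \<in> {\<sigma>. \<sigma> permutes {1..n}}" "\<tau> \<in> {\<sigma>. \<sigma> permutes {1..n}}"
  then have p: "\<sigma> permutes {1..n}" "\<tau> permutes {1..n}" by auto
  show "map \<sigma> [1..<Suc n] = map \<tau> [1..<Suc n] \<longleftrightarrow> \<sigma> = \<tau>"
  proof
    assume "map \<sigma> [1..<Suc n] = map \<tau> [1..<Suc n]"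
    then have "\<forall>i\<in>{1..n}. \<sigma> i = \<tau> i" by auto
    then show "\<sigma> = \<tau>" using p by (metis permutes_not_in ext)
  qed simp
next
  fix \<sigma> assume "\<sigma> \<in> {\<sigma>. \<sigma> permutes {1..n}}"
  then have p: "\<sigma> permutes {1..n}" by simp
  have "set (map \<sigma> [1..<Suc n]) = \<sigma> ` {1..n}"
    by (simp only: set_map set_upt atLeastLessThanSuc_atLeastAtMost)
  moreover have "distinct (map \<sigma> [1..<Suc n])"
    using permutes_inj_on[OF p] by (simp only: distinct_map distinct_upt)
  ultimately show "map \<sigma> [1..<Suc n] \<in> permutations_of_set {1..n}"
    using permutes_image[OF p] by (intro permutations_of_setI) simp_all
next
  fix ms assume "ms \<in> permutations_of_set {1..n}"
  then have ms: "set ms = {1..n}" "distinct ms" by (simp_all add: permutations_of_setD)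
  then have len: "length ms = n" using distinct_card[of ms] by simp
  define \<sigma> where "\<sigma> i = (if i \<in> {1..n} then ms ! (i - 1) else i)" for i
  have map: "map \<sigma> [1..<Suc n] = ms"
    by (rule nth_equalityI) (simp_all add: len \<sigma>_def del: upt_Suc)
  then have im: "\<sigma> ` {1..n} = {1..n}"
    using ms(1) by (metis set_map set_upt atLeastLessThanSuc_atLeastAtMost)
  have "\<sigma> permutes {1..n}"
  proof (rule bij_imp_permutes)
    show "bij_betw \<sigma> {1..n} {1..n}"
      unfolding bij_betw_def using im by (simp add: finite_surj_inj eq_card_imp_inj_on)
  qed (auto simp: \<sigma>_def)
  with map show "\<exists>\<sigma>\<in>{\<sigma>. \<sigma> permutes {1..n}}. ms = map \<sigma> [1..<Suc n]" by blast
qed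

lemma serre_rel_eq:
  "serre_rel Q k l r s = (\<Sum>ms\<in>permutations_of_set {1..nat (1 - cartan Q k l)}.
     foldr (\<lambda>m z. comm (xfree k (r m)) z) ms (xfree l s))"
proof -
  let ?n = "nat (1 - cartan Q k l)"
  have "serre_rel Q k l r s = (\<Sum>\<sigma> | \<sigma> permutes {1..?n}.
      foldr (\<lambda>m z. comm (xfree k (r m)) z) (map \<sigma> [1..<Suc ?n]) (xfree l s))"
    unfolding serre_rel_def Let_def foldr_map comp_def ..
  also have "\<dots> = (\<Sum>ms\<in>permutations_of_set {1..?n}. foldr (\<lambda>m z. comm (xfree k (r m)) z) ms (xfree l s))"
    by (rule sum.reindex_bij_betw[OF bij_betw_map_permutations])
  finally show ?thesis .
qed

lemma serre_rel_FY: "k \<in> verts Q \<Longrightarrow> l \<in> verts Q \<Longrightarrow> serre_rel Q k l r s \<in> carrier FY"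
  unfolding serre_rel_eq by (intro FY_sum nested_comm(1))

lemma free_hom_serre_rel:
  assumes kl: "k \<in> verts Q" "l \<in> verts Q" "k \<noteq> l"
  shows "free_hom (serre_rel Q k l r s) = 0"
proof (rule realize_inj)
  show "free_hom (serre_rel Q k l r s) \<in> carrier SA"
    by (intro free_hom_SA serre_rel_FY kl)
  show "0 \<in> carrier SA" by (rule SA_0)
  fix U :: "('i \<times> nat) set" assume U: "finite U"
  let ?T = "{1..nat (1 - cartan Q k l)}"
  have "realize (free_hom (serre_rel Q k l r s)) U = sym_bracket sh_kernel (\<lambda>m. gen k (r m)) (on_singletons (gen l s)) ?T U"
    unfolding serre_rel_eq free_hom_sum realize_sum sym_bracket_def nested_comm(2)[OF kl(1,2) U] ..
  also have "\<dots> = 0"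
    by (rule conv_serre[OF kl U]) (simp_all add: cartan_eq[OF kl(3)] nat_add_distrib)
  finally show "realize (free_hom (serre_rel Q k l r s)) U = realize 0 U"
    by (simp add: realize_0)
qed

lemma yangian_rels_FY: "yangian_rels Q \<subseteq> carrier FY"
  unfolding yangian_rels_def using quad_rel_FY serre_rel_FY by blast

lemma ideal_yangian_ideal: "ideal (yangian_ideal Q) FY"
  unfolding yangian_ideal_def by (rule ring.genideal_ideal[OF ring_FY yangian_rels_FY])

lemma free_hom_yangian_ideal:
  assumes "x \<in> yangian_ideal Q"
  shows "free_hom x = 0"
proof -
  have "ring_hom_ring FY SA free_hom"
    using algebra_hom_free_hom by (intro ring_hom_ringI2 ring_FY ring_SA) (simp add: algebra_hom_def)
  then have "ideal (a_kernel FY SA free_hom) FY"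
    by (rule ring_hom_ring.kernel_is_ideal)
  moreover have "yangian_rels Q \<subseteq> a_kernel FY SA free_hom"
    using quad_rel_FY serre_rel_FY free_hom_quad_rel free_hom_serre_rel
    by (auto simp: a_kernel_def' SA_simps yangian_rels_def)
  ultimately have "yangian_ideal Q \<subseteq> a_kernel FY SA free_hom"
    unfolding yangian_ideal_def by (rule ring.genideal_minimal[OF ring_FY])
  with assms show ?thesis by (auto simp: a_kernel_def' SA_simps)
qed

end

theorem theorem8p1:
  fixes q :: "rat \<Rightarrow> 'r::comm_ring_1"
    and Q :: "('i, 'h) pre_digraph"
    and pos :: "'h \<Rightarrow> nat"
  assumes "q \<in> ring_hom type_ring type_ring"
    and "fin_digraph Q" and "loopfree_digraph Q"
    and "arrow_numbering Q pos"
  shows "\<exists>\<phi>. algebra_hom type_ring (yangian Q) (shuffle_algebra q Q pos) \<phi> \<and>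
           (\<forall>k\<in>verts Q. \<forall>r::nat.
              \<phi> (xgen Q k r) = Poly_Mapping.single (Poly_Mapping.single k 1) (lam k 1 ^ r))"
proof -
  interpret quiver_shuffle q Q pos
    using assms by (rule quiver_shuffle.intro)
  obtain \<phi> where \<phi>: "algebra_hom type_ring (yangian Q) SA \<phi>"
      "\<And>x. x \<in> carrier FY \<Longrightarrow> \<phi> (yangian_ideal Q +>\<^bsub>FY\<^esub> x) = free_hom x"
    using algebra_quot_induced_hom[OF assoc_algebra_FY ideal_yangian_ideal algebra_hom_free_hom]
      free_hom_yangian_ideal unfolding yangian_def SA_simps by blast
  have "\<phi> (xgen Q k r) = Poly_Mapping.single (Poly_Mapping.single k 1) (lam k 1 ^ r)" if "k \<in> verts Q" for k r
    using \<phi>(2)[OF FY_xfree[OF that]] that by (simp add: xgen_def free_hom_xfree generator_def)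
  with \<phi>(1) show ?thesis by blast
qed

end
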